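(* Let $g$, $g'\in\mathrm{Aut}(S(\mathbb{R})/\pi)$ be of order $2$. Then $g$ and $g'$ are conjugate in $\mathrm{Bir}(S/\pi)$ if and only if they are conjugate in $\mathrm{Aut}(S(\mathbb{R})/\pi)$.
   Context: $S\subset\mathbb{P}^3_{\mathbb{R}}$ is the real projective surface $w^2=x^2+y^2+z^2$, and $\pi\colon S\dashrightarrow\mathbb{P}^1$ is $(w:x:y:z)\mapsto(w:z)$. $\mathrm{Bir}(S/\pi)$ is the group of birational maps $g\colon S\dashrightarrow S$ defined over $\mathbb{R}$ with $\pi g=\pi$. $\mathrm{Aut}(S(\mathbb{R})/\pi)$ is the subgroup of those $g\in\mathrm{Bir}(S/\pi)$ such that $g$ and $g^{-1}$ are defined at every real point of $S$. *)

theory Defs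
  imports "HOL-Analysis.Analysis" "HOL-Algebra.Multiplicative_Group"
begin

text \<open>
  A vector \<open>v :: real ^ 4\<close> holds the homogeneous coordinates \<open>(w, x, y, z)\<close> in this order, at the
  indices 1, 2, 3, 4. As the real field is infinite, polynomials in \<open>w, x, y, z\<close> with real
  coefficients are identified with the functions they define on \<open>real ^ 4\<close>.
\<close>

definition form :: "nat \<Rightarrow> (real ^ 4 \<Rightarrow> real) \<Rightarrow> bool" where
  "form d f \<longleftrightarrow>
     (\<exists>c :: (4 \<Rightarrow> nat) \<Rightarrow> real.
        \<forall>v. f v = (\<Sum>a | (\<Sum>i\<in>UNIV. a i) = d. c a * (\<Prod>i\<in>UNIV. (v $ i) ^ a i)))"

definition quadric :: "real ^ 4 \<Rightarrow> real" where
  "quadric v = (v $ 1)\<^sup>2 - ((v $ 2)\<^sup>2 + (v $ 3)\<^sup>2 + (v $ 4)\<^sup>2)"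

text \<open>
  Vanishing on the surface \<open>S\<close> means vanishing in its homogeneous coordinate ring, that is,
  membership in the principal ideal generated by the equation of \<open>S\<close>.
\<close>

definition zero_on_S :: "(real ^ 4 \<Rightarrow> real) \<Rightarrow> bool" where
  "zero_on_S f \<longleftrightarrow>
     (\<exists>h. real_polynomial_function h \<and> (\<forall>v. f v = quadric v * h v))"

text \<open>
  A rational map from \<open>S\<close> to a real projective space is represented by a tuple of forms of one
  common degree that do not all vanish on \<open>S\<close>; two tuples represent the same map iff they are
  proportional over the coordinate ring, that is, all their 2-by-2 minors vanish on \<open>S\<close>.
\<close>

definition rat_rep :: "(real ^ 4 \<Rightarrow> real ^ 'n) \<Rightarrow> bool" where
  "rat_rep F \<longleftrightarrow>
     (\<exists>d. \<forall>i. form d (\<lambda>v. F v $ i)) \<and> (\<exists>i. \<not> zero_on_S (\<lambda>v. F v $ i))"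

definition rat_eq :: "(real ^ 4 \<Rightarrow> real ^ 'n) \<Rightarrow> (real ^ 4 \<Rightarrow> real ^ 'n) \<Rightarrow> bool" where
  "rat_eq F G \<longleftrightarrow>
     rat_rep F \<and> rat_rep G \<and> (\<forall>i j. zero_on_S (\<lambda>v. F v $ i * G v $ j - F v $ j * G v $ i))"

definition self_reps :: "(real ^ 4 \<Rightarrow> real ^ 4) set" where
  "self_reps = {F. rat_rep F \<and> zero_on_S (quadric \<circ> F)}"

definition self_rel :: "(real ^ 4 \<Rightarrow> real ^ 4) rel" where
  "self_rel = {(F, G). F \<in> self_reps \<and> G \<in> self_reps \<and> rat_eq F G}"

text \<open>A rational map from \<open>S\<close> to itself is the set of all its representatives.\<close>

type_synonym rational_map = "(real ^ 4 \<Rightarrow> real ^ 4) set"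

definition rational_maps :: "rational_map set" where
  "rational_maps = self_reps // self_rel"

definition rat_id :: rational_map where
  "rat_id = self_rel `` {id}"

text \<open>
  Substituting representatives gives a representative of the composite unless the result vanishes
  identically on \<open>S\<close>; in that case it lies outside \<open>self_reps\<close> and contributes nothing to the union.
  The composite is thus empty, hence not a rational map, if it is undefined for all choices of
  representatives.
\<close>

definition rat_comp :: "rational_map \<Rightarrow> rational_map \<Rightarrow> rational_map" where
  "rat_comp A B = (\<Union>F\<in>A. \<Union>G\<in>B. self_rel `` {F \<circ> G})"

definition birational :: "rational_map \<Rightarrow> bool" where
  "birational A \<longleftrightarrow>
     A \<in> rational_maps \<and> (\<exists>B\<in>rational_maps. rat_comp A B = rat_id \<and> rat_comp B A = rat_id)"

text \<open>The rational map \<open>(w : x : y : z) \<mapsto> (w : z)\<close>.\<close>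

definition proj :: "real ^ 4 \<Rightarrow> real ^ 2" where
  "proj v = vector [v $ 1, v $ 4]"

definition Bir_S :: "rational_map monoid" where
  "Bir_S = \<lparr>carrier = {A. birational A \<and> (\<forall>F\<in>A. rat_eq (proj \<circ> F) proj)},
            monoid.mult = rat_comp, one = rat_id\<rparr>"

text \<open>
  A rational map is defined at a point iff it has a representative not all of whose components
  vanish there; the representative may depend on the point.
\<close>

definition defined_at :: "rational_map \<Rightarrow> real ^ 4 \<Rightarrow> bool" where
  "defined_at A p \<longleftrightarrow> (\<exists>F\<in>A. F p \<noteq> 0)"

definition regular_on_real_points :: "rational_map \<Rightarrow> bool" where
  "regular_on_real_points A \<longleftrightarrow> (\<forall>p. p \<noteq> 0 \<and> quadric p = 0 \<longrightarrow> defined_at A p)"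

definition Aut_SR :: "rational_map monoid" where
  "Aut_SR = Bir_S\<lparr>carrier := {A \<in> carrier Bir_S.
     regular_on_real_points A \<and> regular_on_real_points (inv\<^bsub>Bir_S\<^esub> A)}\<rparr>"

definition conjugate_in :: "('a, 'b) monoid_scheme \<Rightarrow> 'a \<Rightarrow> 'a \<Rightarrow> bool" where
  "conjugate_in G a b \<longleftrightarrow> (\<exists>h\<in>carrier G. b = h \<otimes>\<^bsub>G\<^esub> a \<otimes>\<^bsub>G\<^esub> inv\<^bsub>G\<^esub> h)"

end

theory Submission
  imports Defs "HOL-Computational_Algebra.Polynomial_Factorial" "HOL-Computational_Algebra.Field_as_Ring"
begin

text \<open>
  Put \<open>u = x + \<i> y\<close>, \<open>t = z\<close> and \<open>f = 1 - t\<^sup>2\<close> on the unit sphere \<open>w = 1\<close>. The elements of \<open>Bir_S\<close> are the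
  fibrewise Moebius transformations \<open>u \<mapsto> (a u + b f) / (cnj b u + cnj a)\<close>, that is, the classes modulo
  \<open>\<real>(t)\<close> of the invertible quaternions \<open>a + b j\<close> with \<open>j\<^sup>2 = f\<close>, of norm \<open>a cnj a - f b cnj b\<close>. Involutions are
  the classes of trace zero, and two of them are conjugate in \<open>Bir_S\<close> only if their norms agree up to
  squares. If the involutions are regular at all real points, the norms of primitive representatives do not
  vanish for \<open>-1 < t < 1\<close>, so both can be rescaled there to have equal norms. Every element \<open>\<xi> x + y \<xi>\<close> then
  conjugates \<open>x\<close> into \<open>y\<close>, and \<open>\<xi>\<close> can be chosen such that its norm has no zero for \<open>-1 < t < 1\<close>: for
  positive norms and suitable signs \<open>\<xi> = 1\<close> works, for negative norms one approximates a continuous solution on \<open>[-1, 1]\<close>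
  by polynomials.
\<close>

section \<open>Forms and polynomial functions on the sphere\<close>

text \<open>Write N for the norm. If x^2 = y^2, then y (\<xi> x + y \<xi>) = (\<xi> x + y \<xi>) x.
  A quaternion x of trace zero has x^2 = -N(x), so equal norms are enough, and norms that agree up
  to squares become equal after rescaling, which does not change the classes. What remains is the
  freedom in \<xi>, and it must make the conjugating element regular.

  The obstacle sits at t = -1 and t = 1. There f = 0 and the real fibre shrinks to a point; regular
  maps are constructed from quaternions with N > 0 on the closed interval, whereas injectivity on
  real fibres controls the involutions only on the open one. Positive norms stay positive at the
  ends because the representatives are primitive. Negative norms vanish at the ends and are
  divisible by f; splitting off j, the reflection u -> cnj u of norm -f, leads back to a positive
  norm.

  That fibred birational maps are Moebius transformations is shown without function fields: the
  inverse map yields a polynomial relation for the image coordinate with coefficients linear in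
  u.\<close>

lemma vector_4 [simp]:
  "(vector [a, b, c, d] :: ('a::zero) ^ 4) $ 1 = a"
  "(vector [a, b, c, d] :: ('a::zero) ^ 4) $ 2 = b"
  "(vector [a, b, c, d] :: ('a::zero) ^ 4) $ 3 = c"
  "(vector [a, b, c, d] :: ('a::zero) ^ 4) $ 4 = d"
  unfolding vector_def by simp_all

lemma finite_multi_indices: "finite {a :: 'a::finite \<Rightarrow> nat. (\<Sum>i\<in>UNIV. a i) = d}"
proof (rule finite_subset)
  show "{a :: 'a \<Rightarrow> nat. (\<Sum>i\<in>UNIV. a i) = d} \<subseteq> (UNIV \<rightarrow>\<^sub>E {..d})"
    by (auto simp: PiE_def Pi_def member_le_sum)
  show "finite ((UNIV :: 'a set) \<rightarrow>\<^sub>E {..d})"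
    by (intro finite_PiE) auto
qed

lemma form_0: "form d (\<lambda>v. 0)"
  unfolding form_def by (rule exI[of _ "\<lambda>_. 0"]) simp

lemma form_add:
  assumes "form d f" "form d g"
  shows "form d (\<lambda>v. f v + g v)"
proof -
  obtain c e where "\<And>v. f v = (\<Sum>a | (\<Sum>i\<in>UNIV. a i) = d. c a * (\<Prod>i\<in>UNIV. (v $ i) ^ a i))"
    and "\<And>v. g v = (\<Sum>a | (\<Sum>i\<in>UNIV. a i) = d. e a * (\<Prod>i\<in>UNIV. (v $ i) ^ a i))"
    using assms unfolding form_def by blast
  then show ?thesis unfolding form_def
    by (intro exI[of _ "\<lambda>a. c a + e a"]) (simp add: sum.distrib algebra_simps)
qed

lemma form_cmult:
  assumes "form d f"
  shows "form d (\<lambda>v. k * f v)"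
proof -
  obtain c where "\<And>v. f v = (\<Sum>a | (\<Sum>i\<in>UNIV. a i) = d. c a * (\<Prod>i\<in>UNIV. (v $ i) ^ a i))"
    using assms unfolding form_def by blast
  then show ?thesis unfolding form_def
    by (intro exI[of _ "\<lambda>a. k * c a"]) (simp add: sum_distrib_left algebra_simps)
qed

lemma form_diff:
  assumes "form d f" "form d g"
  shows "form d (\<lambda>v. f v - g v)"
  using form_add[OF assms(1) form_cmult[OF assms(2), of "-1"]] by simp

lemma form_monomial:
  assumes "(\<Sum>i\<in>UNIV. b i) = d"
  shows "form d (\<lambda>v. \<Prod>i\<in>UNIV. (v $ i) ^ b i)"
  unfolding form_def
proof (intro exI[of _ "\<lambda>a. if a = b then 1 else 0"] allI)
  fix v :: "real ^ 4"
  have "(\<Sum>a | (\<Sum>i\<in>UNIV. a i) = d. (if a = b then 1 else 0) * (\<Prod>i\<in>UNIV. (v $ i) ^ a i))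
      = (\<Sum>a | (\<Sum>i\<in>UNIV. a i) = d. if a = b then (\<Prod>i\<in>UNIV. (v $ i) ^ b i) else 0)"
    by (intro sum.cong) auto
  also have "\<dots> = (\<Prod>i\<in>UNIV. (v $ i) ^ b i)"
    using assms finite_multi_indices by (subst sum.delta) auto
  finally show "(\<Prod>i\<in>UNIV. (v $ i) ^ b i)
    = (\<Sum>a | (\<Sum>i\<in>UNIV. a i) = d. (if a = b then 1 else 0) * (\<Prod>i\<in>UNIV. (v $ i) ^ a i))" ..
qed

lemma form_sum:
  assumes "finite I" "\<And>i. i \<in> I \<Longrightarrow> form d (f i)"
  shows "form d (\<lambda>v. \<Sum>i\<in>I. f i v)"
  using assms by (induction I rule: finite_induct) (auto simp: form_0 intro: form_add)

lemma form_mult: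
  assumes "form d f" "form e g"
  shows "form (d + e) (\<lambda>v. f v * g v)"
proof -
  obtain c k where f: "\<And>v. f v = (\<Sum>a | (\<Sum>i\<in>UNIV. a i) = d. c a * (\<Prod>i\<in>UNIV. (v $ i) ^ a i))"
    and g: "\<And>v. g v = (\<Sum>a | (\<Sum>i\<in>UNIV. a i) = e. k a * (\<Prod>i\<in>UNIV. (v $ i) ^ a i))"
    using assms unfolding form_def by blast
  have "(\<lambda>v. f v * g v) = (\<lambda>v. \<Sum>a | (\<Sum>i\<in>UNIV. a i) = d. \<Sum>b | (\<Sum>i\<in>UNIV. b i) = e.
      (c a * k b) * (\<Prod>i\<in>UNIV. (v $ i) ^ (a i + b i)))"
    unfolding f g sum_product by (simp add: power_add prod.distrib algebra_simps)
  moreover have "form (d + e) \<dots>"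
    by (intro form_sum form_cmult form_monomial finite_multi_indices) (auto simp: sum.distrib)
  ultimately show ?thesis by simp
qed

lemma form_const: "form 0 (\<lambda>v. c)"
  using form_cmult[OF form_monomial[of "\<lambda>_. 0" 0], of c] by simp

lemma form_nth: "form 1 (\<lambda>v. v $ i)"
proof -
  have "(\<Prod>j\<in>UNIV. (v $ j) ^ (if j = i then 1 else 0)) = v $ i" for v :: "real ^ 4"
  proof -
    have "(\<Prod>j\<in>UNIV. (v $ j) ^ (if j = i then 1 else 0)) = (\<Prod>j\<in>UNIV. if j = i then v $ j else 1)"
      by (intro prod.cong) auto
    then show ?thesis by simp
  qed
  then show ?thesis using form_monomial[of "\<lambda>j. if j = i then 1 else 0" 1] by simp
qed

lemma form_power: "form d f \<Longrightarrow> form (n * d) (\<lambda>v. f v ^ n)"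
  by (induction n) (auto simp: form_const intro: form_mult)

lemma real_polynomial_function_nth [intro]: "real_polynomial_function (\<lambda>v :: real ^ 'n. v $ i)"
  by (intro real_polynomial_function.intros(1) bounded_linear_vec_nth)

lemma form_real_polynomial_function:
  assumes "form d f"
  shows "real_polynomial_function f"
proof -
  obtain c where "\<And>v. f v = (\<Sum>a | (\<Sum>i\<in>UNIV. a i) = d. c a * (\<Prod>i\<in>UNIV. (v $ i) ^ a i))"
    using assms unfolding form_def by blast
  then have "f = (\<lambda>v. \<Sum>a | (\<Sum>i\<in>UNIV. a i) = d. c a * (\<Prod>i\<in>UNIV. (v $ i) ^ a i))"
    by (rule ext)
  then show ?thesis
    by (auto intro!: real_polynomial_function_sum finite_multi_indices real_polynomial_function.intros(4)
        real_polynomial_function_prod real_polynomial_function_power)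
qed

lemma form_scaleR:
  assumes "form d f"
  shows "f (c *\<^sub>R v) = c ^ d * f v"
proof -
  obtain k where k: "\<And>v. f v = (\<Sum>a | (\<Sum>i\<in>UNIV. a i) = d. k a * (\<Prod>i\<in>UNIV. (v $ i) ^ a i))"
    using assms unfolding form_def by blast
  show ?thesis
    unfolding k sum_distrib_left
    by (intro sum.cong) (auto simp: power_mult_distrib prod.distrib power_sum[symmetric])
qed

lemma bounded_linear_axis_expansion:
  fixes f :: "real ^ 'n \<Rightarrow> real"
  assumes "bounded_linear f"
  shows "f v = (\<Sum>i\<in>UNIV. f (axis i 1) * v $ i)"
proof -
  have "f v = f (\<Sum>i\<in>UNIV. (v $ i) *\<^sub>R axis i 1)"
    by (simp add: basis_expansion flip: scalar_mult_eq_scaleR)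
  also have "\<dots> = (\<Sum>i\<in>UNIV. f (axis i 1) * v $ i)"
    using assms by (simp add: bounded_linear.linear linear_sum linear_scale mult.commute)
  finally show ?thesis .
qed

text \<open>Multiplying by powers of the first coordinate raises the degree without changing values
  where that coordinate is 1. All large degrees are provided, so that several polynomials can be
  given one common degree.\<close>

lemma real_polynomial_function_homogenize:
  assumes "real_polynomial_function f"
  shows "\<exists>N. \<forall>d\<ge>N. \<exists>h. form d h \<and> (\<forall>v :: real ^ 4. v $ 1 = 1 \<longrightarrow> h v = f v)"
  using assms
proof (induction rule: real_polynomial_function.induct)
  case (linear f)
  note f = bounded_linear_axis_expansion[OF linear]
  show ?case
  proof (intro exI[of _ 1] allI impI)
    fix d :: nat assume "1 \<le> d"
    then have d: "d = (d - 1) * 1 + 1" by simp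
    have "form d (\<lambda>v. (v $ 1) ^ (d - 1) * (\<Sum>i\<in>UNIV. f (axis i 1) * v $ i))"
      by (subst d, intro form_mult form_power form_sum form_cmult form_nth) auto
    then show "\<exists>h. form d h \<and> (\<forall>v :: real ^ 4. v $ 1 = 1 \<longrightarrow> h v = f v)"
      by (intro exI conjI) (auto simp: f[symmetric])
  qed
next
  case (const c)
  have "form d (\<lambda>v. c * (v $ 1) ^ d)" for d
    using form_cmult[OF form_power[OF form_nth[of 1], of d], of c] by simp
  then show ?case by (intro exI[of _ 0] allI impI) (rule exI, rule conjI, assumption, simp)
next
  case (add f g)
  then obtain M N where M: "\<And>d. d \<ge> M \<Longrightarrow> \<exists>h. form d h \<and> (\<forall>v :: real ^ 4. v $ 1 = 1 \<longrightarrow> h v = f v)"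
    and N: "\<And>d. d \<ge> N \<Longrightarrow> \<exists>h. form d h \<and> (\<forall>v :: real ^ 4. v $ 1 = 1 \<longrightarrow> h v = g v)" by blast
  show ?case
  proof (intro exI[of _ "max M N"] allI impI)
    fix d assume "max M N \<le> d"
    then obtain h k where "form d h" "\<forall>v :: real ^ 4. v $ 1 = 1 \<longrightarrow> h v = f v"
      "form d k" "\<forall>v :: real ^ 4. v $ 1 = 1 \<longrightarrow> k v = g v" using M[of d] N[of d] by auto
    then show "\<exists>h. form d h \<and> (\<forall>v :: real ^ 4. v $ 1 = 1 \<longrightarrow> h v = f v + g v)"
      by (intro exI[of _ "\<lambda>v. h v + k v"]) (auto intro: form_add)
  qed
next
  case (mult f g)
  then obtain M N where M: "\<And>d. d \<ge> M \<Longrightarrow> \<exists>h. form d h \<and> (\<forall>v :: real ^ 4. v $ 1 = 1 \<longrightarrow> h v = f v)"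
    and N: "\<And>d. d \<ge> N \<Longrightarrow> \<exists>h. form d h \<and> (\<forall>v :: real ^ 4. v $ 1 = 1 \<longrightarrow> h v = g v)" by blast
  show ?case
  proof (intro exI[of _ "M + N"] allI impI)
    fix d assume d: "M + N \<le> d"
    then obtain h k where hk: "form M h" "\<forall>v :: real ^ 4. v $ 1 = 1 \<longrightarrow> h v = f v"
      "form (d - M) k" "\<forall>v :: real ^ 4. v $ 1 = 1 \<longrightarrow> k v = g v" using M[OF order_refl] N[of "d - M"] by (metis le_diff_conv2 add.commute add_leD1)
    then have "form d (\<lambda>v. h v * k v)" using form_mult[OF hk(1,3)] d by simp
    then show "\<exists>h. form d h \<and> (\<forall>v :: real ^ 4. v $ 1 = 1 \<longrightarrow> h v = f v * g v)"
      using hk by (intro exI[of _ "\<lambda>v. h v * k v"]) auto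
  qed
qed

section \<open>Division by the quadric and vanishing on the surface\<close>

lemma real_polynomial_function_quadric [intro]: "real_polynomial_function quadric"
  unfolding quadric_def[abs_def] by (intro real_polynomial_function_diff real_polynomial_function.intros(3)
      real_polynomial_function_power real_polynomial_function_nth)

text \<open>Division with remainder by \<open>quadric\<close>, which is monic of degree 2 in the
  first coordinate. The last clause says that the remainder coefficients \<open>A\<close> and
  \<open>B\<close> do not involve that coordinate.\<close>

lemma real_polynomial_function_divide_quadric:
  assumes "real_polynomial_function f"
  shows "\<exists>h A B. real_polynomial_function h \<and> real_polynomial_function A \<and> real_polynomial_function B
    \<and> (\<forall>v. f v = quadric v * h v + A v + v $ 1 * B v)
    \<and> (\<forall>v w. v $ 2 = w $ 2 \<and> v $ 3 = w $ 3 \<and> v $ 4 = w $ 4 \<longrightarrow> A v = A w \<and> B v = B w)"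
  using assms
proof (induction rule: real_polynomial_function.induct)
  case (linear f)
  note f = bounded_linear_axis_expansion[OF linear]
  show ?case
  proof (intro exI conjI)
    show "real_polynomial_function (\<lambda>v :: real ^ 4. 0)" by auto
    show "real_polynomial_function
      (\<lambda>v :: real ^ 4. f (axis 2 1) * v $ 2 + f (axis 3 1) * v $ 3 + f (axis 4 1) * v $ 4)"
      by (intro real_polynomial_function.intros(2,3,4) real_polynomial_function_nth)
    show "real_polynomial_function (\<lambda>v :: real ^ 4. f (axis 1 1))" by auto
    show "\<forall>v. f v = quadric v * 0 +
        (f (axis 2 1) * v $ 2 + f (axis 3 1) * v $ 3 + f (axis 4 1) * v $ 4) + v $ 1 * f (axis 1 1)"
      by (subst f) (simp add: sum_4)
  qed auto
next
  case (const c)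
  show ?case
    by (rule exI[of _ "\<lambda>_. 0"], rule exI[of _ "\<lambda>_. c"], rule exI[of _ "\<lambda>_. 0"]) auto
next
  case (add f g)
  obtain h A B where 1: "real_polynomial_function h \<and> real_polynomial_function A \<and> real_polynomial_function B
    \<and> (\<forall>v. f v = quadric v * h v + A v + v $ 1 * B v)
    \<and> (\<forall>v w. v $ 2 = w $ 2 \<and> v $ 3 = w $ 3 \<and> v $ 4 = w $ 4 \<longrightarrow> A v = A w \<and> B v = B w)"
    using add.IH(1) by (elim exE)
  obtain h' A' B' where 2: "real_polynomial_function h' \<and> real_polynomial_function A' \<and> real_polynomial_function B'
    \<and> (\<forall>v. g v = quadric v * h' v + A' v + v $ 1 * B' v)
    \<and> (\<forall>v w. v $ 2 = w $ 2 \<and> v $ 3 = w $ 3 \<and> v $ 4 = w $ 4 \<longrightarrow> A' v = A' w \<and> B' v = B' w)"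
    using add.IH(2) by (elim exE)
  show ?case
  proof (intro exI conjI)
    show "real_polynomial_function (\<lambda>v. h v + h' v)" "real_polynomial_function (\<lambda>v. A v + A' v)"
      "real_polynomial_function (\<lambda>v. B v + B' v)"
      using 1 2 by (blast intro: real_polynomial_function.intros(3))+
    show "\<forall>v. f v + g v = quadric v * (h v + h' v) + (A v + A' v) + v $ 1 * (B v + B' v)"
      using 1[THEN conjunct2, THEN conjunct2, THEN conjunct2, THEN conjunct1]
        2[THEN conjunct2, THEN conjunct2, THEN conjunct2, THEN conjunct1] by (simp add: algebra_simps)
    show "\<forall>v w. v $ 2 = w $ 2 \<and> v $ 3 = w $ 3 \<and> v $ 4 = w $ 4 \<longrightarrow>
        A v + A' v = A w + A' w \<and> B v + B' v = B w + B' w"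
    proof (intro allI impI)
      fix v w :: "real ^ 4" assume vw: "v $ 2 = w $ 2 \<and> v $ 3 = w $ 3 \<and> v $ 4 = w $ 4"
      then have "A v = A w" "B v = B w" "A' v = A' w" "B' v = B' w" using 1 2 by blast+
      then show "A v + A' v = A w + A' w \<and> B v + B' v = B w + B' w" by simp
    qed
  qed
next
  case (mult f g)
  obtain h A B where 1: "real_polynomial_function h \<and> real_polynomial_function A \<and> real_polynomial_function B
    \<and> (\<forall>v. f v = quadric v * h v + A v + v $ 1 * B v)
    \<and> (\<forall>v w. v $ 2 = w $ 2 \<and> v $ 3 = w $ 3 \<and> v $ 4 = w $ 4 \<longrightarrow> A v = A w \<and> B v = B w)"
    using mult.IH(1) by (elim exE)
  obtain h' A' B' where 2: "real_polynomial_function h' \<and> real_polynomial_function A' \<and> real_polynomial_function B'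
    \<and> (\<forall>v. g v = quadric v * h' v + A' v + v $ 1 * B' v)
    \<and> (\<forall>v w. v $ 2 = w $ 2 \<and> v $ 3 = w $ 3 \<and> v $ 4 = w $ 4 \<longrightarrow> A' v = A' w \<and> B' v = B' w)"
    using mult.IH(2) by (elim exE)
  have *: "real_polynomial_function h" "real_polynomial_function A" "real_polynomial_function B"
    "real_polynomial_function h'" "real_polynomial_function A'" "real_polynomial_function B'"
    using 1 2 by blast+
  have fg: "\<And>v. f v = quadric v * h v + A v + v $ 1 * B v"
    "\<And>v. g v = quadric v * h' v + A' v + v $ 1 * B' v"
    using 1 2 by blast+
  define r where "r = (\<lambda>v :: real ^ 4. (v $ 2)\<^sup>2 + (v $ 3)\<^sup>2 + (v $ 4)\<^sup>2)"
  have r: "real_polynomial_function r" unfolding r_def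
    by (intro real_polynomial_function.intros(3) real_polynomial_function_power real_polynomial_function_nth)
  have q: "quadric v = (v $ 1)\<^sup>2 - r v" for v unfolding r_def quadric_def by simp
  show ?case
  proof (intro exI conjI)
    \<comment> \<open>In the product of the two remainders the square of the first coordinate is
      replaced by \<open>quadric v + r v\<close>; this adds \<open>B v * B' v\<close> to the
      quotient and \<open>r v * (B v * B' v)\<close> to the remainder.\<close>
    show "real_polynomial_function (\<lambda>v. h v * g v + (A v + v $ 1 * B v) * h' v + B v * B' v)"
      using * mult.hyps by (intro real_polynomial_function.intros(3) real_polynomial_function.intros(4)) auto
    show "real_polynomial_function (\<lambda>v. A v * A' v + r v * (B v * B' v))"
      using * r by (intro real_polynomial_function.intros(3) real_polynomial_function.intros(4)) auto
    show "real_polynomial_function (\<lambda>v. A v * B' v + B v * A' v)"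
      using * by (intro real_polynomial_function.intros(3) real_polynomial_function.intros(4)) auto
    show "\<forall>v. f v * g v = quadric v * (h v * g v + (A v + v $ 1 * B v) * h' v + B v * B' v)
        + (A v * A' v + r v * (B v * B' v)) + v $ 1 * (A v * B' v + B v * A' v)"
      unfolding fg q by (auto simp: algebra_simps power2_eq_square)
    show "\<forall>v w. v $ 2 = w $ 2 \<and> v $ 3 = w $ 3 \<and> v $ 4 = w $ 4 \<longrightarrow>
        A v * A' v + r v * (B v * B' v) = A w * A' w + r w * (B w * B' w) \<and>
        A v * B' v + B v * A' v = A w * B' w + B w * A' w"
    proof (intro allI impI)
      fix v w :: "real ^ 4" assume vw: "v $ 2 = w $ 2 \<and> v $ 3 = w $ 3 \<and> v $ 4 = w $ 4"
      then have "A v = A w" "B v = B w" "A' v = A' w" "B' v = B' w" "r v = r w"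
        using 1 2 unfolding r_def by (blast, blast, blast, blast, simp)
      then show "A v * A' v + r v * (B v * B' v) = A w * A' w + r w * (B w * B' w) \<and>
        A v * B' v + B v * A' v = A w * B' w + B w * A' w" by simp
    qed
  qed
qed

text \<open>A real Nullstellensatz for this quadric. Above a point with
  \<open>v $ 2 \<noteq> 0\<close> the cone has two distinct real points, with first coordinates r
  and -r, so the remainder A + w B vanishes at both and A = B = 0. Continuity extends this to
  \<open>v $ 2 = 0\<close>.\<close>

lemma zero_on_S_iff_cone:
  assumes "real_polynomial_function f"
  shows "zero_on_S f \<longleftrightarrow> (\<forall>v. quadric v = 0 \<longrightarrow> f v = 0)"
proof
  assume "zero_on_S f"
  then show "\<forall>v. quadric v = 0 \<longrightarrow> f v = 0" unfolding zero_on_S_def by auto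
next
  assume van: "\<forall>v. quadric v = 0 \<longrightarrow> f v = 0"
  obtain h A B where hAB: "real_polynomial_function h \<and> real_polynomial_function A \<and> real_polynomial_function B
    \<and> (\<forall>v. f v = quadric v * h v + A v + v $ 1 * B v)
    \<and> (\<forall>v w. v $ 2 = w $ 2 \<and> v $ 3 = w $ 3 \<and> v $ 4 = w $ 4 \<longrightarrow> A v = A w \<and> B v = B w)"
    using real_polynomial_function_divide_quadric[OF assms] by (elim exE)
  have h: "real_polynomial_function h" and A: "real_polynomial_function A"
    and B: "real_polynomial_function B" and f: "\<And>v. f v = quadric v * h v + A v + v $ 1 * B v"
    using hAB by blast+
  have off: "A v = 0 \<and> B v = 0" if "v $ 2 \<noteq> 0" for v
  proof -
    define r where "r = sqrt ((v $ 2)\<^sup>2 + (v $ 3)\<^sup>2 + (v $ 4)\<^sup>2)"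
    have r: "r > 0" "r\<^sup>2 = (v $ 2)\<^sup>2 + (v $ 3)\<^sup>2 + (v $ 4)\<^sup>2"
      using that unfolding r_def by (auto simp: add_pos_nonneg)
    have *: "A v + s * B v = 0" if "s\<^sup>2 = r\<^sup>2" for s
    proof -
      define w :: "real ^ 4" where "w = vector [s, v $ 2, v $ 3, v $ 4]"
      have "quadric w = 0" using that r(2) unfolding w_def quadric_def by simp
      moreover have "w $ 1 = s" unfolding w_def by simp
      ultimately have "A w + s * B w = 0" using van f[of w] by (metis add_0 mult_zero_left)
      then show ?thesis using hAB[THEN conjunct2, THEN conjunct2, THEN conjunct2, THEN conjunct2, rule_format, of v w]
        unfolding w_def by simp
    qed
    have "r * B v = 0" "A v = 0" using *[of r] *[of "- r"] by auto
    then show ?thesis using r(1) by simp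
  qed
  have on: "p v = 0" if p: "real_polynomial_function p" and "\<And>v. v $ 2 \<noteq> 0 \<Longrightarrow> p v = 0"
    for p :: "real ^ 4 \<Rightarrow> real" and v
  proof -
    define X where "X = (\<lambda>n. v + inverse (real (Suc n)) *\<^sub>R axis 2 1)"
    have "(\<lambda>n. v + inverse (real (Suc n)) *\<^sub>R (axis 2 1 :: real ^ 4)) \<longlonglongrightarrow> v + 0 *\<^sub>R axis 2 1"
      by (intro tendsto_intros LIMSEQ_inverse_real_of_nat)
    then have X: "X \<longlonglongrightarrow> v" unfolding X_def by simp
    have "isCont p v"
      using p continuous_polymonial_function real_polynomial_function_eq by blast
    then have "(\<lambda>n. p (X n)) \<longlonglongrightarrow> p v" using X isCont_tendsto_compose by blast
    moreover have "\<forall>\<^sub>F n in sequentially. p (X n) = 0"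
    proof (cases "v $ 2 = 0")
      case True
      then have "p (X n) = 0" for n using that(2)[of "X n"] unfolding X_def by simp
      then show ?thesis by simp
    next
      case False
      then have "\<forall>\<^sub>F n in sequentially. X n $ 2 \<noteq> 0"
        using tendsto_vec_nth[OF X, of 2] tendsto_imp_eventually_ne by blast
      then show ?thesis by (rule eventually_mono) (rule that(2))
    qed
    ultimately have "(\<lambda>n. 0) \<longlonglongrightarrow> p v" using Lim_transform_eventually by fastforce
    then show ?thesis by (simp add: LIMSEQ_const_iff)
  qed
  have "A v = 0" "B v = 0" for v using on[OF A] on[OF B] off by blast+
  then show "zero_on_S f" unfolding zero_on_S_def using h f by auto
qed

definition sph :: "(real ^ 4) set" where
  "sph = {v. v $ 1 = 1 \<and> quadric v = 0}"

text \<open>The plane w = 0 contains no real point of the surface, since there a sum of three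
  squares would vanish. Hence the sphere w = 1 represents all real points.\<close>

lemma cone_cases:
  assumes "quadric v = 0"
  obtains "v = 0" | c w where "c \<noteq> 0" "w \<in> sph" "v = c *\<^sub>R w"
proof (cases "v $ 1 = 0")
  case True
  have "(v $ 2)\<^sup>2 + ((v $ 3)\<^sup>2 + (v $ 4)\<^sup>2) = 0" using assms True unfolding quadric_def by simp
  then have "v $ i = 0" for i
    using True exhaust_4[of i] by (auto simp: add_nonneg_eq_0_iff)
  then show ?thesis using that(1) by (simp add: vec_eq_iff)
next
  case False
  have "quadric (inverse (v $ 1) *\<^sub>R v) = (inverse (v $ 1))\<^sup>2 * quadric v"
    unfolding quadric_def by (simp add: power2_eq_square algebra_simps)
  then have "inverse (v $ 1) *\<^sub>R v \<in> sph" using assms False unfolding sph_def by simp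
  then show ?thesis using that(2)[of "v $ 1" "inverse (v $ 1) *\<^sub>R v"] False by simp
qed

lemma zero_on_S_iff:
  assumes "form d f"
  shows "zero_on_S f \<longleftrightarrow> (\<forall>v\<in>sph. f v = 0)"
  unfolding zero_on_S_iff_cone[OF form_real_polynomial_function[OF assms]]
proof
  assume *: "\<forall>v\<in>sph. f v = 0"
  show "\<forall>v. quadric v = 0 \<longrightarrow> f v = 0"
  proof (intro allI impI)
    fix v assume "quadric v = 0"
    then show "f v = 0"
    proof (cases rule: cone_cases)
      case 1
      \<comment> \<open>Scaling any point of the sphere by 0 reaches the origin; as
        \<open>0 ^ 0 = 1\<close>, this also covers forms of degree 0, which are constant.\<close>
      define w :: "real ^ 4" where "w = vector [1, 1, 0, 0]"
      have "w \<in> sph" unfolding w_def sph_def quadric_def by simp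
      then show ?thesis using * form_scaleR[OF assms, of 0 w] 1 by simp
    next
      case (2 c w)
      then show ?thesis using * form_scaleR[OF assms, of c w] by simp
    qed
  qed
qed (auto simp: sph_def)

text \<open>The spinor parametrisation \<open>(\<xi>, \<eta>) \<mapsto> (\<bar>\<xi>\<bar>\<^sup>2 + \<bar>\<eta>\<bar>\<^sup>2, 2 \<xi> cnj \<eta>, \<bar>\<xi>\<bar>\<^sup>2 - \<bar>\<eta>\<bar>\<^sup>2)\<close> of the cone
  \<open>w\<^sup>2 = x\<^sup>2 + y\<^sup>2 + z\<^sup>2\<close>, \<open>w \<ge> 0\<close>, in real coordinates.\<close>

definition spinor :: "real ^ 4 \<Rightarrow> real ^ 4" where
  "spinor s = vector [(s $ 1)\<^sup>2 + (s $ 2)\<^sup>2 + (s $ 3)\<^sup>2 + (s $ 4)\<^sup>2, 2 * (s $ 1 * s $ 3 + s $ 2 * s $ 4),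
     2 * (s $ 2 * s $ 3 - s $ 1 * s $ 4), (s $ 1)\<^sup>2 + (s $ 2)\<^sup>2 - (s $ 3)\<^sup>2 - (s $ 4)\<^sup>2]"

lemma quadric_spinor: "quadric (spinor s) = 0"
  unfolding quadric_def spinor_def by (simp add: power2_eq_square algebra_simps)

text \<open>A common phase of \<xi> and \<eta> does not affect the image, so \<xi> may be taken
  real. Its square is (1 + z) / 2, which vanishes only at the pole z = -1; elsewhere \<eta> is found
  by division.\<close>

lemma spinor_surj:
  assumes "v \<in> sph"
  obtains s where "spinor s = v"
proof (cases "v $ 4 = - 1")
  case True
  have "v $ 1 = 1" "(v $ 2)\<^sup>2 + (v $ 3)\<^sup>2 = 0"
    using assms True unfolding sph_def quadric_def by auto
  then have "v $ 2 = 0" "v $ 3 = 0" by (auto simp: add_nonneg_eq_0_iff)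
  then have "spinor (vector [0, 0, 1, 0]) = v"
    using assms True unfolding spinor_def sph_def by (simp add: vec_eq_iff forall_4)
  then show ?thesis using that by blast
next
  case False
  have q: "1 = (v $ 2)\<^sup>2 + (v $ 3)\<^sup>2 + (v $ 4)\<^sup>2" and v1: "v $ 1 = 1"
    using assms unfolding sph_def quadric_def by auto
  have "(v $ 4)\<^sup>2 \<le> 1" using q zero_le_power2[of "v $ 2"] zero_le_power2[of "v $ 3"] by linarith
  then have "v $ 4 > - 1" using False abs_le_square_iff[of "v $ 4" 1] by simp
  define p where "p = sqrt ((1 + v $ 4) / 2)"
  have p: "p > 0" "p\<^sup>2 = (1 + v $ 4) / 2" using \<open>v $ 4 > - 1\<close> unfolding p_def by auto
  define a b where "a = v $ 2 / (2 * p)" and "b = - v $ 3 / (2 * p)"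
  define s :: "real ^ 4" where "s = vector [p, 0, a, b]"
  have e: "(v $ 2)\<^sup>2 + (v $ 3)\<^sup>2 = (1 - v $ 4) * (1 + v $ 4)"
    using q by (simp add: algebra_simps power2_eq_square)
  have "a\<^sup>2 + b\<^sup>2 = ((v $ 2)\<^sup>2 + (v $ 3)\<^sup>2) / (4 * p\<^sup>2)"
    unfolding a_def b_def by (simp add: power_divide power_mult_distrib add_divide_distrib)
  also have "\<dots> = (1 - v $ 4) / 2"
    unfolding e p(2) using \<open>v $ 4 > - 1\<close> by (simp add: field_simps)
  finally have "spinor s $ 1 = v $ 1" "spinor s $ 4 = v $ 4"
    using p(2) v1 unfolding spinor_def s_def by (simp_all add: field_simps)
  moreover have "spinor s $ 2 = v $ 2" "spinor s $ 3 = v $ 3"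
    using p(1) unfolding spinor_def s_def a_def b_def by simp_all
  ultimately have "spinor s = v" by (simp add: vec_eq_iff forall_4)
  then show ?thesis using that by blast
qed

section \<open>Irreducibility of the sphere\<close>

lemma real_polynomial_function_finite_zeros:
  fixes F :: "real \<Rightarrow> real"
  assumes "real_polynomial_function F" "F x \<noteq> 0"
  shows "finite {s. F s = 0}"
proof -
  obtain a n where F: "F = (\<lambda>x. \<Sum>i\<le>n. a i * x ^ i)"
    using assms(1) real_polynomial_function_iff_sum by blast
  have "\<exists>i\<le>n. a i \<noteq> 0" using assms(2) unfolding F by (metis (no_types, lifting) atMost_iff mult_zero_left sum.neutral)
  then show ?thesis unfolding F using polyfun_finite_roots[of a n] by blast
qed

text \<open>Two points of the sphere lift to spinors, and the straight line between these maps into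
  the cone. Along it both functions are polynomials in one variable, one non-zero at 0 and the other
  at 1, so their product cannot vanish identically. The curve leaves w = 1, which is why the
  functions are homogenised first.\<close>

lemma sph_prime:
  assumes f: "real_polynomial_function f" and g: "real_polynomial_function g"
    and fg: "\<And>v. v \<in> sph \<Longrightarrow> f v * g v = 0"
  shows "(\<forall>v\<in>sph. f v = 0) \<or> (\<forall>v\<in>sph. g v = 0)"
proof (rule ccontr)
  assume "\<not> ?thesis"
  then obtain p q where pq: "p \<in> sph" "f p \<noteq> 0" "q \<in> sph" "g q \<noteq> 0" by blast
  obtain M N where M: "\<And>d. d \<ge> M \<Longrightarrow> \<exists>h. form d h \<and> (\<forall>v :: real ^ 4. v $ 1 = 1 \<longrightarrow> h v = f v)"
    and N: "\<And>d. d \<ge> N \<Longrightarrow> \<exists>h. form d h \<and> (\<forall>v :: real ^ 4. v $ 1 = 1 \<longrightarrow> h v = g v)"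
    using real_polynomial_function_homogenize[OF f] real_polynomial_function_homogenize[OF g] by blast
  obtain h k where h: "form M h" "\<And>v. v $ 1 = 1 \<Longrightarrow> h v = f v"
    and k: "form N k" "\<And>v. v $ 1 = 1 \<Longrightarrow> k v = g v" using M[of M] N[of N] by blast
  have "\<forall>v\<in>sph. h v * k v = 0" using fg h(2) k(2) unfolding sph_def by simp
  then have "zero_on_S (\<lambda>v. h v * k v)" using zero_on_S_iff[OF form_mult[OF h(1) k(1)]] by simp
  then have hk: "h v * k v = 0" if "quadric v = 0" for v
    using that unfolding zero_on_S_def by (metis mult_zero_left)
  obtain a b where ab: "spinor a = p" "spinor b = q" using spinor_surj pq by metis
  define \<gamma> where "\<gamma> = (\<lambda>s :: real. spinor (a + s *\<^sub>R (b - a)))"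
  have line: "real_polynomial_function (\<lambda>s. (a + s *\<^sub>R (b - a)) $ i)" for i
  proof -
    have "real_polynomial_function (\<lambda>s :: real. a $ i + s * (b $ i - a $ i))"
      by (intro real_polynomial_function.intros(3) real_polynomial_function.intros(4)
          real_polynomial_function.intros(2) real_polynomial_function.intros(1) bounded_linear_ident)
    then show ?thesis by simp
  qed
  have \<gamma>i: "real_polynomial_function (\<lambda>s. \<gamma> s $ i)" for i
    using exhaust_4[of i] unfolding \<gamma>_def spinor_def
    by (auto simp del: vector_add_component vector_minus_component vector_scaleR_component
        intro!: real_polynomial_function.intros(3) real_polynomial_function.intros(4) real_polynomial_function_diff
        real_polynomial_function_power line)
  have \<gamma>: "polynomial_function \<gamma>"
    unfolding polynomial_function_iff_Basis_inner
    using \<gamma>i by (auto simp: Basis_vec_def inner_axis)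
  have F: "real_polynomial_function (h \<circ> \<gamma>)" and G: "real_polynomial_function (k \<circ> \<gamma>)"
    using \<gamma> h(1) k(1) form_real_polynomial_function real_polynomial_function_compose by blast+
  have "(h \<circ> \<gamma>) 0 \<noteq> 0" "(k \<circ> \<gamma>) 1 \<noteq> 0" using pq ab h(2) k(2) unfolding \<gamma>_def sph_def by auto
  then have "finite ({s. (h \<circ> \<gamma>) s = 0} \<union> {s. (k \<circ> \<gamma>) s = 0})"
    using F G real_polynomial_function_finite_zeros by blast
  moreover have "{s. (h \<circ> \<gamma>) s = 0} \<union> {s. (k \<circ> \<gamma>) s = 0} = UNIV"
    using hk quadric_spinor unfolding \<gamma>_def by fastforce
  ultimately show False using infinite_UNIV_char_0 by metis
qed

section \<open>Rational maps as partial self-maps of the sphere\<close>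

text \<open>Encodes a generic condition. By \<open>sph_prime\<close> such functions are closed under
  products, so finitely many generic conditions can be imposed at once and cancelled from polynomial
  identities.\<close>

definition nonzero_on_sph :: "(real ^ 4 \<Rightarrow> real) \<Rightarrow> bool" where
  "nonzero_on_sph f \<longleftrightarrow> real_polynomial_function f \<and> (\<exists>v\<in>sph. f v \<noteq> 0)"

lemma nonzero_on_sph_mult:
  assumes "nonzero_on_sph f" "nonzero_on_sph g"
  shows "nonzero_on_sph (\<lambda>v. f v * g v)"
proof -
  have "\<exists>v\<in>sph. f v * g v \<noteq> 0"
    using sph_prime[of f g] assms unfolding nonzero_on_sph_def by blast
  then show ?thesis using assms unfolding nonzero_on_sph_def by auto
qed

lemma nonzero_on_sph_1: "nonzero_on_sph (\<lambda>v. 1)"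
proof -
  have "vector [1, 1, 0, 0] \<in> sph" unfolding sph_def quadric_def by simp
  then show ?thesis unfolding nonzero_on_sph_def by auto
qed

lemma nonzero_on_sph_cancel:
  assumes "nonzero_on_sph P" "real_polynomial_function f" "\<And>v. v \<in> sph \<Longrightarrow> P v \<noteq> 0 \<Longrightarrow> f v = 0"
    and "v \<in> sph"
  shows "f v = 0"
  using sph_prime[of P f] assms unfolding nonzero_on_sph_def by fastforce

lemma nonzero_on_sphE:
  assumes "nonzero_on_sph f"
  obtains v where "v \<in> sph" "f v \<noteq> 0"
  using assms unfolding nonzero_on_sph_def by blast

lemma form_prod:
  assumes "finite I" "\<And>i. i \<in> I \<Longrightarrow> form (d i) (f i)"
  shows "form (\<Sum>i\<in>I. d i) (\<lambda>v. \<Prod>i\<in>I. f i v)"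
  using assms by (induction I rule: finite_induct) (auto simp: form_const intro: form_mult)

lemma form_compose:
  assumes "form d f" "\<And>i. form e (\<lambda>v. G v $ i)"
  shows "form (d * e) (f \<circ> G)"
proof -
  obtain c where "\<And>v. f v = (\<Sum>a | (\<Sum>i\<in>UNIV. a i) = d. c a * (\<Prod>i\<in>UNIV. (v $ i) ^ a i))"
    using assms unfolding form_def by blast
  then have "f \<circ> G = (\<lambda>v. \<Sum>a | (\<Sum>i\<in>UNIV. a i) = d. c a * (\<Prod>i\<in>UNIV. (G v $ i) ^ a i))"
    by auto
  moreover have "form (d * e) (\<lambda>v. c a * (\<Prod>i\<in>UNIV. (G v $ i) ^ a i))"
    if "(\<Sum>i\<in>UNIV. a i) = d" for a
  proof -
    have "form (\<Sum>i\<in>UNIV. a i * e) (\<lambda>v. \<Prod>i\<in>UNIV. (G v $ i) ^ a i)"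
      by (intro form_prod form_power assms) auto
    then show ?thesis using that by (intro form_cmult) (simp flip: sum_distrib_right)
  qed
  ultimately show ?thesis by (auto intro!: form_sum finite_multi_indices)
qed

lemma cone_nth_1_eq_0: "quadric w = 0 \<Longrightarrow> w $ 1 = 0 \<Longrightarrow> w = 0"
  by (erule cone_cases) (auto simp: sph_def)

lemma quadric_0 [simp]: "quadric 0 = 0"
  unfolding quadric_def by simp

lemma quadric_scaleR: "quadric (c *\<^sub>R v) = c\<^sup>2 * quadric v"
  unfolding quadric_def by (simp add: power2_eq_square algebra_simps)

text \<open>On the real cone the first coordinate vanishes only at the origin, so a representative
  vanishes at a real point as soon as its first component does. This reduces all questions of
  definedness to \<open>F v $ 1\<close>.\<close>

lemma self_reps_iff:
  "F \<in> self_reps \<longleftrightarrow> (\<exists>d. \<forall>i. form d (\<lambda>v. F v $ i)) \<and> (\<exists>v\<in>sph. F v $ 1 \<noteq> 0)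
     \<and> (\<forall>v. quadric v = 0 \<longrightarrow> quadric (F v) = 0)" (is "?L = ?R")
proof (cases "\<exists>d. \<forall>i. form d (\<lambda>v. F v $ i)")
  case True
  then obtain d where d: "\<And>i. form d (\<lambda>v. F v $ i)" by blast
  have "real_polynomial_function (quadric \<circ> F)"
    unfolding quadric_def[abs_def] comp_def
    by (intro real_polynomial_function_diff real_polynomial_function.intros(3)
        real_polynomial_function_power form_real_polynomial_function[OF d])
  then have q: "zero_on_S (quadric \<circ> F) \<longleftrightarrow> (\<forall>v. quadric v = 0 \<longrightarrow> quadric (F v) = 0)"
    using zero_on_S_iff_cone by auto
  have "(\<exists>i. \<not> zero_on_S (\<lambda>v. F v $ i)) \<longleftrightarrow> (\<exists>v\<in>sph. F v $ 1 \<noteq> 0)"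
    if "\<forall>v. quadric v = 0 \<longrightarrow> quadric (F v) = 0"
    using that cone_nth_1_eq_0[of "F v" for v] unfolding zero_on_S_iff[OF d] sph_def
    by (metis (mono_tags, lifting) mem_Collect_eq zero_index)
  then show ?thesis using True q unfolding self_reps_def rat_rep_def by auto
qed (auto simp: self_reps_def rat_rep_def)

lemma self_repsE:
  assumes "F \<in> self_reps"
  obtains d where "\<And>i. form d (\<lambda>v. F v $ i)"
  using assms unfolding self_reps_iff by blast

lemma self_reps_polynomial: "F \<in> self_reps \<Longrightarrow> real_polynomial_function (\<lambda>v. F v $ i)"
  by (metis self_repsE form_real_polynomial_function)

lemma self_reps_nonzero: "F \<in> self_reps \<Longrightarrow> nonzero_on_sph (\<lambda>v. F v $ 1)"
  using self_reps_polynomial unfolding nonzero_on_sph_def self_reps_iff by blast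

lemma self_reps_quadric: "F \<in> self_reps \<Longrightarrow> quadric v = 0 \<Longrightarrow> quadric (F v) = 0"
  unfolding self_reps_iff by blast

lemma self_reps_eq_0: "F \<in> self_reps \<Longrightarrow> v \<in> sph \<Longrightarrow> F v $ 1 = 0 \<Longrightarrow> F v = 0"
  using self_reps_quadric cone_nth_1_eq_0 unfolding sph_def by blast

text \<open>The minors that involve the first index give all others: dividing by
  \<open>F v $ 1\<close> works where it is non-zero, and otherwise \<open>F v\<close> is zero
  altogether.\<close>

lemma self_rel_iff:
  "(F, G) \<in> self_rel \<longleftrightarrow> F \<in> self_reps \<and> G \<in> self_reps \<and>
     (\<forall>v\<in>sph. F v $ 1 *\<^sub>R G v = G v $ 1 *\<^sub>R F v)"
proof (cases "F \<in> self_reps \<and> G \<in> self_reps")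
  case True
  then obtain d e where de: "\<And>i. form d (\<lambda>v. F v $ i)" "\<And>i. form e (\<lambda>v. G v $ i)"
    by (metis self_repsE)
  have f: "form (d + e) (\<lambda>v. F v $ i * G v $ j - F v $ j * G v $ i)" for i j
    by (intro form_diff form_mult de)
  have "(\<forall>i j. \<forall>v\<in>sph. F v $ i * G v $ j - F v $ j * G v $ i = 0) \<longleftrightarrow>
    (\<forall>v\<in>sph. F v $ 1 *\<^sub>R G v = G v $ 1 *\<^sub>R F v)"
  proof
    assume "\<forall>i j. \<forall>v\<in>sph. F v $ i * G v $ j - F v $ j * G v $ i = 0"
    then show "\<forall>v\<in>sph. F v $ 1 *\<^sub>R G v = G v $ 1 *\<^sub>R F v"
      by (auto simp: vec_eq_iff mult.commute)
  next
    assume *: "\<forall>v\<in>sph. F v $ 1 *\<^sub>R G v = G v $ 1 *\<^sub>R F v"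
    show "\<forall>i j. \<forall>v\<in>sph. F v $ i * G v $ j - F v $ j * G v $ i = 0"
    proof (intro allI ballI)
      fix i j v assume v: "v \<in> sph"
      then have "F v $ 1 *\<^sub>R G v = G v $ 1 *\<^sub>R F v" using * by blast
      then have "(F v $ 1 *\<^sub>R G v) $ i = (G v $ 1 *\<^sub>R F v) $ i" for i by (simp only:)
      then have c: "F v $ 1 * G v $ i = G v $ 1 * F v $ i" for i by simp
      show "F v $ i * G v $ j - F v $ j * G v $ i = 0"
      proof (cases "F v $ 1 = 0")
        case True
        then show ?thesis using self_reps_eq_0[of F v] v \<open>F \<in> self_reps \<and> G \<in> self_reps\<close> by simp
      next
        case False
        have "F v $ 1 * (F v $ i * G v $ j - F v $ j * G v $ i)
          = F v $ i * (F v $ 1 * G v $ j) - F v $ j * (F v $ 1 * G v $ i)"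
          by (simp add: algebra_simps)
        also have "\<dots> = 0" unfolding c[of i] c[of j] by (simp add: algebra_simps)
        finally show ?thesis using False by simp
      qed
    qed
  qed
  moreover have "(\<forall>i j. zero_on_S (\<lambda>v. F v $ i * G v $ j - F v $ j * G v $ i)) \<longleftrightarrow>
    (\<forall>i j. \<forall>v\<in>sph. F v $ i * G v $ j - F v $ j * G v $ i = 0)"
    using zero_on_S_iff[OF f] by (intro iff_allI)
  moreover have "rat_rep F" "rat_rep G" using True unfolding self_reps_def by auto
  ultimately show ?thesis using True unfolding self_rel_def rat_eq_def by blast
qed (auto simp: self_rel_def)

text \<open>The value at a point of the sphere, normalised to lie on the sphere; it is meaningful only where
  \<open>F v $ 1 \<noteq> 0\<close>.\<close>

definition ev :: "(real ^ 4 \<Rightarrow> real ^ 4) \<Rightarrow> real ^ 4 \<Rightarrow> real ^ 4" where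
  "ev F v = inverse (F v $ 1) *\<^sub>R F v"

lemma ev_in_sph: "F \<in> self_reps \<Longrightarrow> v \<in> sph \<Longrightarrow> F v $ 1 \<noteq> 0 \<Longrightarrow> ev F v \<in> sph"
  unfolding sph_def ev_def by (simp add: quadric_scaleR self_reps_quadric)

lemma ev_eq: "F v $ 1 \<noteq> 0 \<Longrightarrow> F v = F v $ 1 *\<^sub>R ev F v"
  unfolding ev_def by simp

lemma self_rel_ev:
  assumes "(F, G) \<in> self_rel" "v \<in> sph" "F v $ 1 \<noteq> 0" "G v $ 1 \<noteq> 0"
  shows "ev F v = ev G v"
proof -
  have "F v $ 1 *\<^sub>R G v = G v $ 1 *\<^sub>R F v" using assms(1,2) unfolding self_rel_iff by blast
  then have "(F v $ 1 *\<^sub>R G v) $ i = (G v $ 1 *\<^sub>R F v) $ i" for i by (simp only:)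
  then have "F v $ 1 * G v $ i = G v $ 1 * F v $ i" for i by simp
  then show ?thesis unfolding ev_def vec_eq_iff using assms(3,4) by (simp add: field_simps)
qed

lemma self_rel_generic:
  assumes F: "F \<in> self_reps" and G: "G \<in> self_reps" and P: "nonzero_on_sph P"
    and eq: "\<And>v. v \<in> sph \<Longrightarrow> P v \<noteq> 0 \<Longrightarrow> F v $ 1 \<noteq> 0 \<Longrightarrow> G v $ 1 \<noteq> 0 \<Longrightarrow> ev F v = ev G v"
  shows "(F, G) \<in> self_rel"
proof -
  have "F v $ 1 * G v $ i - G v $ 1 * F v $ i = 0" if v: "v \<in> sph" for v i
  proof (rule nonzero_on_sph_cancel[where P = "\<lambda>v. P v * (F v $ 1 * G v $ 1)", OF _ _ _ v])
    show "nonzero_on_sph (\<lambda>v. P v * (F v $ 1 * G v $ 1))"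
      using P F G by (intro nonzero_on_sph_mult self_reps_nonzero)
    show "real_polynomial_function (\<lambda>v. F v $ 1 * G v $ i - G v $ 1 * F v $ i)"
      using F G by (intro real_polynomial_function_diff real_polynomial_function.intros(4) self_reps_polynomial)
    fix w assume w: "w \<in> sph" "P w * (F w $ 1 * G w $ 1) \<noteq> 0"
    then have "ev F w $ i = ev G w $ i" using eq by simp
    then show "F w $ 1 * G w $ i - G w $ 1 * F w $ i = 0"
      using w(2) unfolding ev_def by (simp add: field_simps)
  qed
  then show ?thesis using F G unfolding self_rel_iff by (auto simp: vec_eq_iff)
qed

lemma equiv_self_rel: "equiv self_reps self_rel"
proof (rule equivI)
  show "self_rel \<subseteq> self_reps \<times> self_reps" unfolding self_rel_def by auto
  show "refl_on self_reps self_rel" unfolding refl_on_def by (auto simp: self_rel_iff)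
  show "sym self_rel" unfolding sym_def self_rel_iff by auto
  show "trans self_rel"
  proof (rule transI)
    fix F G H assume *: "(F, G) \<in> self_rel" "(G, H) \<in> self_rel"
    then have r: "F \<in> self_reps" "G \<in> self_reps" "H \<in> self_reps" unfolding self_rel_iff by auto
    \<comment> \<open>At points where \<open>G\<close> vanishes nothing can be inferred pointwise;
      the comparison is made where \<open>G v $ 1 \<noteq> 0\<close>, and this is enough.\<close>
    show "(F, H) \<in> self_rel"
      by (rule self_rel_generic[OF r(1,3) self_reps_nonzero[OF r(2)]])
        (use * self_rel_ev in metis)
  qed
qed

lemma rational_maps_rep:
  assumes "A \<in> rational_maps" "F \<in> A"
  shows "F \<in> self_reps" "A = self_rel `` {F}"
proof -
  obtain G where G: "G \<in> self_reps" "A = self_rel `` {G}"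
    using assms(1) unfolding rational_maps_def by (auto elim: quotientE)
  then have "(G, F) \<in> self_rel" using assms(2) by auto
  then show "F \<in> self_reps" "A = self_rel `` {F}"
    using G equiv_class_eq[OF equiv_self_rel] unfolding self_rel_iff by auto
qed

lemma rational_maps_ex: "A \<in> rational_maps \<Longrightarrow> \<exists>F. F \<in> A"
  using in_quotient_imp_non_empty[OF equiv_self_rel] unfolding rational_maps_def by blast

lemma class_in_rational_maps: "F \<in> self_reps \<Longrightarrow> self_rel `` {F} \<in> rational_maps"
  unfolding rational_maps_def by (rule quotientI)

lemma rep_in_class: "F \<in> self_reps \<Longrightarrow> F \<in> self_rel `` {F}"
  using equiv_class_self[OF equiv_self_rel] .

lemma rational_maps_rel: "A \<in> rational_maps \<Longrightarrow> F \<in> A \<Longrightarrow> G \<in> A \<Longrightarrow> (F, G) \<in> self_rel"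
  using rational_maps_rep(2) by blast

lemma self_reps_scaleR:
  assumes "F \<in> self_reps"
  obtains d where "\<And>c v. F (c *\<^sub>R v) = c ^ d *\<^sub>R F v"
proof -
  obtain d where d: "\<And>i. form d (\<lambda>v. F v $ i)" using assms self_repsE by blast
  have "F (c *\<^sub>R v) = c ^ d *\<^sub>R F v" for c v
    using form_scaleR[OF d] by (simp add: vec_eq_iff)
  then show ?thesis by (rule that)
qed

lemma comp_ev:
  assumes "F \<in> self_reps" "G v $ 1 \<noteq> 0"
  obtains c where "c \<noteq> 0" "F (G v) = c *\<^sub>R F (ev G v)"
proof -
  obtain d where "\<And>c v. F (c *\<^sub>R v) = c ^ d *\<^sub>R F v" using self_reps_scaleR[OF assms(1)] by blast
  then have "F (G v) = (G v $ 1) ^ d *\<^sub>R F (ev G v)" using ev_eq[of G v] assms(2) by metis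
  then show ?thesis using that[of "(G v $ 1) ^ d"] assms(2) by simp
qed

lemma comp_nth_1_iff:
  assumes "F \<in> self_reps" "G v $ 1 \<noteq> 0"
  shows "(F \<circ> G) v $ 1 \<noteq> 0 \<longleftrightarrow> F (ev G v) $ 1 \<noteq> 0"
  using comp_ev[where F = F, where G = G, where v = v, OF assms] by fastforce

lemma ev_comp:
  assumes "F \<in> self_reps" "G v $ 1 \<noteq> 0"
  shows "ev (F \<circ> G) v = ev F (ev G v)"
proof -
  obtain c where "c \<noteq> 0" "F (G v) = c *\<^sub>R F (ev G v)" using comp_ev[where F = F, where G = G, where v = v, OF assms] .
  then show ?thesis unfolding ev_def[of "F \<circ> G"] ev_def[of F] by simp
qed

lemma comp_in_self_reps:
  assumes F: "F \<in> self_reps" and G: "G \<in> self_reps" and "v \<in> sph" "F (G v) $ 1 \<noteq> 0"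
  shows "F \<circ> G \<in> self_reps"
proof -
  obtain d e where de: "\<And>i. form d (\<lambda>v. F v $ i)" "\<And>i. form e (\<lambda>v. G v $ i)"
    using F G by (metis self_repsE)
  have "form (d * e) (\<lambda>v. (F \<circ> G) v $ i)" for i
    using form_compose[OF de] by (simp add: comp_def)
  then show ?thesis unfolding self_reps_iff
    using assms self_reps_quadric[OF F] self_reps_quadric[OF G] by auto
qed

text \<open>In the union over all pairs of representatives, pairs with a vanishing composite
  contribute nothing, and all others have the same normalised values at generic points. One pair
  with a non-vanishing composite therefore determines the result.\<close>

lemma rat_comp_eq:
  assumes A: "A \<in> rational_maps" "F \<in> A" and B: "B \<in> rational_maps" "G \<in> B"
    and FG: "F \<circ> G \<in> self_reps"
  shows "rat_comp A B = self_rel `` {F \<circ> G}"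
proof -
  have "self_rel `` {F' \<circ> G'} \<subseteq> self_rel `` {F \<circ> G}" if F': "F' \<in> A" and G': "G' \<in> B" for F' G'
  proof (cases "F' \<circ> G' \<in> self_reps")
    case True
    have r: "F \<in> self_reps" "F' \<in> self_reps" "G \<in> self_reps" "G' \<in> self_reps"
      using A B F' G' rational_maps_rep(1) by auto
    have "(F \<circ> G, F' \<circ> G') \<in> self_rel"
    proof (rule self_rel_generic[OF FG True nonzero_on_sph_mult[OF r(3,4)[THEN self_reps_nonzero]]])
      fix v assume v: "v \<in> sph" "G v $ 1 * G' v $ 1 \<noteq> 0" "(F \<circ> G) v $ 1 \<noteq> 0" "(F' \<circ> G') v $ 1 \<noteq> 0"
      then have g: "G v $ 1 \<noteq> 0" "G' v $ 1 \<noteq> 0" by auto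
      have e: "ev G v = ev G' v"
        using self_rel_ev[OF rational_maps_rel[OF B(1) B(2) G'] v(1) g] .
      have "F (ev G v) $ 1 \<noteq> 0" "F' (ev G v) $ 1 \<noteq> 0"
        using v comp_nth_1_iff[of F G v, OF r(1) g(1)] comp_nth_1_iff[of F' G' v, OF r(2) g(2)] e by auto
      then have "ev F (ev G v) = ev F' (ev G v)"
        using self_rel_ev[OF rational_maps_rel[OF A(1) A(2) F'] ev_in_sph[OF r(3) v(1) g(1)]] by blast
      then show "ev (F \<circ> G) v = ev (F' \<circ> G') v"
        using ev_comp[of F G v, OF r(1) g(1)] ev_comp[of F' G' v, OF r(2) g(2)] e by simp
    qed
    then show ?thesis using equiv_class_eq[OF equiv_self_rel] by blast
  next
    case False
    then show ?thesis by (auto simp: self_rel_iff)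
  qed
  then show ?thesis unfolding rat_comp_def using A(2) B(2) by blast
qed

lemma id_in_self_reps: "id \<in> self_reps"
proof -
  have "\<exists>v\<in>sph. v $ 1 \<noteq> 0" using nonzero_on_sph_1 by (auto simp: nonzero_on_sph_def sph_def)
  then show ?thesis unfolding self_reps_iff using form_nth by auto
qed

lemma rat_id_in_rational_maps: "rat_id \<in> rational_maps"
  unfolding rat_id_def by (rule class_in_rational_maps[OF id_in_self_reps])

lemma id_in_rat_id: "id \<in> rat_id"
  unfolding rat_id_def by (rule rep_in_class[OF id_in_self_reps])

lemma rat_comp_id_left: "A \<in> rational_maps \<Longrightarrow> rat_comp rat_id A = A"
  using rational_maps_ex rational_maps_rep rat_comp_eq[OF rat_id_in_rational_maps id_in_rat_id, of A]
  by (metis id_comp)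

lemma rat_comp_id_right: "A \<in> rational_maps \<Longrightarrow> rat_comp A rat_id = A"
  using rational_maps_ex rational_maps_rep rat_comp_eq[of A _ rat_id id]
  by (metis comp_id rat_id_in_rational_maps id_in_rat_id)

lemma ev_id: "v \<in> sph \<Longrightarrow> ev id v = v"
  unfolding ev_def sph_def by simp

text \<open>Since \<open>B\<close> after \<open>C\<close> is the identity, a generic point is a
  value of \<open>B\<close>, so a form that vanishes on the image of \<open>B\<close> vanishes
  generically.\<close>

lemma right_inverse_dominant:
  assumes B: "B \<in> rational_maps" "G \<in> B" and C: "C \<in> rational_maps" and BC: "rat_comp B C = rat_id"
    and f: "form d f" and nz: "nonzero_on_sph f"
  shows "\<exists>v\<in>sph. f (G v) \<noteq> 0"
proof (rule ccontr)
  assume "\<not> ?thesis"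
  then have z: "f (G v) = 0" if "v \<in> sph" for v using that by blast
  have "id \<in> rat_comp B C" using BC id_in_rat_id by simp
  then obtain G' H where GH: "G' \<in> B" "H \<in> C" "(G' \<circ> H, id) \<in> self_rel"
    unfolding rat_comp_def by blast
  have r: "G \<in> self_reps" "G' \<in> self_reps" "H \<in> self_reps" "G' \<circ> H \<in> self_reps"
    using B C GH rational_maps_rep(1) unfolding self_rel_iff by auto
  \<comment> \<open>The representative \<open>G'\<close> that the composite supplies may differ from
    \<open>G\<close>; the vanishing is carried over where both are non-zero and then
    everywhere.\<close>
  have z': "f (G' v) = 0" if "v \<in> sph" for v
  proof (rule nonzero_on_sph_cancel[where P = "\<lambda>v. G v $ 1 * G' v $ 1", OF _ _ _ that])
    show "nonzero_on_sph (\<lambda>v. G v $ 1 * G' v $ 1)" using r by (intro nonzero_on_sph_mult self_reps_nonzero)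
    obtain e where "\<And>i. form e (\<lambda>v. G' v $ i)" using r(2) self_repsE by blast
    from form_compose[OF f this] show "real_polynomial_function (\<lambda>v. f (G' v))"
      by (simp add: comp_def form_real_polynomial_function)
    fix w assume w: "w \<in> sph" "G w $ 1 * G' w $ 1 \<noteq> 0"
    then have "ev G w = ev G' w" using self_rel_ev[OF rational_maps_rel[OF B GH(1)] w(1)] by simp
    moreover have "f (G w) = (G w $ 1) ^ d * f (ev G w)" "f (G' w) = (G' w $ 1) ^ d * f (ev G' w)"
      using form_scaleR[OF f] ev_eq w(2) by (metis mult_eq_0_iff)+
    ultimately show "f (G' w) = 0" using z[OF w(1)] w(2) by simp
  qed
  obtain v where v: "v \<in> sph" "f v * (H v $ 1 * (G' \<circ> H) v $ 1) \<noteq> 0"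
    using nonzero_on_sph_mult[OF nz nonzero_on_sph_mult[OF r(3,4)[THEN self_reps_nonzero]]]
    by (rule nonzero_on_sphE)
  then have h: "H v $ 1 \<noteq> 0" "(G' \<circ> H) v $ 1 \<noteq> 0" by auto
  have "G' (ev H v) $ 1 \<noteq> 0" using comp_nth_1_iff[of G' H v, OF r(2) h(1)] h(2) by simp
  moreover have "ev G' (ev H v) = v"
    using self_rel_ev[OF GH(3) v(1) h(2)] ev_comp[of G' H v, OF r(2) h(1)] v(1) by (simp add: ev_id sph_def comp_def)
  moreover have "ev H v \<in> sph" by (rule ev_in_sph[OF r(3) v(1) h(1)])
  ultimately have "f v = 0" using z'[of "ev H v"] form_scaleR[OF f] ev_eq
    by (metis mult_eq_0_iff power_not_zero)
  then show False using v(2) by simp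
qed

section \<open>The groups\<close>

definition fibred :: "(real ^ 4 \<Rightarrow> real ^ 4) \<Rightarrow> bool" where
  "fibred F \<longleftrightarrow> (\<forall>v\<in>sph. F v $ 4 = F v $ 1 * v $ 4)"

lemma rat_eq_proj_iff:
  assumes "F \<in> self_reps"
  shows "rat_eq (proj \<circ> F) proj \<longleftrightarrow> fibred F"
proof -
  obtain d where d: "\<And>i. form d (\<lambda>v. F v $ i)" using assms self_repsE by blast
  have p: "proj w $ 1 = w $ 1" "proj w $ 2 = w $ 4" for w by (auto simp: proj_def)
  have "\<forall>i. form d (\<lambda>v. (proj \<circ> F) v $ i)" "\<forall>i. form 1 (\<lambda>v. proj v $ i)"
    unfolding forall_2 comp_def p using d form_nth by blast+
  moreover have "\<exists>v\<in>sph. F v $ 1 \<noteq> 0" using assms unfolding self_reps_iff by blast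
  then have "\<not> zero_on_S (\<lambda>v. (proj \<circ> F) v $ 1)" using zero_on_S_iff[OF d] by (simp add: p)
  moreover have "\<not> zero_on_S (\<lambda>v. proj v $ 1)" using zero_on_S_iff[OF form_nth] nonzero_on_sph_1
    by (auto simp: nonzero_on_sph_def sph_def p)
  ultimately have 1: "rat_rep (proj \<circ> F)" and 2: "rat_rep proj" unfolding rat_rep_def by blast+
  have z: "zero_on_S (\<lambda>v. 0)" using zero_on_S_iff[OF form_0] by simp
  have f: "form (d + 1) (\<lambda>v. F v $ 1 * v $ 4 - F v $ 4 * v $ 1)"
    "form (d + 1) (\<lambda>v. F v $ 4 * v $ 1 - F v $ 1 * v $ 4)"
    by (intro form_diff form_mult d form_nth)+
  show ?thesis
    unfolding rat_eq_def fibred_def using 1 2 z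
    by (auto simp: forall_2 p zero_on_S_iff[OF f(1)] zero_on_S_iff[OF f(2)] sph_def)
qed

lemma fibred_ev: "fibred F \<Longrightarrow> v \<in> sph \<Longrightarrow> F v $ 1 \<noteq> 0 \<Longrightarrow> ev F v $ 4 = v $ 4"
  unfolding fibred_def ev_def by simp

lemma fibred_generic:
  assumes "F \<in> self_reps" "nonzero_on_sph P" "\<And>v. v \<in> sph \<Longrightarrow> P v \<noteq> 0 \<Longrightarrow> F v $ 1 \<noteq> 0 \<Longrightarrow> ev F v $ 4 = v $ 4"
  shows "fibred F"
proof -
  have "F v $ 4 - F v $ 1 * v $ 4 = 0" if v: "v \<in> sph" for v
  proof (rule nonzero_on_sph_cancel[where P = "\<lambda>v. P v * F v $ 1", OF _ _ _ v])
    show "nonzero_on_sph (\<lambda>v. P v * F v $ 1)" using assms by (intro nonzero_on_sph_mult self_reps_nonzero)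
    show "real_polynomial_function (\<lambda>v. F v $ 4 - F v $ 1 * v $ 4)"
      using assms(1) by (intro real_polynomial_function_diff real_polynomial_function.intros(4)
          self_reps_polynomial real_polynomial_function_nth)
    fix w assume w: "w \<in> sph" "P w * F w $ 1 \<noteq> 0"
    then have "ev F w $ 4 = w $ 4" using assms(3) by simp
    then show "F w $ 4 - F w $ 1 * w $ 4 = 0" using w(2) unfolding ev_def by (simp add: field_simps)
  qed
  then show ?thesis unfolding fibred_def by simp
qed

lemma Bir_simps [simp]: "mult Bir_S = rat_comp" "one Bir_S = rat_id"
  unfolding Bir_S_def by simp_all

lemma Bir_carrier_iff:
  "A \<in> carrier Bir_S \<longleftrightarrow> A \<in> rational_maps \<and>
     (\<exists>B\<in>rational_maps. rat_comp A B = rat_id \<and> rat_comp B A = rat_id) \<and> (\<forall>F\<in>A. fibred F)"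
  unfolding Bir_S_def birational_def using rat_eq_proj_iff rational_maps_rep(1) by auto

lemma Bir_rational: "A \<in> carrier Bir_S \<Longrightarrow> A \<in> rational_maps"
  unfolding Bir_carrier_iff by blast

lemma Bir_rep: "A \<in> carrier Bir_S \<Longrightarrow> F \<in> A \<Longrightarrow> F \<in> self_reps"
  using Bir_rational rational_maps_rep(1) by blast

lemma Bir_fibred: "A \<in> carrier Bir_S \<Longrightarrow> F \<in> A \<Longrightarrow> fibred F"
  unfolding Bir_carrier_iff by blast

lemma Bir_ex: "A \<in> carrier Bir_S \<Longrightarrow> \<exists>F. F \<in> A"
  using Bir_rational rational_maps_ex by blast

lemma fibred_class:
  assumes "A \<in> rational_maps" "F \<in> A" "fibred F" "G \<in> A"
  shows "fibred G"
proof -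
  have r: "F \<in> self_reps" "G \<in> self_reps" using assms rational_maps_rep(1) by auto
  show ?thesis
    by (rule fibred_generic[OF r(2) self_reps_nonzero[OF r(1)]])
      (use assms self_rel_ev[OF rational_maps_rel] fibred_ev in metis)
qed

text \<open>The inner map is dominant because it has a right inverse, so no choice of
  representatives makes the composite vanish. Composition is thereby total on
  \<open>Bir_S\<close>.\<close>

lemma comp_Bir_in_self_reps:
  assumes A: "A \<in> rational_maps" "F \<in> A" and B: "B \<in> carrier Bir_S" "G \<in> B"
  shows "F \<circ> G \<in> self_reps"
proof -
  have r: "F \<in> self_reps" "G \<in> self_reps" using A B rational_maps_rep(1) Bir_rep by auto
  obtain C where C: "C \<in> rational_maps" "rat_comp B C = rat_id" using B(1) Bir_carrier_iff by blast
  obtain d where "\<And>i. form d (\<lambda>v. F v $ i)" using r(1) self_repsE by blast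
  then obtain v where "v \<in> sph" "F (G v) $ 1 \<noteq> 0"
    using right_inverse_dominant[OF Bir_rational[OF B(1)] B(2) C _ self_reps_nonzero[OF r(1)]] by blast
  then show ?thesis using comp_in_self_reps r by blast
qed

lemma rat_comp_Bir:
  assumes "A \<in> rational_maps" "F \<in> A" "B \<in> carrier Bir_S" "G \<in> B"
  shows "rat_comp A B = self_rel `` {F \<circ> G}" "rat_comp A B \<in> rational_maps" "F \<circ> G \<in> rat_comp A B"
  using rat_comp_eq[OF assms(1,2) Bir_rational[OF assms(3)] assms(4) comp_Bir_in_self_reps[OF assms]]
    class_in_rational_maps rep_in_class comp_Bir_in_self_reps[OF assms] by auto

lemma rat_comp_assoc:
  assumes "A \<in> rational_maps" "B \<in> carrier Bir_S" "C \<in> carrier Bir_S"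
  shows "rat_comp (rat_comp A B) C = rat_comp A (rat_comp B C)"
proof -
  obtain F G H where FGH: "F \<in> A" "G \<in> B" "H \<in> C"
    using rational_maps_ex[OF assms(1)] Bir_ex[OF assms(2)] Bir_ex[OF assms(3)] by blast
  note AB = rat_comp_Bir[OF assms(1) FGH(1) assms(2) FGH(2)]
  note BC = rat_comp_Bir[OF Bir_rational[OF assms(2)] FGH(2) assms(3) FGH(3)]
  note ABC = rat_comp_Bir[OF AB(2,3) assms(3) FGH(3)]
  have "F \<circ> (G \<circ> H) \<in> self_reps"
    using comp_Bir_in_self_reps[OF AB(2,3) assms(3) FGH(3)] by (simp add: comp_assoc)
  then have "rat_comp A (rat_comp B C) = self_rel `` {F \<circ> (G \<circ> H)}"
    using rat_comp_eq[OF assms(1) FGH(1) BC(2,3)] by simp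
  then show ?thesis using ABC(1) by (simp add: comp_assoc)
qed

text \<open>If F(G'(v)) = v and F keeps the coordinate z, then v and G'(v) have the same z.\<close>

lemma Bir_inverse:
  assumes A: "A \<in> carrier Bir_S" and B: "B \<in> rational_maps" "rat_comp A B = rat_id" "rat_comp B A = rat_id"
  shows "B \<in> carrier Bir_S"
proof -
  have "\<forall>G\<in>B. fibred G"
  proof
    fix G assume G: "G \<in> B"
    have "id \<in> rat_comp A B" using B id_in_rat_id by simp
    then obtain F G' where FG: "F \<in> A" "G' \<in> B" "(F \<circ> G', id) \<in> self_rel"
      unfolding rat_comp_def by blast
    have r: "F \<in> self_reps" "G' \<in> self_reps" "F \<circ> G' \<in> self_reps"
      using Bir_rep[OF A FG(1)] rational_maps_rep(1)[OF B(1) FG(2)] FG(3) unfolding self_rel_iff by auto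
    have "fibred G'"
    proof (rule fibred_generic[OF r(2) self_reps_nonzero[OF r(3)]])
      fix v assume v: "v \<in> sph" "(F \<circ> G') v $ 1 \<noteq> 0" "G' v $ 1 \<noteq> 0"
      have "ev F (ev G' v) = v"
        using self_rel_ev[OF FG(3) v(1,2)] ev_comp[of F G' v, OF r(1) v(3)] v(1) by (simp add: ev_id sph_def comp_def)
      moreover have "F (ev G' v) $ 1 \<noteq> 0" using comp_nth_1_iff[of F G' v, OF r(1) v(3)] v(2) by simp
      ultimately show "ev G' v $ 4 = v $ 4"
        using fibred_ev[OF Bir_fibred[OF A FG(1)] ev_in_sph[OF r(2) v(1,3)]] by simp
    qed
    then show "fibred G" using fibred_class B(1) FG(2) G by blast
  qed
  then show ?thesis using assms Bir_rational[OF A] unfolding Bir_carrier_iff by blast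
qed

lemma group_Bir: "group Bir_S"
proof (rule groupI)
  fix A B assume A: "A \<in> carrier Bir_S" and B: "B \<in> carrier Bir_S"
  obtain A' B' where A': "A' \<in> rational_maps" "rat_comp A A' = rat_id" "rat_comp A' A = rat_id"
    and B': "B' \<in> rational_maps" "rat_comp B B' = rat_id" "rat_comp B' B = rat_id"
    using A B Bir_carrier_iff by metis
  have i: "A' \<in> carrier Bir_S" "B' \<in> carrier Bir_S" using Bir_inverse A B A' B' by auto
  obtain F G F' G' where F: "F \<in> A" "G \<in> B" "F' \<in> A'" "G' \<in> B'" using Bir_ex A B i by metis
  note AB = rat_comp_Bir[OF Bir_rational[OF A] F(1) B F(2)]
  note BA' = rat_comp_Bir[OF B'(1) F(4) i(1) F(3)]
  have f: "fibred (F \<circ> G)"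
  proof (rule fibred_generic[OF rational_maps_rep(1)[OF AB(2,3)] self_reps_nonzero[OF Bir_rep[OF B F(2)]]])
    fix v assume v: "v \<in> sph" "G v $ 1 \<noteq> 0" "(F \<circ> G) v $ 1 \<noteq> 0"
    have "F (ev G v) $ 1 \<noteq> 0" using comp_nth_1_iff[of F G v, OF Bir_rep[OF A F(1)] v(2)] v(3) by simp
    then show "ev (F \<circ> G) v $ 4 = v $ 4"
      using fibred_ev[OF Bir_fibred[OF A F(1)] ev_in_sph[OF Bir_rep[OF B F(2)] v(1,2)]]
        fibred_ev[OF Bir_fibred[OF B F(2)] v(1,2)] ev_comp[of F G v, OF Bir_rep[OF A F(1)] v(2)] by simp
  qed
  have "rat_comp (rat_comp A B) (rat_comp B' A') = rat_id"
  proof -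
    have "rat_comp (rat_comp A B) (rat_comp B' A') = rat_comp (rat_comp (rat_comp A B) B') A'"
      using rat_comp_assoc[OF AB(2) i(2,1)] by simp
    also have "\<dots> = rat_id"
      using rat_comp_assoc[OF Bir_rational[OF A] B i(2)] A' B' rat_comp_id_right[OF Bir_rational[OF A]] by simp
    finally show ?thesis .
  qed
  moreover have "rat_comp (rat_comp B' A') (rat_comp A B) = rat_id"
  proof -
    have "rat_comp (rat_comp B' A') (rat_comp A B) = rat_comp (rat_comp (rat_comp B' A') A) B"
      using rat_comp_assoc[OF BA'(2) A B] by simp
    also have "\<dots> = rat_id"
      using rat_comp_assoc[OF B'(1) i(1) A] A' B' rat_comp_id_right[OF B'(1)] by simp
    finally show ?thesis .
  qed
  ultimately show "A \<otimes>\<^bsub>Bir_S\<^esub> B \<in> carrier Bir_S"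
    using AB BA'(2) f fibred_class[OF AB(2,3) f] unfolding Bir_carrier_iff by auto
next
  have "fibred id" unfolding fibred_def sph_def by auto
  then show "\<one>\<^bsub>Bir_S\<^esub> \<in> carrier Bir_S"
    using rat_id_in_rational_maps fibred_class[OF rat_id_in_rational_maps id_in_rat_id]
      rat_comp_id_left[OF rat_id_in_rational_maps] unfolding Bir_carrier_iff by auto
next
  fix A assume A: "A \<in> carrier Bir_S"
  show "\<one>\<^bsub>Bir_S\<^esub> \<otimes>\<^bsub>Bir_S\<^esub> A = A" using rat_comp_id_left[OF Bir_rational[OF A]] by simp
  show "\<exists>B\<in>carrier Bir_S. B \<otimes>\<^bsub>Bir_S\<^esub> A = \<one>\<^bsub>Bir_S\<^esub>"
    using A Bir_inverse[OF A] Bir_carrier_iff by (metis Bir_simps)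
next
  fix A B C assume "A \<in> carrier Bir_S" "B \<in> carrier Bir_S" "C \<in> carrier Bir_S"
  then show "A \<otimes>\<^bsub>Bir_S\<^esub> B \<otimes>\<^bsub>Bir_S\<^esub> C = A \<otimes>\<^bsub>Bir_S\<^esub> (B \<otimes>\<^bsub>Bir_S\<^esub> C)"
    using rat_comp_assoc Bir_rational by simp
qed

interpretation Bir: group Bir_S by (rule group_Bir)

lemma regular_iff:
  assumes "A \<in> rational_maps"
  shows "regular_on_real_points A \<longleftrightarrow> (\<forall>v\<in>sph. \<exists>F\<in>A. F v $ 1 \<noteq> 0)"
proof
  assume *: "regular_on_real_points A"
  show "\<forall>v\<in>sph. \<exists>F\<in>A. F v $ 1 \<noteq> 0"
  proof
    fix v assume v: "v \<in> sph"
    then have "v \<noteq> 0" "quadric v = 0" unfolding sph_def by auto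
    then obtain F where "F \<in> A" "F v \<noteq> 0" using * unfolding regular_on_real_points_def defined_at_def by blast
    then show "\<exists>F\<in>A. F v $ 1 \<noteq> 0" using self_reps_eq_0 rational_maps_rep(1)[OF assms] v by metis
  qed
next
  assume *: "\<forall>v\<in>sph. \<exists>F\<in>A. F v $ 1 \<noteq> 0"
  show "regular_on_real_points A" unfolding regular_on_real_points_def defined_at_def
  proof (intro allI impI)
    fix p :: "real ^ 4" assume p: "p \<noteq> 0 \<and> quadric p = 0"
    then obtain c w where cw: "c \<noteq> 0" "w \<in> sph" "p = c *\<^sub>R w" by (metis cone_cases)
    then obtain F where F: "F \<in> A" "F w $ 1 \<noteq> 0" using * by blast
    obtain d where "\<And>c v. F (c *\<^sub>R v) = c ^ d *\<^sub>R F v"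
      using self_reps_scaleR[OF rational_maps_rep(1)[OF assms F(1)]] by blast
    then have "F p = c ^ d *\<^sub>R F w" using cw by simp
    then have "F p \<noteq> 0" using cw(1) F(2) by auto
    then show "\<exists>F\<in>A. F p \<noteq> 0" using F(1) by blast
  qed
qed

lemma regular_comp:
  assumes A: "A \<in> carrier Bir_S" "regular_on_real_points A" and B: "B \<in> carrier Bir_S" "regular_on_real_points B"
  shows "regular_on_real_points (rat_comp A B)"
proof -
  have AB: "rat_comp A B \<in> rational_maps" using Bir_rational[OF Bir.m_closed[OF A(1) B(1)]] by simp
  show ?thesis unfolding regular_iff[OF AB]
  proof
    fix v assume v: "v \<in> sph"
    then obtain G where G: "G \<in> B" "G v $ 1 \<noteq> 0" using B regular_iff[OF Bir_rational[OF B(1)]] by blast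
    then have "ev G v \<in> sph" using ev_in_sph[OF Bir_rep[OF B(1) G(1)] v] by blast
    then obtain F where F: "F \<in> A" "F (ev G v) $ 1 \<noteq> 0" using A regular_iff[OF Bir_rational[OF A(1)]] by blast
    have "(F \<circ> G) v $ 1 \<noteq> 0" using comp_nth_1_iff[of F G v, OF Bir_rep[OF A(1) F(1)] G(2)] F(2) by simp
    then show "\<exists>H\<in>rat_comp A B. H v $ 1 \<noteq> 0"
      using rat_comp_Bir(3)[OF Bir_rational[OF A(1)] F(1) B(1) G(1)] by blast
  qed
qed

lemma Aut_carrier_iff:
  "A \<in> carrier Aut_SR \<longleftrightarrow> A \<in> carrier Bir_S \<and> regular_on_real_points A
     \<and> regular_on_real_points (inv\<^bsub>Bir_S\<^esub> A)"
  unfolding Aut_SR_def by simp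

lemma subgroup_Aut: "subgroup (carrier Aut_SR) Bir_S"
proof (rule Bir.subgroupI)
  show "carrier Aut_SR \<subseteq> carrier Bir_S" using Aut_carrier_iff by blast
  have "regular_on_real_points rat_id"
    unfolding regular_iff[OF rat_id_in_rational_maps] using id_in_rat_id
    by (intro ballI bexI[of _ id]) (auto simp: sph_def)
  then have "rat_id \<in> carrier Aut_SR" unfolding Aut_carrier_iff using Bir.one_closed Bir.inv_one by simp
  then show "carrier Aut_SR \<noteq> {}" by blast
  show "inv\<^bsub>Bir_S\<^esub> A \<in> carrier Aut_SR" if "A \<in> carrier Aut_SR" for A
    using that unfolding Aut_carrier_iff by simp
  show "A \<otimes>\<^bsub>Bir_S\<^esub> B \<in> carrier Aut_SR" if "A \<in> carrier Aut_SR" "B \<in> carrier Aut_SR" for A B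
    using that unfolding Aut_carrier_iff using regular_comp Bir.inv_mult_group Bir.m_closed Bir.inv_closed
    by simp
qed

lemma Aut_eq: "Aut_SR = Bir_S\<lparr>carrier := carrier Aut_SR\<rparr>"
  unfolding Aut_SR_def by simp

lemma group_Aut: "group Aut_SR"
  using subgroup.subgroup_is_group[OF subgroup_Aut group_Bir] Aut_eq by simp

lemma Aut_simps [simp]: "mult Aut_SR = rat_comp" "one Aut_SR = rat_id"
  unfolding Aut_SR_def by simp_all

lemma Aut_inv: "A \<in> carrier Aut_SR \<Longrightarrow> inv\<^bsub>Aut_SR\<^esub> A = inv\<^bsub>Bir_S\<^esub> A"
  using Bir.m_inv_consistent[OF subgroup_Aut] Aut_eq by metis

lemma Aut_order_2:
  assumes "g \<in> carrier Aut_SR" "group.ord Aut_SR g = 2"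
  shows "rat_comp g g = rat_id" "g \<noteq> rat_id"
proof -
  interpret Aut: group Aut_SR by (rule group_Aut)
  have "g [^]\<^bsub>Aut_SR\<^esub> (2 :: nat) = rat_id" "g [^]\<^bsub>Aut_SR\<^esub> (1 :: nat) \<noteq> rat_id"
    using Aut.pow_eq_id[OF assms(1), of 2] Aut.pow_eq_id[OF assms(1), of 1] assms(2) by auto
  then show "rat_comp g g = rat_id" "g \<noteq> rat_id"
    using assms(1) Aut.l_one[OF assms(1)] by (simp_all add: numeral_2_eq_2)
qed

text \<open>The inverse has a representative that is non-zero at the common image point, and it
  recovers both \<open>v\<close> and \<open>w\<close>. Two representatives \<open>F\<close> and
  \<open>F'\<close> are allowed because a single one need not be non-zero at both points.\<close>

lemma Aut_ev_inj:
  assumes A: "A \<in> carrier Aut_SR" and F: "F \<in> A" "F v $ 1 \<noteq> 0" "F' \<in> A" "F' w $ 1 \<noteq> 0"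
    and vw: "v \<in> sph" "w \<in> sph" "ev F v = ev F' w"
  shows "v = w"
proof -
  define B where "B = inv\<^bsub>Bir_S\<^esub> A"
  have A': "A \<in> carrier Bir_S" using A Aut_carrier_iff by blast
  have B: "B \<in> carrier Bir_S" "regular_on_real_points B" using A unfolding B_def Aut_carrier_iff by auto
  have BA: "rat_comp B A = rat_id" using Bir.l_inv[OF A'] unfolding B_def by simp
  have "ev F v \<in> sph" using ev_in_sph[OF Bir_rep[OF A' F(1)] vw(1) F(2)] .
  then obtain G where G: "G \<in> B" "G (ev F v) $ 1 \<noteq> 0" using B regular_iff[OF Bir_rational[OF B(1)]] by blast
  have *: "ev G (ev H x) = x" if H: "H \<in> A" "H x $ 1 \<noteq> 0" "x \<in> sph" "G (ev H x) $ 1 \<noteq> 0" for H x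
  proof -
    have "G \<circ> H \<in> rat_id" using rat_comp_Bir(3)[OF Bir_rational[OF B(1)] G(1) A' H(1)] BA by simp
    then have "(G \<circ> H, id) \<in> self_rel"
      using rational_maps_rel[OF rat_id_in_rational_maps _ id_in_rat_id] by blast
    moreover have "(G \<circ> H) x $ 1 \<noteq> 0" using comp_nth_1_iff[of G H x, OF Bir_rep[OF B(1) G(1)] H(2)] H(4) by simp
    ultimately show ?thesis
      using self_rel_ev[of "G \<circ> H" id x] ev_comp[of G H x, OF Bir_rep[OF B(1) G(1)] H(2)] H(3)
      by (simp add: ev_id sph_def comp_def)
  qed
  show ?thesis using *[OF F(1,2) vw(1) G(2)] *[OF F(3,4) vw(2)] G(2) vw(3) by simp
qed

section \<open>Fibrewise Moebius transformations\<close>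

text \<open>The coordinate \<open>x + \<i> y\<close>. On the fibre over \<open>z = t\<close> it runs through the circle
  \<open>u * cnj u = 1 - t\<^sup>2\<close>.\<close>

definition uc :: "real ^ 4 \<Rightarrow> complex" where
  "uc v = Complex (v $ 2) (v $ 3)"

lemma uc_scaleR [simp]: "uc (c *\<^sub>R v) = of_real c * uc v"
  unfolding uc_def by (simp add: complex_eq_iff)

lemma uc_norm:
  assumes "v \<in> sph"
  shows "uc v * cnj (uc v) = 1 - (of_real (v $ 4))\<^sup>2"
proof -
  have "(v $ 2)\<^sup>2 + (v $ 3)\<^sup>2 = 1 - (v $ 4)\<^sup>2" using assms unfolding sph_def quadric_def by auto
  then have "uc v * cnj (uc v) = of_real (1 - (v $ 4)\<^sup>2)"
    unfolding complex_norm_square[symmetric] by (simp add: uc_def cmod_power2)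
  then show ?thesis by simp
qed

lemma sph_ex:
  assumes "u * cnj u = 1 - (of_real t)\<^sup>2"
  obtains v where "v \<in> sph" "uc v = u" "v $ 4 = t"
proof -
  have "of_real ((Re u)\<^sup>2 + (Im u)\<^sup>2) = (of_real (1 - t\<^sup>2) :: complex)"
    using assms unfolding complex_norm_square[symmetric] by (simp add: cmod_power2)
  then have "(Re u)\<^sup>2 + (Im u)\<^sup>2 = 1 - t\<^sup>2" unfolding of_real_eq_iff .
  then have "vector [1, Re u, Im u, t] \<in> sph" unfolding sph_def quadric_def by simp
  then show ?thesis using that[of "vector [1, Re u, Im u, t]"] unfolding uc_def by simp
qed

lemma sph_nth_4_bounds: "v \<in> sph \<Longrightarrow> v $ 4 \<in> {-1..1}"
proof -
  assume "v \<in> sph"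
  then have "(v $ 2)\<^sup>2 + (v $ 3)\<^sup>2 = 1 - (v $ 4)\<^sup>2" unfolding sph_def quadric_def by auto
  then have "(v $ 4)\<^sup>2 \<le> 1" by (smt (verit) zero_le_power2)
  then show ?thesis using abs_le_square_iff[of "v $ 4" 1] by auto
qed

section \<open>The ring of complex polynomials in t, as functions of a real variable\<close>

definition cpoly :: "(real \<Rightarrow> complex) \<Rightarrow> bool" where
  "cpoly f \<longleftrightarrow> (\<exists>p. \<forall>t. f t = poly p (of_real t))"

lemma cpoly_poly: "cpoly (\<lambda>t. poly p (of_real t))"
  unfolding cpoly_def by blast

lemma cpoly_const [intro]: "cpoly (\<lambda>t. c)"
  unfolding cpoly_def by (rule exI[of _ "[:c:]"]) simp

lemma cpoly_of_real [intro]: "cpoly (\<lambda>t. of_real t)"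
  unfolding cpoly_def by (rule exI[of _ "[:0, 1:]"]) simp

lemma cpoly_add [intro]: "cpoly f \<Longrightarrow> cpoly g \<Longrightarrow> cpoly (\<lambda>t. f t + g t)"
  unfolding cpoly_def by (metis poly_add)

lemma cpoly_diff [intro]: "cpoly f \<Longrightarrow> cpoly g \<Longrightarrow> cpoly (\<lambda>t. f t - g t)"
  unfolding cpoly_def by (metis poly_diff)

lemma cpoly_minus [intro]: "cpoly f \<Longrightarrow> cpoly (\<lambda>t. - f t)"
  unfolding cpoly_def by (metis poly_minus)

lemma cpoly_mult [intro]: "cpoly f \<Longrightarrow> cpoly g \<Longrightarrow> cpoly (\<lambda>t. f t * g t)"
  unfolding cpoly_def by (metis poly_mult)

lemma cpoly_power [intro]: "cpoly f \<Longrightarrow> cpoly (\<lambda>t. f t ^ n)"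
  unfolding cpoly_def by (metis poly_power)

text \<open>The variable is real, so pointwise conjugation amounts to conjugating the
  coefficients.\<close>

lemma cpoly_cnj [intro]:
  assumes "cpoly f" shows "cpoly (\<lambda>t. cnj (f t))"
proof -
  obtain p where "\<And>t. f t = poly p (of_real t)" using assms unfolding cpoly_def by blast
  moreover have "cnj (poly p (of_real t)) = poly (map_poly cnj p) (of_real t)" for t
    by (induction p) (auto simp: map_poly_pCons)
  ultimately show ?thesis unfolding cpoly_def by metis
qed

lemma cpoly_real_poly [intro]: "cpoly (\<lambda>t. of_real (poly p t))"
proof -
  have "of_real (poly p t) = poly (map_poly of_real p :: complex poly) (of_real t)" for t
    by (induction p) (auto simp: map_poly_pCons)
  then show ?thesis unfolding cpoly_def by blast
qed

lemma cpoly_Re_Im: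
  assumes "cpoly f"
  obtains p q where "\<And>t. f t = Complex (poly p t) (poly q t)"
proof -
  obtain P where P: "\<And>t. f t = poly P (of_real t)" using assms unfolding cpoly_def by blast
  have "Re (poly P (of_real t)) = poly (map_poly Re P) t" "Im (poly P (of_real t)) = poly (map_poly Im P) t" for t
    by (induction P) (auto simp: map_poly_pCons)
  then show ?thesis using that[of "map_poly Re P" "map_poly Im P"] P by (simp add: complex_eq_iff)
qed

lemma cpoly_finite_zeros:
  assumes "cpoly f" "f s \<noteq> 0"
  shows "finite {t. f t = 0}"
proof -
  obtain p where p: "\<And>t. f t = poly p (of_real t)" using assms unfolding cpoly_def by blast
  then have "p \<noteq> 0" using assms(2) by auto
  then have "finite (of_real -` {z :: complex. poly p z = 0} :: real set)"
    by (intro finite_vimageI poly_roots_finite) (auto simp: inj_def)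
  then show ?thesis using p by (simp add: vimage_def)
qed

text \<open>The sphere has points only over [-1, 1], but identities read off from it extend to all
  real t, in particular to t > 1, where the norm is definite.\<close>

lemma cpoly_eq_0:
  assumes "cpoly f" "\<And>t. -1 < t \<Longrightarrow> t < 1 \<Longrightarrow> f t = 0"
  shows "f t = 0"
proof (rule ccontr)
  assume "f t \<noteq> 0"
  then have "finite {t. f t = 0}" by (rule cpoly_finite_zeros[OF assms(1)])
  then have "finite {-1<..<1 :: real}" by (rule finite_subset[rotated]) (use assms(2) in auto)
  then show False using infinite_Ioo[of "-1" "1 :: real"] by simp
qed

definition cpf :: "(real ^ 4 \<Rightarrow> complex) \<Rightarrow> bool" where
  "cpf g \<longleftrightarrow> real_polynomial_function (\<lambda>v. Re (g v)) \<and> real_polynomial_function (\<lambda>v. Im (g v))"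

lemma cpf_const [intro]: "cpf (\<lambda>v. c)"
  unfolding cpf_def by auto

lemma cpf_add [intro]: "cpf f \<Longrightarrow> cpf g \<Longrightarrow> cpf (\<lambda>v. f v + g v)"
  unfolding cpf_def by (auto intro: real_polynomial_function.intros(3))

lemma cpf_diff [intro]: "cpf f \<Longrightarrow> cpf g \<Longrightarrow> cpf (\<lambda>v. f v - g v)"
  unfolding cpf_def by (auto intro: real_polynomial_function_diff)

lemma cpf_mult [intro]: "cpf f \<Longrightarrow> cpf g \<Longrightarrow> cpf (\<lambda>v. f v * g v)"
  unfolding cpf_def
  by (auto intro!: real_polynomial_function_diff real_polynomial_function.intros(3) real_polynomial_function.intros(4))

lemma cpf_power [intro]: "cpf f \<Longrightarrow> cpf (\<lambda>v. f v ^ n)"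
  by (induction n) auto

lemma cpf_cnj [intro]: "cpf f \<Longrightarrow> cpf (\<lambda>v. cnj (f v))"
  unfolding cpf_def by (auto intro: real_polynomial_function_minus)

lemma cpf_of_real [intro]: "real_polynomial_function f \<Longrightarrow> cpf (\<lambda>v. of_real (f v))"
  unfolding cpf_def by auto

lemma cpf_uc [intro]: "cpf uc"
  unfolding cpf_def uc_def by (auto intro: real_polynomial_function_nth)

lemma cpf_cpoly [intro]:
  assumes "cpoly f" shows "cpf (\<lambda>v. f (v $ i))"
proof -
  obtain p where p: "\<And>t. f t = poly p (of_real t)" using assms unfolding cpoly_def by blast
  have "cpf (\<lambda>v. poly p (of_real (v $ i)))"
    by (induction p) (auto intro!: cpf_add cpf_mult cpf_of_real)
  then show ?thesis using p by simp
qed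

lemma cpf_uc_comp: "F \<in> self_reps \<Longrightarrow> cpf (\<lambda>v. uc (F v))"
  unfolding cpf_def uc_def by (simp add: self_reps_polynomial)

lemma cpf_nonzero:
  assumes "cpf g" "v \<in> sph" "g v \<noteq> 0"
  shows "nonzero_on_sph (\<lambda>v. (cmod (g v))\<^sup>2)"
  using assms unfolding nonzero_on_sph_def cpf_def cmod_power2
  by (auto intro!: real_polynomial_function.intros(3) real_polynomial_function_power bexI[of _ v]
      simp: complex_neq_0)

lemma cpf_cancel:
  assumes "nonzero_on_sph P" "cpf f" "\<And>v. v \<in> sph \<Longrightarrow> P v \<noteq> 0 \<Longrightarrow> f v = 0" "v \<in> sph"
  shows "f v = 0"
proof -
  have "Re (f v) = 0" "Im (f v) = 0"
    using assms nonzero_on_sph_cancel[OF assms(1), of "\<lambda>v. Re (f v)" v]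
      nonzero_on_sph_cancel[OF assms(1), of "\<lambda>v. Im (f v)" v] unfolding cpf_def by auto
  then show ?thesis by (simp add: complex_eq_iff)
qed

text \<open>The quaternion \<open>a + b j\<close> over \<open>\<real>[t]\<close>, with \<open>j\<^sup>2 = 1 - t\<^sup>2\<close> and \<open>j c = cnj c j\<close> for \<open>c \<in> \<complex>[t]\<close>,
  acts on the fibre over \<open>t\<close> by \<open>u \<mapsto> (a u + b (1 - t\<^sup>2)) / (cnj b u + cnj a)\<close>.\<close>

definition mob_num :: "(real \<Rightarrow> complex) \<Rightarrow> (real \<Rightarrow> complex) \<Rightarrow> real ^ 4 \<Rightarrow> complex" where
  "mob_num a b v = a (v $ 4) * uc v + b (v $ 4) * (1 - (of_real (v $ 4))\<^sup>2)"

definition mob_den :: "(real \<Rightarrow> complex) \<Rightarrow> (real \<Rightarrow> complex) \<Rightarrow> real ^ 4 \<Rightarrow> complex" where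
  "mob_den a b v = cnj (b (v $ 4)) * uc v + cnj (a (v $ 4))"

text \<open>The action is stated cross-multiplied, so it can be required of every representative at
  every point without a condition on denominators. The pair may have common zeros; real polynomial
  factors do not change the map.\<close>

definition moebius :: "rational_map \<Rightarrow> (real \<Rightarrow> complex) \<Rightarrow> (real \<Rightarrow> complex) \<Rightarrow> bool" where
  "moebius A a b \<longleftrightarrow> A \<in> rational_maps \<and> (\<forall>F\<in>A. fibred F) \<and> cpoly a \<and> cpoly b \<and>
     (\<exists>t. a t \<noteq> 0 \<or> b t \<noteq> 0) \<and>
     (\<forall>F\<in>A. \<forall>v\<in>sph. uc (F v) * mob_den a b v = of_real (F v $ 1) * mob_num a b v)"

lemma cpf_mob:
  assumes "cpoly a" "cpoly b"
  shows "cpf (mob_num a b)" "cpf (mob_den a b)"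
  unfolding mob_num_def[abs_def] mob_den_def[abs_def] using assms
  by (auto intro!: cpf_add cpf_mult cpf_diff cpf_power cpf_of_real)

lemma sph_circle:
  assumes "-1 < t" "t < 1"
  obtains r :: real where "r > 0" "\<And>s. s * cnj s = 1 \<Longrightarrow> \<exists>v\<in>sph. v $ 4 = t \<and> uc v = of_real r * s"
proof -
  have "t\<^sup>2 < 1" using assms abs_square_less_1[of t] by simp
  then have "sqrt (1 - t\<^sup>2) > 0" "(sqrt (1 - t\<^sup>2))\<^sup>2 = 1 - t\<^sup>2" by auto
  moreover have "\<exists>v\<in>sph. v $ 4 = t \<and> uc v = of_real r * s"
    if "r\<^sup>2 = 1 - t\<^sup>2" "s * cnj s = 1" for r s
  proof -
    have "(of_real r * s) * cnj (of_real r * s) = of_real (r\<^sup>2) * (s * cnj s)"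
      by (simp add: power2_eq_square)
    also have "\<dots> = 1 - (of_real t)\<^sup>2" using that by simp
    finally show ?thesis using sph_ex by metis
  qed
  ultimately show ?thesis using that by blast
qed

text \<open>The denominator is affine in u. Each fibre with -1 < t < 1 contains u = r and u = -r for
  some r > 0, and vanishing at both points kills both coefficients.\<close>

lemma mob_den_nonzero:
  assumes "cpoly a" "cpoly b" "a s \<noteq> 0 \<or> b s \<noteq> 0"
  shows "nonzero_on_sph (\<lambda>v. (cmod (mob_den a b v))\<^sup>2)"
proof (rule ccontr)
  assume "\<not> ?thesis"
  then have z: "mob_den a b v = 0" if "v \<in> sph" for v
    using cpf_nonzero[OF cpf_mob(2)[OF assms(1,2)] that] by blast
  have "a t = 0 \<and> b t = 0" if t: "-1 < t" "t < 1" for t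
  proof -
    obtain r :: real where r: "r > 0" "\<And>s. s * cnj s = 1 \<Longrightarrow> \<exists>v\<in>sph. v $ 4 = t \<and> uc v = of_real r * s"
      using sph_circle[OF t] by blast
    obtain v w where "v \<in> sph" "v $ 4 = t" "uc v = of_real r" "w \<in> sph" "w $ 4 = t" "uc w = - of_real r"
      using r(2)[of 1] r(2)[of "-1"] by auto
    then have "cnj (b t) * of_real r + cnj (a t) = 0" "- (cnj (b t) * of_real r) + cnj (a t) = 0"
      using z[of v] z[of w] unfolding mob_den_def by auto
    moreover have "2 * cnj (a t) = (cnj (b t) * of_real r + cnj (a t)) + (- (cnj (b t) * of_real r) + cnj (a t))"
      "2 * (cnj (b t) * of_real r) = (cnj (b t) * of_real r + cnj (a t)) - (- (cnj (b t) * of_real r) + cnj (a t))"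
      by (simp_all add: algebra_simps)
    ultimately have "2 * cnj (a t) = 0" "2 * (cnj (b t) * of_real r) = 0" by (simp_all only: add_0 diff_0_right)
    then show ?thesis using r(1) by simp
  qed
  then have "a s = 0" "b s = 0" using cpoly_eq_0[OF assms(1)] cpoly_eq_0[OF assms(2)] by auto
  then show False using assms(3) by simp
qed

text \<open>A single representative at generic points is enough: any other one is proportional to
  it, and the factor \<open>P v * F v $ 1\<close> cancels.\<close>

lemma moebiusI:
  assumes A: "A \<in> rational_maps" "F \<in> A" and F: "fibred F"
    and ab: "cpoly a" "cpoly b" "a s \<noteq> 0 \<or> b s \<noteq> 0"
    and P: "nonzero_on_sph P"
    and eq: "\<And>v. v \<in> sph \<Longrightarrow> P v \<noteq> 0 \<Longrightarrow> uc (F v) * mob_den a b v = of_real (F v $ 1) * mob_num a b v"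
  shows "moebius A a b"
proof -
  have "uc (G v) * mob_den a b v = of_real (G v $ 1) * mob_num a b v" if G: "G \<in> A" and v: "v \<in> sph" for G v
  proof -
    have r: "F \<in> self_reps" "G \<in> self_reps" using A G rational_maps_rep(1) by auto
    have "uc (G v) * mob_den a b v - of_real (G v $ 1) * mob_num a b v = 0"
    proof (rule cpf_cancel[OF nonzero_on_sph_mult[OF P self_reps_nonzero[OF r(1)]] _ _ v])
      show "cpf (\<lambda>v. uc (G v) * mob_den a b v - of_real (G v $ 1) * mob_num a b v)"
        using cpf_mob[OF ab(1,2)] r by (intro cpf_diff cpf_mult cpf_of_real cpf_uc_comp self_reps_polynomial) auto
      fix w assume w: "w \<in> sph" "P w * F w $ 1 \<noteq> 0"
      have "F w $ 1 *\<^sub>R G w = G w $ 1 *\<^sub>R F w"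
        using rational_maps_rel[OF A G] w(1) unfolding self_rel_iff by blast
      then have "uc (F w $ 1 *\<^sub>R G w) = uc (G w $ 1 *\<^sub>R F w)" by (simp only:)
      then have "of_real (F w $ 1) * uc (G w) = of_real (G w $ 1) * uc (F w)" by simp
      moreover have "uc (F w) * mob_den a b w = of_real (F w $ 1) * mob_num a b w" using eq w by simp
      moreover have "of_real (F w $ 1) * (uc (G w) * mob_den a b w - of_real (G w $ 1) * mob_num a b w)
        = mob_den a b w * (of_real (F w $ 1) * uc (G w) - of_real (G w $ 1) * uc (F w))
        + of_real (G w $ 1) * (uc (F w) * mob_den a b w - of_real (F w $ 1) * mob_num a b w)"
        by (simp add: algebra_simps)
      ultimately have "of_real (F w $ 1) * (uc (G w) * mob_den a b w - of_real (G w $ 1) * mob_num a b w) = 0"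
        by simp
      then show "uc (G w) * mob_den a b w - of_real (G w $ 1) * mob_num a b w = 0" using w(2) by simp
    qed
    then show ?thesis by simp
  qed
  then show ?thesis unfolding moebius_def using A(1) ab fibred_class[OF A F] by blast
qed

lemma moebiusD:
  assumes "moebius A a b"
  shows "A \<in> rational_maps" "cpoly a" "cpoly b" "\<exists>t. a t \<noteq> 0 \<or> b t \<noteq> 0"
    "F \<in> A \<Longrightarrow> fibred F"
    "F \<in> A \<Longrightarrow> v \<in> sph \<Longrightarrow> uc (F v) * mob_den a b v = of_real (F v $ 1) * mob_num a b v"
  using assms unfolding moebius_def by blast+

lemma finite_common_zeros:
  assumes "cpoly a" "cpoly b" "a s \<noteq> 0 \<or> b s \<noteq> 0"
  shows "finite {t. a t = 0 \<and> b t = 0}"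
proof (cases "a s = 0")
  case True
  then show ?thesis using assms cpoly_finite_zeros[of b s] by (auto intro: finite_subset[rotated])
next
  case False
  then show ?thesis using assms cpoly_finite_zeros[of a s] by (auto intro: finite_subset[rotated])
qed

section \<open>Norm and product of quaternions\<close>

definition qnorm :: "(real \<Rightarrow> complex) \<Rightarrow> (real \<Rightarrow> complex) \<Rightarrow> real \<Rightarrow> real" where
  "qnorm a b t = (cmod (a t))\<^sup>2 - (1 - t\<^sup>2) * (cmod (b t))\<^sup>2"

lemma of_real_qnorm:
  "of_real (qnorm a b t) = a t * cnj (a t) - (1 - (of_real t)\<^sup>2) * (b t * cnj (b t))"
  unfolding qnorm_def by (simp only: of_real_diff of_real_mult complex_norm_square) simp

text \<open>For t > 1 the factor 1 - t^2 is negative and the norm is a positive definite form. This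
  shows that products of non-zero quaternions are non-zero, although the norm is indefinite for -1 <
  t < 1.\<close>

lemma qnorm_pos:
  assumes "t > 1" "a t \<noteq> 0 \<or> b t \<noteq> 0"
  shows "qnorm a b t > 0"
proof -
  have "t\<^sup>2 - 1 > 0" using assms(1) by simp
  moreover have "qnorm a b t = (cmod (a t))\<^sup>2 + (t\<^sup>2 - 1) * (cmod (b t))\<^sup>2"
    unfolding qnorm_def by (simp add: algebra_simps)
  ultimately show ?thesis using assms(2)
    by (auto intro: add_pos_nonneg add_nonneg_pos)
qed

text \<open>\<open>qmult1\<close> and \<open>qmult2\<close> are the two components of (a + b j) (c +
  d j), computed with j^2 = 1 - t^2 and j c = cnj c j.\<close>

definition qmult1 :: "(real \<Rightarrow> complex) \<Rightarrow> (real \<Rightarrow> complex) \<Rightarrow> (real \<Rightarrow> complex) \<Rightarrow> (real \<Rightarrow> complex) \<Rightarrow> real \<Rightarrow> complex"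
  where "qmult1 a b c d t = a t * c t + (1 - (of_real t)\<^sup>2) * (b t * cnj (d t))"

definition qmult2 :: "(real \<Rightarrow> complex) \<Rightarrow> (real \<Rightarrow> complex) \<Rightarrow> (real \<Rightarrow> complex) \<Rightarrow> (real \<Rightarrow> complex) \<Rightarrow> real \<Rightarrow> complex"
  where "qmult2 a b c d t = a t * d t + b t * cnj (c t)"

lemma qnorm_mult: "qnorm (qmult1 a b c d) (qmult2 a b c d) t = qnorm a b t * qnorm c d t"
proof -
  have "of_real (qnorm (qmult1 a b c d) (qmult2 a b c d) t) = (of_real (qnorm a b t * qnorm c d t) :: complex)"
    unfolding of_real_mult of_real_qnorm qmult1_def qmult2_def by (simp add: algebra_simps)
  then show ?thesis unfolding of_real_eq_iff .
qed

text \<open>Composition of maps is the product of quaternions. Besides the formula this requires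
  that the product is non-zero, which is seen from its norm at some t > 1.\<close>

lemma moebius_comp:
  assumes A: "moebius A a b" "F \<in> A" and B: "moebius B c d" "G \<in> B"
    and FG: "F \<circ> G \<in> self_reps"
  shows "moebius (rat_comp A B) (qmult1 a b c d) (qmult2 a b c d)"
proof -
  note A' = moebiusD[OF A(1)] and B' = moebiusD[OF B(1)]
  have r: "F \<in> self_reps" "G \<in> self_reps"
    using rational_maps_rep(1)[OF A'(1) A(2)] rational_maps_rep(1)[OF B'(1) B(2)] by auto
  have AB: "rat_comp A B = self_rel `` {F \<circ> G}" by (rule rat_comp_eq[OF A'(1) A(2) B'(1) B(2) FG])
  obtain s s' where "a s \<noteq> 0 \<or> b s \<noteq> 0" "c s' \<noteq> 0 \<or> d s' \<noteq> 0" using A'(4) B'(4) by blast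
  then have "finite ({t. a t = 0 \<and> b t = 0} \<union> {t. c t = 0 \<and> d t = 0})"
    using finite_common_zeros A'(2,3) B'(2,3) by blast
  \<comment> \<open>Only finitely many t are common zeros of one of the pairs, so some t > 1 avoids
    them all.\<close>
  then have "\<not> {1<..} \<subseteq> {t. a t = 0 \<and> b t = 0} \<union> {t. c t = 0 \<and> d t = 0}"
    using infinite_Ioi[of "1 :: real"] finite_subset by blast
  then obtain t where t: "t > 1" "\<not> (a t = 0 \<and> b t = 0)" "\<not> (c t = 0 \<and> d t = 0)" by blast
  then have "qnorm (qmult1 a b c d) (qmult2 a b c d) t > 0"
    unfolding qnorm_mult using qnorm_pos by simp
  then have nz: "qmult1 a b c d t \<noteq> 0 \<or> qmult2 a b c d t \<noteq> 0" unfolding qnorm_def by auto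
  show ?thesis
  proof (rule moebiusI[where F = "F \<circ> G" and a = "qmult1 a b c d" and b = "qmult2 a b c d" and s = t,
          OF _ _ _ _ _ nz self_reps_nonzero[OF r(2)]])
    show "rat_comp A B \<in> rational_maps" "F \<circ> G \<in> rat_comp A B"
      unfolding AB using class_in_rational_maps rep_in_class FG by auto
    show "fibred (F \<circ> G)"
    proof (rule fibred_generic[OF FG self_reps_nonzero[OF r(2)]])
      fix v assume v: "v \<in> sph" "G v $ 1 \<noteq> 0" "(F \<circ> G) v $ 1 \<noteq> 0"
      have "F (ev G v) $ 1 \<noteq> 0" using comp_nth_1_iff[of F G v, OF r(1) v(2)] v(3) by simp
      then show "ev (F \<circ> G) v $ 4 = v $ 4"
        using fibred_ev[OF A'(5)[OF A(2)] ev_in_sph[OF r(2) v(1,2)]]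
          fibred_ev[OF B'(5)[OF B(2)] v(1,2)] ev_comp[of F G v, OF r(1) v(2)] by simp
    qed
    show "cpoly (qmult1 a b c d)" "cpoly (qmult2 a b c d)"
      unfolding qmult1_def[abs_def] qmult2_def[abs_def] using A'(2,3) B'(2,3)
      by (auto intro!: cpoly_add cpoly_mult cpoly_diff cpoly_power cpoly_cnj)
    fix v assume v: "v \<in> sph" "G v $ 1 \<noteq> 0"
    define p where "p = ev G v"
    have p: "p \<in> sph" "p $ 4 = v $ 4"
      unfolding p_def using ev_in_sph[OF r(2) v] fibred_ev[OF B'(5)[OF B(2)] v] by auto
    obtain k where k: "k \<noteq> 0" "F (G v) = k *\<^sub>R F p" unfolding p_def using comp_ev[of F G v, OF r(1) v(2)] by blast
    have G: "uc (G v) = of_real (G v $ 1) * uc p" unfolding p_def using ev_eq[of G v, OF v(2)] by (metis uc_scaleR)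
    define t where "t = v $ 4"
    define f :: complex where "f = 1 - (of_real t)\<^sup>2"
    have 1: "uc (F p) * (cnj (b t) * uc p + cnj (a t)) = of_real (F p $ 1) * (a t * uc p + b t * f)"
      using A'(6)[OF A(2) p(1)] unfolding mob_num_def mob_den_def p(2) t_def f_def .
    have 2: "of_real (G v $ 1) * uc p * (cnj (d t) * uc v + cnj (c t)) = of_real (G v $ 1) * (c t * uc v + d t * f)"
      using B'(6)[OF B(2) v(1)] unfolding mob_num_def mob_den_def G t_def f_def .
    then have 2: "uc p * (cnj (d t) * uc v + cnj (c t)) = c t * uc v + d t * f" using v(2) by simp
    have f: "cnj f = f" unfolding f_def by simp
    have "uc (F p) * (cnj (qmult2 a b c d t) * uc v + cnj (qmult1 a b c d t))
      = of_real (F p $ 1) * (qmult1 a b c d t * uc v + qmult2 a b c d t * f)"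
    proof -
      \<comment> \<open>\<open>X\<close> and \<open>E\<close> are numerator and denominator of the
        inner map, so \<open>uc p * E = X\<close>. The difference of the two sides is a combination
        of this relation and of the relation for the outer map.\<close>
      define E X where "E = cnj (d t) * uc v + cnj (c t)" and "X = c t * uc v + d t * f"
      have "uc (F p) * (cnj (qmult2 a b c d t) * uc v + cnj (qmult1 a b c d t))
          - of_real (F p $ 1) * (qmult1 a b c d t * uc v + qmult2 a b c d t * f)
        = uc (F p) * (cnj (b t) * X + cnj (a t) * E) - of_real (F p $ 1) * (a t * X + b t * f * E)"
        unfolding qmult1_def qmult2_def f_def[symmetric] complex_cnj_add complex_cnj_mult complex_cnj_cnj f
          E_def X_def by (simp add: algebra_simps)
      also have "\<dots> = E * (uc (F p) * (cnj (b t) * uc p + cnj (a t)) - of_real (F p $ 1) * (a t * uc p + b t * f))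
        + (of_real (F p $ 1) * a t - uc (F p) * cnj (b t)) * (uc p * E - X)"
        by (simp add: algebra_simps)
      also have "\<dots> = 0" using 1 2 unfolding E_def X_def by simp
      finally show ?thesis by simp
    qed
    then show "uc ((F \<circ> G) v) * mob_den (qmult1 a b c d) (qmult2 a b c d) v
      = of_real ((F \<circ> G) v $ 1) * mob_num (qmult1 a b c d) (qmult2 a b c d) v"
      unfolding mob_num_def mob_den_def t_def[symmetric] f_def[symmetric] using k(2) by simp
  qed
qed

lemma moebius_comp_Bir:
  assumes "moebius A a b" "moebius B c d" "B \<in> carrier Bir_S"
  shows "moebius (rat_comp A B) (qmult1 a b c d) (qmult2 a b c d)"
  using moebius_comp[OF assms(1) _ assms(2) _ comp_Bir_in_self_reps] moebiusD(1)[OF assms(1)] assms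
    rational_maps_ex Bir_ex by metis

text \<open>On a fibre, being the identity means that the quadratic polynomial cnj b u^2 + (cnj a -
  a) u - b f vanishes on a whole circle. The three points r, -r and r times the imaginary unit
  already force its coefficients to vanish.\<close>

lemma moebius_id:
  assumes "moebius rat_id a b"
  shows "b t = 0" "cnj (a t) = a t"
proof -
  note ab = moebiusD[OF assms]
  have "b t = 0 \<and> cnj (a t) - a t = 0" if t: "-1 < t" "t < 1" for t
  proof -
    obtain r :: real where r: "r > 0" "\<And>s. s * cnj s = 1 \<Longrightarrow> \<exists>v\<in>sph. v $ 4 = t \<and> uc v = of_real r * s"
      using sph_circle[OF t] by blast
    define x where "x = (of_real r :: complex)"
    define f :: complex where "f = 1 - (of_real t)\<^sup>2"
    have *: "x * s * (cnj (b t) * (x * s) + cnj (a t)) = a t * (x * s) + b t * f" if s: "s * cnj s = 1" for s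
    proof -
      obtain v where v: "v \<in> sph" "v $ 4 = t" "uc v = x * s" using r(2)[OF s] unfolding x_def by blast
      have "v $ 1 = 1" using v(1) unfolding sph_def by simp
      then show ?thesis using ab(6)[OF id_in_rat_id v(1)] unfolding mob_num_def mob_den_def f_def v(2,3) by (simp add: v(3))
    qed
    have "x * (cnj (b t) * x + cnj (a t)) = a t * x + b t * f"
      "- x * (cnj (b t) * (- x) + cnj (a t)) = a t * (- x) + b t * f"
      "x * \<i> * (cnj (b t) * (x * \<i>) + cnj (a t)) = a t * (x * \<i>) + b t * f"
      using *[of 1] *[of "-1"] *[of \<i>] by simp_all
    then have 1: "x * (cnj (b t) * x + cnj (a t)) - (a t * x + b t * f) = 0" (is "?e1 = 0")
      and 2: "- x * (cnj (b t) * (- x) + cnj (a t)) - (a t * (- x) + b t * f) = 0" (is "?e2 = 0")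
      and 3: "x * \<i> * (cnj (b t) * (x * \<i>) + cnj (a t)) - (a t * (x * \<i>) + b t * f) = 0" (is "?e3 = 0")
      by simp_all
    have "2 * (x * (cnj (a t) - a t)) = ?e1 - ?e2" by (simp add: algebra_simps)
    moreover have "4 * (x * x * cnj (b t)) = ?e1 + ?e2 - 2 * ?e3 + \<i> * (?e1 - ?e2)" by (simp add: algebra_simps)
    ultimately have "2 * (x * (cnj (a t) - a t)) = 0" "4 * (x * x * cnj (b t)) = 0" unfolding 1 2 3 by simp_all
    then show ?thesis using r(1) unfolding x_def by simp
  qed
  moreover have "cpoly (\<lambda>t. cnj (a t) - a t)" using ab(2) by (intro cpoly_diff cpoly_cnj)
  ultimately show "b t = 0" "cnj (a t) = a t"
    using cpoly_eq_0[OF ab(3)] cpoly_eq_0[of "\<lambda>t. cnj (a t) - a t" t] by auto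
qed

text \<open>Where the denominator is non-zero, the pair prescribes the coordinate u of the image,
  and z is preserved anyway.\<close>

lemma moebius_unique:
  assumes A: "moebius A a b" and B: "moebius B a b"
  shows "A = B"
proof -
  note A' = moebiusD[OF A] and B' = moebiusD[OF B]
  obtain F G where F: "F \<in> A" and G: "G \<in> B" using rational_maps_ex A'(1) B'(1) by metis
  note FA = rational_maps_rep[OF A'(1) F] and GB = rational_maps_rep[OF B'(1) G]
  obtain s where s: "a s \<noteq> 0 \<or> b s \<noteq> 0" using A'(4) by blast
  have "of_real (F v $ 1) * uc (G v) - of_real (G v $ 1) * uc (F v) = 0" if v: "v \<in> sph" for v
  proof (rule cpf_cancel[OF mob_den_nonzero[OF A'(2,3) s] _ _ v])
    show "cpf (\<lambda>v. of_real (F v $ 1) * uc (G v) - of_real (G v $ 1) * uc (F v))"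
      using FA(1) GB(1) by (intro cpf_diff cpf_mult cpf_of_real cpf_uc_comp self_reps_polynomial)
    fix w assume w: "w \<in> sph" "(cmod (mob_den a b w))\<^sup>2 \<noteq> 0"
    have "(of_real (F w $ 1) * uc (G w) - of_real (G w $ 1) * uc (F w)) * mob_den a b w
      = of_real (F w $ 1) * (uc (G w) * mob_den a b w) - of_real (G w $ 1) * (uc (F w) * mob_den a b w)"
      by (simp add: algebra_simps)
    also have "\<dots> = 0" unfolding A'(6)[OF F w(1)] B'(6)[OF G w(1)] by simp
    finally have "(of_real (F w $ 1) * uc (G w) - of_real (G w $ 1) * uc (F w)) * mob_den a b w = 0" .
    then show "of_real (F w $ 1) * uc (G w) - of_real (G w $ 1) * uc (F w) = 0" using w(2) by simp
  qed
  then have u: "uc (F v $ 1 *\<^sub>R G v) = uc (G v $ 1 *\<^sub>R F v)" if "v \<in> sph" for v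
    using that by simp
  have "F v $ 1 *\<^sub>R G v = G v $ 1 *\<^sub>R F v" if v: "v \<in> sph" for v
    using u[OF v] A'(5)[OF F] B'(5)[OF G] v unfolding uc_def fibred_def
    by (simp add: vec_eq_iff forall_4)
  then have "(F, G) \<in> self_rel" unfolding self_rel_iff using FA(1) GB(1) by blast
  then show ?thesis using FA(2) GB(2) equiv_class_eq[OF equiv_self_rel] by metis
qed

text \<open>The factor has to be real because the denominator contains the conjugates of
  \<open>a\<close> and \<open>b\<close>.\<close>

lemma moebius_scale:
  assumes A: "moebius A a b" and c: "cpoly c" "\<And>t. cnj (c t) = c t" "c s \<noteq> 0"
  shows "moebius A (\<lambda>t. c t * a t) (\<lambda>t. c t * b t)"
proof -
  note A' = moebiusD[OF A]
  obtain s' where "a s' \<noteq> 0 \<or> b s' \<noteq> 0" using A'(4) by blast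
  then have "finite ({t. a t = 0 \<and> b t = 0} \<union> {t. c t = 0})"
    using finite_common_zeros A'(2,3) cpoly_finite_zeros[OF c(1,3)] by blast
  then have "{t. a t = 0 \<and> b t = 0} \<union> {t. c t = 0} \<noteq> UNIV"
    using infinite_UNIV_char_0[where 'a = real] by metis
  then obtain t where "\<not> (a t = 0 \<and> b t = 0)" "c t \<noteq> 0" by blast
  then have nz: "c t * a t \<noteq> 0 \<or> c t * b t \<noteq> 0" by auto
  obtain F where F: "F \<in> A" using rational_maps_ex A'(1) by metis
  show ?thesis
  proof (rule moebiusI[where a = "\<lambda>t. c t * a t" and b = "\<lambda>t. c t * b t" and s = t,
          OF A'(1) F A'(5)[OF F] _ _ nz nonzero_on_sph_1])
    show "cpoly (\<lambda>t. c t * a t)" "cpoly (\<lambda>t. c t * b t)" using A'(2,3) c(1) by auto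
    fix v assume v: "v \<in> sph"
    have "mob_den (\<lambda>t. c t * a t) (\<lambda>t. c t * b t) v = c (v $ 4) * mob_den a b v"
      "mob_num (\<lambda>t. c t * a t) (\<lambda>t. c t * b t) v = c (v $ 4) * mob_num a b v"
      unfolding mob_den_def mob_num_def by (simp_all add: c(2) algebra_simps)
    then show "uc (F v) * mob_den (\<lambda>t. c t * a t) (\<lambda>t. c t * b t) v
        = of_real (F v $ 1) * mob_num (\<lambda>t. c t * a t) (\<lambda>t. c t * b t) v"
      using A'(6)[OF F v] by (simp add: mult.left_commute)
  qed
qed

section \<open>From quaternions to maps regular on the sphere\<close>

lemma self_reps_from_polynomials:
  assumes "\<And>i. real_polynomial_function (\<lambda>v. P v $ i)" "\<And>v. v \<in> sph \<Longrightarrow> quadric (P v) = 0"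
    and "v \<in> sph" "P v $ 1 \<noteq> 0"
  obtains F where "F \<in> self_reps" "\<And>v. v \<in> sph \<Longrightarrow> F v = P v"
proof -
  have "\<forall>i. \<exists>N. \<forall>d\<ge>N. \<exists>h. form d h \<and> (\<forall>v :: real ^ 4. v $ 1 = 1 \<longrightarrow> h v = P v $ i)"
    using real_polynomial_function_homogenize[OF assms(1)] by blast
  then obtain N where N: "\<And>i d. d \<ge> N i \<Longrightarrow> \<exists>h. form d h \<and> (\<forall>v :: real ^ 4. v $ 1 = 1 \<longrightarrow> h v = P v $ i)"
    by metis
  \<comment> \<open>Any common bound of the four degrees would do; the sum is one.\<close>
  define d where "d = (\<Sum>i\<in>UNIV. N i)"
  have "d \<ge> N i" for i unfolding d_def by (rule member_le_sum) auto
  then have "\<forall>i. \<exists>h. form d h \<and> (\<forall>v :: real ^ 4. v $ 1 = 1 \<longrightarrow> h v = P v $ i)" using N by blast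
  then obtain h where h: "\<And>i. form d (h i)" "\<And>i v. v $ 1 = 1 \<Longrightarrow> h i v = P v $ i" by metis
  define F where "F = (\<lambda>v. \<chi> i. h i v)"
  have F: "F v = P v" if "v \<in> sph" for v
    using that h(2)[of v] unfolding F_def sph_def by (simp add: vec_eq_iff)
  have fF: "form d (\<lambda>v. F v $ i)" for i using h(1)[of i] unfolding F_def by simp
  have "form (2 * d) (quadric \<circ> F)"
    unfolding quadric_def[abs_def] comp_def by (intro form_diff form_add form_power fF)
  then have "zero_on_S (quadric \<circ> F)" using zero_on_S_iff assms(2) F by (metis comp_apply)
  then have "\<forall>v. quadric v = 0 \<longrightarrow> quadric (F v) = 0" unfolding zero_on_S_def by auto
  then have "F \<in> self_reps" unfolding self_reps_iff using fF F assms(3,4) by metis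
  then show ?thesis using that F by blast
qed

text \<open>The difference of the two sides is the norm of a + b j times u cnj u - f, and the second
  factor vanishes on the sphere. So the fibre circle is mapped to itself.\<close>

lemma mob_num_den:
  assumes "v \<in> sph"
  shows "(cmod (mob_num a b v))\<^sup>2 = (1 - (v $ 4)\<^sup>2) * (cmod (mob_den a b v))\<^sup>2"
proof -
  define t where "t = v $ 4"
  define f :: complex where "f = 1 - (of_real t)\<^sup>2"
  have u: "uc v * cnj (uc v) = f" using uc_norm[OF assms] unfolding f_def t_def .
  have f: "cnj f = f" unfolding f_def by simp
  have "mob_num a b v * cnj (mob_num a b v) - f * (mob_den a b v * cnj (mob_den a b v))
    = (a t * cnj (a t) - f * (b t * cnj (b t))) * (uc v * cnj (uc v) - f)"
    unfolding mob_num_def mob_den_def t_def[symmetric] f_def[symmetric] complex_cnj_add complex_cnj_mult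
      complex_cnj_cnj f by (simp add: algebra_simps)
  then have "mob_num a b v * cnj (mob_num a b v) = f * (mob_den a b v * cnj (mob_den a b v))"
    using u by simp
  then have "of_real ((cmod (mob_num a b v))\<^sup>2) = (of_real ((1 - t\<^sup>2) * (cmod (mob_den a b v))\<^sup>2) :: complex)"
    unfolding f_def by (simp only: of_real_mult complex_norm_square) simp
  then show ?thesis unfolding of_real_eq_iff t_def .
qed

text \<open>Extending num / den by cnj den gives the polynomial vector with w = |den|^2, x + i y =
  num cnj den and z = t |den|^2. If den vanished, then |a|^2 = f |b|^2 would hold and the norm would
  be zero. The poles belong to the sphere, hence the closed interval in the hypothesis.\<close>

lemma moebius_construct_rep:
  assumes ab: "cpoly a" "cpoly b" and pos: "\<And>t. t \<in> {-1..1} \<Longrightarrow> qnorm a b t > 0"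
  obtains F where "F \<in> self_reps" "\<And>v. v \<in> sph \<Longrightarrow> F v $ 1 \<noteq> 0" "moebius (self_rel `` {F}) a b"
proof -
  define D where "D = (\<lambda>v. (cmod (mob_den a b v))\<^sup>2)"
  define U where "U = (\<lambda>v. mob_num a b v * cnj (mob_den a b v))"
  define P :: "real ^ 4 \<Rightarrow> real ^ 4" where "P = (\<lambda>v. vector [D v, Re (U v), Im (U v), v $ 4 * D v])"
  have cpf: "cpf U" unfolding U_def using cpf_mob[OF ab] by (intro cpf_mult cpf_cnj)
  have D: "real_polynomial_function D" unfolding D_def cmod_power2
    using cpf_mob(2)[OF ab] unfolding cpf_def
    by (intro real_polynomial_function.intros(3) real_polynomial_function_power) auto
  have P1: "real_polynomial_function (\<lambda>v. P v $ i)" for i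
    using exhaust_4[of i] cpf D unfolding P_def cpf_def
    by (auto intro!: real_polynomial_function.intros(4) real_polynomial_function_nth)
  have D0: "D v \<noteq> 0" if v: "v \<in> sph" for v
  proof
    assume "D v = 0"
    then have z: "mob_den a b v = 0" unfolding D_def by simp
    define t where "t = v $ 4"
    have u: "uc v * cnj (uc v) = 1 - (of_real t)\<^sup>2" using uc_norm[OF v] unfolding t_def .
    have e: "cnj (b t) * uc v = - cnj (a t)" using z unfolding mob_den_def t_def by (simp add: add_eq_0_iff2)
    then have "cnj (cnj (b t) * uc v) = cnj (- cnj (a t))" by simp
    then have "b t * cnj (uc v) = - a t" by simp
    then have "a t * cnj (a t) = (b t * cnj (uc v)) * (cnj (b t) * uc v)" using e by simp
    then have "a t * cnj (a t) = (uc v * cnj (uc v)) * (b t * cnj (b t))" by (simp add: algebra_simps)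
    then have "of_real (qnorm a b t) = (0 :: complex)" unfolding of_real_qnorm u by simp
    then show False using pos[of t] sph_nth_4_bounds[OF v] unfolding t_def by simp
  qed
  have P2: "quadric (P v) = 0" if v: "v \<in> sph" for v
  proof -
    have "(Re (U v))\<^sup>2 + (Im (U v))\<^sup>2 = (cmod (U v))\<^sup>2" by (simp add: cmod_power2)
    also have "\<dots> = (1 - (v $ 4)\<^sup>2) * (D v)\<^sup>2"
      using mob_num_den[OF v, of a b] unfolding U_def D_def
      by (simp add: norm_mult power_mult_distrib power2_eq_square)
    finally have "(Im (U v))\<^sup>2 = (1 - (v $ 4)\<^sup>2) * (D v)\<^sup>2 - (Re (U v))\<^sup>2" by simp
    then show ?thesis unfolding quadric_def P_def by (simp add: algebra_simps power_mult_distrib)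
  qed
  obtain v0 where v0: "v0 \<in> sph" using nonzero_on_sph_1 by (rule nonzero_on_sphE)
  have "P v0 $ 1 \<noteq> 0" using D0[OF v0] unfolding P_def by simp
  then obtain F where F: "F \<in> self_reps" "\<And>v. v \<in> sph \<Longrightarrow> F v = P v"
    using self_reps_from_polynomials[OF P1 P2 v0] by blast
  have "qnorm a b 0 > 0" using pos by simp
  then have nz: "a 0 \<noteq> 0 \<or> b 0 \<noteq> 0" unfolding qnorm_def by auto
  have "moebius (self_rel `` {F}) a b"
  proof (rule moebiusI[OF class_in_rational_maps[OF F(1)] rep_in_class[OF F(1)] _ ab nz nonzero_on_sph_1])
    show "fibred F" unfolding fibred_def using F(2) by (simp add: P_def)
    fix v assume v: "v \<in> sph"
    have "uc (F v) = U v" "F v $ 1 = D v" unfolding F(2)[OF v] P_def uc_def by simp_all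
    then show "uc (F v) * mob_den a b v = of_real (F v $ 1) * mob_num a b v"
      unfolding U_def D_def by (simp only: complex_norm_square) (simp add: algebra_simps)
  qed
  moreover have "F v $ 1 \<noteq> 0" if "v \<in> sph" for v using D0[OF that] F(2)[OF that] unfolding P_def by simp
  ultimately show ?thesis using that F(1) by blast
qed

lemma moebius_rat_id:
  assumes "cpoly c" "\<And>t. cnj (c t) = c t" "c s \<noteq> 0"
  shows "moebius rat_id c (\<lambda>t. 0)"
proof (rule moebiusI[OF rat_id_in_rational_maps id_in_rat_id _ assms(1) _ _ nonzero_on_sph_1])
  show "c s \<noteq> 0 \<or> (0 :: complex) \<noteq> 0" using assms by simp
  show "uc (id v) * mob_den c (\<lambda>t. 0) v = of_real (id v $ 1) * mob_num c (\<lambda>t. 0) v" if "v \<in> sph" for v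
    using that assms(2) unfolding mob_den_def mob_num_def sph_def by simp
qed (auto simp: fibred_def sph_def)

lemma Aut_of_inverse_reps:
  assumes F: "F \<in> self_reps" "\<And>v. v \<in> sph \<Longrightarrow> F v $ 1 \<noteq> 0" "fibred F"
    and G: "G \<in> self_reps" "\<And>v. v \<in> sph \<Longrightarrow> G v $ 1 \<noteq> 0" "fibred G"
    and FG: "rat_comp (self_rel `` {F}) (self_rel `` {G}) = rat_id"
    and GF: "rat_comp (self_rel `` {G}) (self_rel `` {F}) = rat_id"
  shows "self_rel `` {F} \<in> carrier Aut_SR"
proof -
  have r: "self_rel `` {F} \<in> rational_maps" "self_rel `` {G} \<in> rational_maps"
    using F G class_in_rational_maps by auto
  have m: "F \<in> self_rel `` {F}" "G \<in> self_rel `` {G}" using F G rep_in_class by auto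
  have c: "self_rel `` {F} \<in> carrier Bir_S" "self_rel `` {G} \<in> carrier Bir_S"
    unfolding Bir_carrier_iff using r FG GF fibred_class[OF r(1) m(1) F(3)] fibred_class[OF r(2) m(2) G(3)]
    by blast+
  have "inv\<^bsub>Bir_S\<^esub> (self_rel `` {F}) = self_rel `` {G}"
    using Bir.inv_equality[OF _ c] GF by simp
  then show ?thesis unfolding Aut_carrier_iff using c r regular_iff m F(2) G(2) by metis
qed

lemma moebius_construct:
  assumes ab: "cpoly a" "cpoly b" and pos: "\<And>t. t \<in> {-1..1} \<Longrightarrow> qnorm a b t > 0"
  obtains A where "A \<in> carrier Aut_SR" "moebius A a b"
proof -
  \<comment> \<open>The conjugate quaternion. Its product with a + b j, in either order, is the
    norm, a real scalar that acts as the identity.\<close>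
  define a' b' where "a' = (\<lambda>t. cnj (a t))" and "b' = (\<lambda>t. - b t)"
  have ab': "cpoly a'" "cpoly b'" unfolding a'_def b'_def using ab by auto
  have "qnorm a' b' t = qnorm a b t" for t unfolding qnorm_def a'_def b'_def by simp
  then have pos': "\<And>t. t \<in> {-1..1} \<Longrightarrow> qnorm a' b' t > 0" using pos by simp
  obtain F where F: "F \<in> self_reps" "\<And>v. v \<in> sph \<Longrightarrow> F v $ 1 \<noteq> 0" "moebius (self_rel `` {F}) a b"
    using moebius_construct_rep[OF ab pos] by blast
  obtain G where G: "G \<in> self_reps" "\<And>v. v \<in> sph \<Longrightarrow> G v $ 1 \<noteq> 0" "moebius (self_rel `` {G}) a' b'"
    using moebius_construct_rep[OF ab' pos'] by blast
  have comp: "F' \<circ> G' \<in> self_reps" if "F' \<in> self_reps" "\<And>v. v \<in> sph \<Longrightarrow> F' v $ 1 \<noteq> 0"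
    "G' \<in> self_reps" "\<And>v. v \<in> sph \<Longrightarrow> G' v $ 1 \<noteq> 0" for F' G' :: "real ^ 4 \<Rightarrow> real ^ 4"
  proof -
    obtain v where v: "v \<in> sph" using nonzero_on_sph_1 by (rule nonzero_on_sphE)
    then have "ev G' v \<in> sph" using ev_in_sph that by blast
    then show ?thesis using comp_nth_1_iff[of F' G' v, OF that(1) that(4)[OF v]] that(2)
        comp_in_self_reps[OF that(1,3) v] by simp
  qed
  define n where "n = (\<lambda>t. of_real (qnorm a b t) :: complex)"
  have n: "cpoly n" "\<And>t. cnj (n t) = n t" "n 0 \<noteq> 0"
  proof -
    show "cpoly n" unfolding n_def of_real_qnorm using ab
      by (intro cpoly_diff cpoly_mult cpoly_power cpoly_cnj cpoly_const cpoly_of_real)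
    show "n 0 \<noteq> 0" unfolding n_def using pos[of 0] by simp
  qed (simp add: n_def)
  have id: "moebius rat_id n (\<lambda>t. 0)" by (rule moebius_rat_id[OF n])
  have m: "F \<in> self_rel `` {F}" "G \<in> self_rel `` {G}" using F G rep_in_class by auto
  have q: "qmult1 a b a' b' = n" "qmult2 a b a' b' = (\<lambda>t. 0)" "qmult1 a' b' a b = n" "qmult2 a' b' a b = (\<lambda>t. 0)"
    unfolding n_def a'_def b'_def qmult1_def qmult2_def of_real_qnorm by (auto simp: fun_eq_iff algebra_simps)
  have FG: "rat_comp (self_rel `` {F}) (self_rel `` {G}) = rat_id"
    using moebius_unique[OF moebius_comp[OF F(3) m(1) G(3) m(2) comp[OF F(1,2) G(1,2)], unfolded q] id] .
  have GF: "rat_comp (self_rel `` {G}) (self_rel `` {F}) = rat_id"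
    using moebius_unique[OF moebius_comp[OF G(3) m(2) F(3) m(1) comp[OF G(1,2) F(1,2)], unfolded q] id] .
  have "self_rel `` {F} \<in> carrier Aut_SR"
    by (rule Aut_of_inverse_reps[OF F(1,2) moebiusD(5)[OF F(3) m(1)] G(1,2) moebiusD(5)[OF G(3) m(2)] FG GF])
  then show ?thesis using that F(3) by blast
qed

text \<open>The reflection u -> cnj u, which on the circle u cnj u = f is u -> f / u. Its norm -(1 -
  t^2) is not positive on [-1, 1], so the general construction does not produce it.\<close>

lemma moebius_j:
  obtains J where "J \<in> carrier Aut_SR" "moebius J (\<lambda>t. 0) (\<lambda>t. 1)"
proof -
  define F :: "real ^ 4 \<Rightarrow> real ^ 4" where "F = (\<lambda>v. vector [v $ 1, v $ 2, - 1 * v $ 3, v $ 4])"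
  have "form 1 (\<lambda>v. F v $ i)" for i
    using exhaust_4[of i] form_nth form_cmult[OF form_nth, of "-1" 3] unfolding F_def by auto
  moreover have "quadric (F v) = quadric v" for v unfolding F_def quadric_def by simp
  moreover have F1: "F v $ 1 = v $ 1" for v unfolding F_def by simp
  moreover obtain v where "v \<in> sph" using nonzero_on_sph_1 by (rule nonzero_on_sphE)
  ultimately have F: "F \<in> self_reps" unfolding self_reps_iff by (auto simp: sph_def)
  have F0: "F v $ 1 \<noteq> 0" if "v \<in> sph" for v using that F1 unfolding sph_def by simp
  have fib: "fibred F" unfolding fibred_def F_def sph_def by simp
  have "F \<circ> F = id" unfolding F_def by (auto simp: fun_eq_iff vec_eq_iff forall_4)
  then have "rat_comp (self_rel `` {F}) (self_rel `` {F}) = rat_id"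
    using rat_comp_eq[OF class_in_rational_maps rep_in_class class_in_rational_maps rep_in_class, OF F F F F]
      id_in_self_reps unfolding rat_id_def by simp
  then have "self_rel `` {F} \<in> carrier Aut_SR" using Aut_of_inverse_reps[OF F F0 fib F F0 fib] by blast
  moreover have "moebius (self_rel `` {F}) (\<lambda>t. 0) (\<lambda>t. 1)"
  proof (rule moebiusI[OF class_in_rational_maps[OF F] rep_in_class[OF F] fib _ _ _ nonzero_on_sph_1])
    fix v assume v: "v \<in> sph"
    have "uc (F v) = cnj (uc v)" unfolding F_def uc_def by (simp add: complex_eq_iff)
    then show "uc (F v) * mob_den (\<lambda>t. 0) (\<lambda>t. 1) v = of_real (F v $ 1) * mob_num (\<lambda>t. 0) (\<lambda>t. 1) v"
      using uc_norm[OF v] v unfolding mob_den_def mob_num_def F1 sph_def by (simp add: mult.commute)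
  qed auto
  ultimately show ?thesis using that by blast
qed

section \<open>Every fibred birational map is a Moebius transformation\<close>

text \<open>Elements of \<open>\<complex>[t][u]\<close> are values of type \<open>complex poly poly\<close>, the outer variable being \<open>u\<close>.\<close>

definition ev2 :: "complex poly poly \<Rightarrow> real \<Rightarrow> complex \<Rightarrow> complex" where
  "ev2 P t u = poly (poly P [:u:]) (of_real t)"

lemma ev2_simps [simp]:
  "ev2 (P + Q) t u = ev2 P t u + ev2 Q t u" "ev2 (P - Q) t u = ev2 P t u - ev2 Q t u"
  "ev2 (P * Q) t u = ev2 P t u * ev2 Q t u"
  "ev2 (P ^ n) t u = ev2 P t u ^ n" "ev2 0 t u = 0" "ev2 1 t u = 1"
  "ev2 (pCons c P) t u = poly c (of_real t) + u * ev2 P t u"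
  "ev2 (Polynomial.smult c P) t u = poly c (of_real t) * ev2 P t u"
  unfolding ev2_def by simp_all

lemma ev2_sum: "ev2 (sum f I) t u = (\<Sum>i\<in>I. ev2 (f i) t u)"
  by (induction I rule: infinite_finite_induct) auto

lemma ev2_eq_poly: "ev2 P t u = poly (map_poly (\<lambda>c. poly c (of_real t)) P) u"
  by (induction P) (auto simp: map_poly_pCons)

lemma infinite_unit_circle: "infinite {s :: complex. s * cnj s = 1}"
proof
  assume "finite {s :: complex. s * cnj s = 1}"
  moreover have "cis ` {0..1} \<subseteq> {s. s * cnj s = 1}"
    by (auto simp: complex_norm_square[symmetric])
  moreover have "inj_on cis {0..1}"
  proof (rule inj_onI)
    fix x y :: real assume "x \<in> {0..1}" "y \<in> {0..1}" "cis x = cis y"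
    then show "x = y" using cos_inj_pi[of x y] pi_gt3 by (auto simp: complex_eq_iff)
  qed
  ultimately have "finite {0..1 :: real}" using finite_imageD finite_subset by blast
  then show False using infinite_Icc[of 0 "1 :: real"] by simp
qed

text \<open>Choose t with -1 < t < 1 at which the leading coefficient in u does not vanish. The
  specialised polynomial is then non-zero but has the infinitely many points of a circle as
  roots.\<close>

lemma ev2_eq_0:
  assumes z: "\<And>v. v \<in> sph \<Longrightarrow> uc v \<noteq> 0 \<Longrightarrow> ev2 P (v $ 4) (uc v) = 0"
  shows "P = 0"
proof (rule ccontr)
  assume "P \<noteq> 0"
  then have "lead_coeff P \<noteq> 0" by simp
  then have "\<exists>t. -1 < t \<and> t < 1 \<and> poly (lead_coeff P) (of_real t :: complex) \<noteq> 0"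
  proof (rule contrapos_np)
    assume "\<not> ?thesis"
    then have "poly (lead_coeff P) (of_real t :: complex) = 0" for t :: real
      using cpoly_eq_0[OF cpoly_poly[of "lead_coeff P"]] by blast
    then have "range (of_real :: real \<Rightarrow> complex) \<subseteq> {z. poly (lead_coeff P) z = 0}" by auto
    then have "infinite {z. poly (lead_coeff P) z = 0}"
      using infinite_UNIV_char_0[where 'a = real] finite_imageD[OF _ inj_of_real] finite_subset by blast
    then show "lead_coeff P = 0" using poly_roots_finite by blast
  qed
  then obtain t :: real where t: "-1 < t" "t < 1" "poly (lead_coeff P) (of_real t :: complex) \<noteq> 0" by blast
  obtain r :: real where r: "r > 0" "\<And>s. s * cnj s = 1 \<Longrightarrow> \<exists>v\<in>sph. v $ 4 = t \<and> uc v = of_real r * s"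
    using sph_circle[OF t(1,2)] by blast
  define p where "p = map_poly (\<lambda>c. poly c (of_real t)) P"
  have "poly.coeff p (degree P) \<noteq> 0" unfolding p_def using t(3) by (simp add: coeff_map_poly)
  then have "p \<noteq> 0" by auto
  then have "finite {u. poly p u = 0}" by (rule poly_roots_finite)
  moreover have "(\<lambda>s. of_real r * s) ` {s. s * cnj s = 1} \<subseteq> {u. poly p u = 0}"
  proof clarify
    fix s :: complex assume s: "s * cnj s = 1"
    then have "of_real r * s \<noteq> 0" using r(1) by auto
    moreover obtain v where "v \<in> sph" "v $ 4 = t" "uc v = of_real r * s" using r(2)[OF s] by blast
    ultimately show "poly p (of_real r * s) = 0" using z[of v] unfolding p_def ev2_eq_poly by simp
  qed
  moreover have "inj_on (\<lambda>s. of_real r * s) {s :: complex. s * cnj s = 1}"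
    using r(1) by (auto intro!: inj_onI)
  ultimately show False using infinite_unit_circle finite_imageD finite_subset by blast
qed

text \<open>On the sphere \<open>cnj u = (1 - t\<^sup>2) / u\<close>, so polynomial functions become Laurent polynomials in \<open>u\<close>.\<close>

lemma real_polynomial_function_laurent:
  assumes "real_polynomial_function f"
  shows "\<exists>P N. \<forall>v\<in>sph. uc v ^ N * of_real (f v) = ev2 P (v $ 4) (uc v)"
  using assms
proof (induction rule: real_polynomial_function.induct)
  case (linear f)
  define c where "c = (\<lambda>i. complex_of_real (f (axis i 1)))"
  \<comment> \<open>The coefficients of u f after substituting x = (u + cnj u) / 2, y = -i (u - cnj
    u) / 2 and u cnj u = 1 - t^2.\<close>
  define P where "P = [: Polynomial.smult ((c 2 + \<i> * c 3) / 2) [:1, 0, -1:], [:c 1, c 4:], [:(c 2 - \<i> * c 3) / 2:] :]"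
  have "uc v ^ 1 * of_real (f v) = ev2 P (v $ 4) (uc v)" if v: "v \<in> sph" for v
  proof -
    define u t where "u = uc v" and "t = complex_of_real (v $ 4)"
    have n: "u * cnj u = 1 - t\<^sup>2" using uc_norm[OF v] unfolding u_def t_def .
    have x: "complex_of_real (v $ 2) = (u + cnj u) / 2" "complex_of_real (v $ 3) = - \<i> * (u - cnj u) / 2"
      unfolding u_def uc_def by (simp_all add: complex_eq_iff)
    have "v $ 1 = 1" using v unfolding sph_def by simp
    then have "of_real (f v) = c 1 + c 2 * ((u + cnj u) / 2) + c 3 * (- \<i> * (u - cnj u) / 2) + c 4 * t"
      by (subst bounded_linear_axis_expansion[OF linear]) (simp add: sum_4 c_def x t_def)
    then have "u * of_real (f v) = u * (c 1 + c 2 * ((u + cnj u) / 2) + c 3 * (- \<i> * (u - cnj u) / 2) + c 4 * t)"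
      by simp
    also have "\<dots> = c 1 * u + (c 2 - \<i> * c 3) / 2 * (u * u) + (c 2 + \<i> * c 3) / 2 * (u * cnj u) + c 4 * t * u"
      by (simp add: field_simps)
    also have "\<dots> = (c 2 + \<i> * c 3) / 2 * (1 - t\<^sup>2) + u * ((c 1 + t * c 4) + u * ((c 2 - \<i> * c 3) / 2))"
      unfolding n by (simp only: algebra_simps)
    also have "\<dots> = ev2 P (v $ 4) u"
      unfolding P_def ev2_simps t_def[symmetric] by (simp add: power2_eq_square) (simp add: algebra_simps)
    finally show ?thesis unfolding u_def by simp
  qed
  then show ?case by blast
next
  case (const c)
  have "\<forall>v\<in>sph. uc v ^ 0 * of_real c = ev2 [:[:of_real c:]:] (v $ 4) (uc v)" by simp
  then show ?case by blast
next
  case (add f g)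
  then obtain P N Q M where PQ: "\<forall>v\<in>sph. uc v ^ N * of_real (f v) = ev2 P (v $ 4) (uc v)"
    "\<forall>v\<in>sph. uc v ^ M * of_real (g v) = ev2 Q (v $ 4) (uc v)" by metis
  have "\<forall>v\<in>sph. uc v ^ (N + M) * of_real (f v + g v) = ev2 (P * [:0, 1:] ^ M + Q * [:0, 1:] ^ N) (v $ 4) (uc v)"
    by (simp add: PQ[rule_format, symmetric] power_add algebra_simps)
  then show ?case by blast
next
  case (mult f g)
  then obtain P N Q M where PQ: "\<forall>v\<in>sph. uc v ^ N * of_real (f v) = ev2 P (v $ 4) (uc v)"
    "\<forall>v\<in>sph. uc v ^ M * of_real (g v) = ev2 Q (v $ 4) (uc v)" by metis
  have "\<forall>v\<in>sph. uc v ^ (N + M) * of_real (f v * g v) = ev2 (P * Q) (v $ 4) (uc v)"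
    by (simp add: PQ[rule_format, symmetric] power_add algebra_simps)
  then show ?case by blast
qed

lemma self_reps_laurent:
  assumes "F \<in> self_reps"
  shows "\<exists>P Q N. \<forall>v\<in>sph. uc v ^ N * uc (F v) = ev2 P (v $ 4) (uc v) \<and>
    uc v ^ N * of_real (F v $ 1) = ev2 Q (v $ 4) (uc v)"
proof -
  have "\<exists>P N. \<forall>v\<in>sph. uc v ^ N * of_real (F v $ i) = ev2 P (v $ 4) (uc v)" for i
    by (rule real_polynomial_function_laurent[OF self_reps_polynomial[OF assms]])
  then obtain P N where P: "\<And>i v. v \<in> sph \<Longrightarrow> uc v ^ N i * of_real (F v $ i) = ev2 (P i) (v $ 4) (uc v)"
    by metis
  let ?X = "[:0, 1:] :: complex poly poly"
  show ?thesis
  proof (intro exI ballI conjI)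
    fix v assume v: "v \<in> sph"
    have "uc (F v) = of_real (F v $ 2) + \<i> * of_real (F v $ 3)" unfolding uc_def by (simp add: complex_eq_iff)
    then show "uc v ^ (N 1 + N 2 + N 3) * uc (F v)
      = ev2 (P 2 * ?X ^ (N 1 + N 3) + [:[:\<i>:]:] * (P 3 * ?X ^ (N 1 + N 2))) (v $ 4) (uc v)"
      by (simp add: P[OF v, symmetric] power_add algebra_simps)
    show "uc v ^ (N 1 + N 2 + N 3) * of_real (F v $ 1) = ev2 (P 1 * ?X ^ (N 2 + N 3)) (v $ 4) (uc v)"
      by (simp add: P[OF v, symmetric] power_add algebra_simps)
  qed
qed

text \<open>The argument of the rational root theorem: after cancelling a power of \<open>Q\<close>,
  every term except the last non-zero one, \<open>R k * P ^ k\<close>, is a multiple of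
  \<open>Q\<close>. By coprimality \<open>Q\<close> divides \<open>R k\<close>, which has degree at
  most 1.\<close>

lemma degree_le_1_if_binary_relation:
  fixes P Q :: "complex poly poly"
  assumes cop: "coprime P Q" and "\<exists>i\<le>n. R i \<noteq> 0" and deg: "\<And>i. degree (R i) \<le> 1"
    and sum0: "(\<Sum>i\<le>n. R i * P ^ i * Q ^ (n - i)) = 0" and "Q \<noteq> 0"
  shows "degree Q \<le> 1"
proof -
  define k where "k = (GREATEST i. i \<le> n \<and> R i \<noteq> 0)"
  have k: "k \<le> n \<and> R k \<noteq> 0" unfolding k_def by (rule GreatestI_ex_nat[where b = n]) (use assms(2) in auto)
  have above: "R i = 0" if "i \<le> n" "k < i" for i
    using that Greatest_le_nat[of "\<lambda>i. i \<le> n \<and> R i \<noteq> 0" i n] unfolding k_def by force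
  have "(\<Sum>i\<le>n. R i * P ^ i * Q ^ (n - i)) = (\<Sum>i\<le>k. R i * P ^ i * Q ^ (n - i))"
    using k above by (intro sum.mono_neutral_right) auto
  also have "\<dots> = (\<Sum>i\<le>k. Q ^ (n - k) * (R i * P ^ i * Q ^ (k - i)))"
  proof (rule sum.cong)
    fix i assume "i \<in> {..k}"
    then have "n - i = (n - k) + (k - i)" using k by auto
    then show "R i * P ^ i * Q ^ (n - i) = Q ^ (n - k) * (R i * P ^ i * Q ^ (k - i))"
      by (simp add: power_add algebra_simps)
  qed simp
  finally have "Q ^ (n - k) * (\<Sum>i\<le>k. R i * P ^ i * Q ^ (k - i)) = 0"
    using sum0 by (simp add: sum_distrib_left)
  then have "(\<Sum>i\<le>k. R i * P ^ i * Q ^ (k - i)) = 0" using \<open>Q \<noteq> 0\<close> by simp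
  moreover have "{..k} = insert k {..<k}" by auto
  ultimately have "R k * P ^ k + (\<Sum>i<k. R i * P ^ i * Q ^ (k - i)) = 0" by simp
  moreover have "Q dvd (\<Sum>i<k. R i * P ^ i * Q ^ (k - i))"
  proof (rule dvd_sum)
    fix i assume "i \<in> {..<k}"
    then have "Q dvd Q ^ (k - i)" by (intro dvd_power) auto
    then show "Q dvd R i * P ^ i * Q ^ (k - i)" by (rule dvd_mult)
  qed
  moreover have "R k * P ^ k = - (\<Sum>i<k. R i * P ^ i * Q ^ (k - i))"
    using calculation(1) by (simp add: eq_neg_iff_add_eq_0)
  ultimately have "Q dvd R k * P ^ k" by simp
  moreover have "coprime Q (P ^ k)" using cop by (simp add: coprime_commute)
  ultimately have "Q dvd R k" by (simp add: coprime_dvd_mult_left_iff)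
  then show ?thesis using k deg[of k] dvd_imp_degree_le[of Q "R k"] by simp
qed

text \<open>After division by the gcd the bound applies to \<open>Q0\<close>; reading the sum
  backwards exchanges the roles and bounds \<open>P0\<close>.\<close>

lemma binary_relation_linear:
  fixes P Q :: "complex poly poly"
  assumes R: "\<exists>i\<le>n. R i \<noteq> 0" and deg: "\<And>i. degree (R i) \<le> 1"
    and sum0: "(\<Sum>i\<le>n. R i * P ^ i * Q ^ (n - i)) = 0" and PQ: "P \<noteq> 0" "Q \<noteq> 0"
  obtains D P0 Q0 where "P = D * P0" "Q = D * Q0" "degree P0 \<le> 1" "degree Q0 \<le> 1"
proof -
  have "gcd P Q \<noteq> 0" using PQ by simp
  then obtain P0 Q0 where P0: "P = P0 * gcd P Q" "Q = Q0 * gcd P Q" "coprime P0 Q0"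
    using gcd_coprime_exists by blast
  define D where "D = gcd P Q"
  have D: "P = D * P0" "Q = D * Q0" using P0 unfolding D_def by (simp_all add: mult.commute)
  then have nz: "P0 \<noteq> 0" "Q0 \<noteq> 0" "D \<noteq> 0" using PQ by auto
  have "(\<Sum>i\<le>n. R i * P ^ i * Q ^ (n - i)) = (\<Sum>i\<le>n. D ^ n * (R i * P0 ^ i * Q0 ^ (n - i)))"
  proof (rule sum.cong)
    fix i assume "i \<in> {..n}"
    then have "D ^ n = D ^ i * D ^ (n - i)" by (simp flip: power_add)
    then show "R i * P ^ i * Q ^ (n - i) = D ^ n * (R i * P0 ^ i * Q0 ^ (n - i))"
      unfolding D power_mult_distrib by (simp add: algebra_simps)
  qed simp
  then have s: "(\<Sum>i\<le>n. R i * P0 ^ i * Q0 ^ (n - i)) = 0"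
    using sum0 nz(3) by (simp flip: sum_distrib_left)
  have "(\<Sum>i\<le>n. R i * P0 ^ i * Q0 ^ (n - i)) = (\<Sum>i\<le>n. R (n - i) * P0 ^ (n - i) * Q0 ^ (n - (n - i)))"
    using sum.nat_diff_reindex[of "\<lambda>i. R i * P0 ^ i * Q0 ^ (n - i)" "Suc n"]
    by (simp add: lessThan_Suc_atMost)
  also have "\<dots> = (\<Sum>i\<le>n. R (n - i) * Q0 ^ i * P0 ^ (n - i))"
    by (intro sum.cong) (auto simp: algebra_simps)
  finally have s': "(\<Sum>i\<le>n. R (n - i) * Q0 ^ i * P0 ^ (n - i)) = 0" using s by simp
  have R': "\<exists>i\<le>n. R (n - i) \<noteq> 0" using R by (metis diff_diff_cancel diff_le_self)
  have "degree Q0 \<le> 1" by (rule degree_le_1_if_binary_relation[OF P0(3) R deg s nz(2)])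
  moreover have "degree P0 \<le> 1"
    by (rule degree_le_1_if_binary_relation[OF _ R' deg s' nz(1)]) (use P0(3) in \<open>simp add: coprime_commute\<close>)
  ultimately show ?thesis using that D by blast
qed

lemma poly_eq_sum_le:
  fixes p :: "'a :: comm_semiring_1 poly"
  assumes "degree p \<le> n"
  shows "poly p x = (\<Sum>i\<le>n. poly.coeff p i * x ^ i)"
  unfolding poly_altdef using assms
  by (intro sum.mono_neutral_left) (auto simp: coeff_eq_0)

lemma uc_nonzero: "nonzero_on_sph (\<lambda>v. (cmod (uc v ^ n))\<^sup>2)"
proof -
  have "vector [1, 1, 0, 0] \<in> sph" unfolding sph_def quadric_def by simp
  moreover have "uc (vector [1, 1, 0, 0]) ^ n \<noteq> 0" unfolding uc_def by (simp add: complex_eq_iff)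
  ultimately show ?thesis using cpf_nonzero[of "\<lambda>v. uc v ^ n"] cpf_uc by blast
qed

lemma uc_self_rep:
  assumes "F \<in> self_reps" "fibred F" "v \<in> sph"
  shows "uc (F v) * cnj (uc (F v)) = (of_real (F v $ 1))\<^sup>2 * (1 - (of_real (v $ 4))\<^sup>2)"
proof -
  have "quadric (F v) = 0" "F v $ 4 = F v $ 1 * v $ 4"
    using assms self_reps_quadric unfolding sph_def fibred_def by auto
  then have "(F v $ 2)\<^sup>2 + (F v $ 3)\<^sup>2 = (F v $ 1)\<^sup>2 * (1 - (v $ 4)\<^sup>2)"
    unfolding quadric_def by (simp add: algebra_simps power_mult_distrib)
  then have "uc (F v) * cnj (uc (F v)) = of_real ((F v $ 1)\<^sup>2 * (1 - (v $ 4)\<^sup>2))"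
    unfolding complex_norm_square[symmetric] by (simp add: uc_def cmod_power2)
  then show ?thesis by simp
qed

text \<open>Let \<phi> = P / Q be the coordinate u of the image. The inverse map gives u =
  P'(\<phi>) / Q'(\<phi>), hence a relation for \<phi> whose i-th coefficient, u times that of Q'
  minus that of P', is linear in u. In lowest terms P and Q then have degree at most 1 in u.\<close>

lemma Bir_linear_fractional:
  assumes A: "A \<in> carrier Bir_S" and F: "F \<in> A"
  obtains \<alpha> \<beta> \<gamma> \<delta> s where "cpoly \<alpha>" "cpoly \<beta>" "cpoly \<gamma>" "cpoly \<delta>" "\<gamma> s \<noteq> 0 \<or> \<delta> s \<noteq> 0"
    "\<And>v. v \<in> sph \<Longrightarrow> uc (F v) * (\<gamma> (v $ 4) * uc v + \<delta> (v $ 4))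
       = of_real (F v $ 1) * (\<alpha> (v $ 4) * uc v + \<beta> (v $ 4))"
proof -
  define B where "B = inv\<^bsub>Bir_S\<^esub> A"
  have B: "B \<in> carrier Bir_S" and BA: "rat_comp B A = rat_id"
    unfolding B_def using A Bir.l_inv[OF A] by auto
  obtain G where G: "G \<in> B" using Bir_ex[OF B] by blast
  have r: "F \<in> self_reps" "G \<in> self_reps" using Bir_rep A B F G by auto
  have "G \<circ> F \<in> rat_id" using rat_comp_Bir(3)[OF Bir_rational[OF B] G A F] BA by simp
  then have GF: "(G \<circ> F, id) \<in> self_rel" using rational_maps_rel[OF rat_id_in_rational_maps _ id_in_rat_id] by blast
  obtain P Q N where P: "\<And>v. v \<in> sph \<Longrightarrow> uc v ^ N * uc (F v) = ev2 P (v $ 4) (uc v)"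
    and Q: "\<And>v. v \<in> sph \<Longrightarrow> uc v ^ N * of_real (F v $ 1) = ev2 Q (v $ 4) (uc v)"
    using self_reps_laurent[OF r(1)] by metis
  obtain P' Q' N' where P': "\<And>v. v \<in> sph \<Longrightarrow> uc v ^ N' * uc (G v) = ev2 P' (v $ 4) (uc v)"
    and Q': "\<And>v. v \<in> sph \<Longrightarrow> uc v ^ N' * of_real (G v $ 1) = ev2 Q' (v $ 4) (uc v)"
    using self_reps_laurent[OF r(2)] by metis
  have Q_nz: "Q \<noteq> 0" if H: "H \<in> self_reps" "\<And>v. v \<in> sph \<Longrightarrow> uc v ^ N * of_real (H v $ 1) = ev2 Q (v $ 4) (uc v)"
    for H N Q
  proof
    assume "Q = 0"
    have "H v $ 1 = 0" if v: "v \<in> sph" for v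
    proof (rule nonzero_on_sph_cancel[OF uc_nonzero[of N] self_reps_polynomial[OF H(1), of 1] _ v])
      fix w assume w: "w \<in> sph" "(cmod (uc w ^ N))\<^sup>2 \<noteq> 0"
      then show "H w $ 1 = 0" using H(2)[OF w(1)] \<open>Q = 0\<close> by auto
    qed
    then show False using self_reps_nonzero[OF H(1)] unfolding nonzero_on_sph_def by blast
  qed
  have nz: "Q \<noteq> 0" "Q' \<noteq> 0" using Q_nz[OF r(1) Q] Q_nz[OF r(2) Q'] by auto
  \<comment> \<open>Otherwise the image would lie on the axis u = 0; but its fibre circle has the
    same radius as that of the argument, so generically u cannot vanish.\<close>
  have "P \<noteq> 0"
  proof
    assume "P = 0"
    have "F v $ 1 = 0" if v: "v \<in> sph" for v
    proof (rule nonzero_on_sph_cancel[OF uc_nonzero[of "Suc N"] self_reps_polynomial[OF r(1), of 1] _ v])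
      fix w assume w: "w \<in> sph" "(cmod (uc w ^ Suc N))\<^sup>2 \<noteq> 0"
      then have "uc (F w) = 0" using P[OF w(1)] \<open>P = 0\<close> by auto
      then have "(of_real (F w $ 1))\<^sup>2 * (uc w * cnj (uc w)) = 0"
        using uc_self_rep[OF r(1) Bir_fibred[OF A F] w(1)] uc_norm[OF w(1)] by simp
      then show "F w $ 1 = 0" using w(2) by simp
    qed
    then show False using self_reps_nonzero[OF r(1)] unfolding nonzero_on_sph_def by blast
  qed
  define n where "n = max (degree P') (degree Q')"
  define R where "R = (\<lambda>i. [:- poly.coeff P' i, poly.coeff Q' i:])"
  \<comment> \<open>The extra factor \<open>Q\<close> settles the points where \<phi> is undefined;
    it is cancelled afterwards.\<close>
  have "(\<Sum>i\<le>n. R i * P ^ i * Q ^ (n - i)) * Q = 0"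
  proof (rule ev2_eq_0)
    fix v assume v: "v \<in> sph" "uc v \<noteq> 0"
    define u t where "u = uc v" and "t = v $ 4"
    show "ev2 ((\<Sum>i\<le>n. R i * P ^ i * Q ^ (n - i)) * Q) (v $ 4) (uc v) = 0"
    proof (cases "ev2 Q t u = 0")
      case False
      then have F1: "F v $ 1 \<noteq> 0" using Q[OF v(1)] unfolding u_def t_def by auto
      define p where "p = ev F v"
      have p: "p \<in> sph" "p $ 4 = t"
        unfolding p_def t_def using ev_in_sph[OF r(1) v(1) F1] fibred_ev[OF Bir_fibred[OF A F] v(1) F1] by auto
      define \<phi> where "\<phi> = uc p"
      have "uc (F v) = of_real (F v $ 1) * \<phi>" unfolding \<phi>_def p_def using ev_eq[of F v, OF F1] by (metis uc_scaleR)
      then have PQ: "ev2 P t u = \<phi> * ev2 Q t u"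
        unfolding u_def t_def P[OF v(1), symmetric] Q[OF v(1), symmetric] by simp
      obtain k where k: "k \<noteq> 0" "G (F v) = k *\<^sub>R G p" unfolding p_def using comp_ev[of G F v, OF r(2) F1] by blast
      have "(G \<circ> F) v $ 1 *\<^sub>R id v = id v $ 1 *\<^sub>R (G \<circ> F) v" using GF v(1) unfolding self_rel_iff by blast
      then have "uc ((k * G p $ 1) *\<^sub>R v) = uc (k *\<^sub>R G p)" using k(2) v(1) by (simp add: sph_def)
      then have "uc (G p) = of_real (G p $ 1) * u" using k(1) unfolding u_def by simp
      then have "ev2 P' t \<phi> = u * ev2 Q' t \<phi>"
        unfolding \<phi>_def p(2)[symmetric] P'[OF p(1), symmetric] Q'[OF p(1), symmetric] by simp
      moreover have "ev2 P' t \<phi> = (\<Sum>i\<le>n. poly (poly.coeff P' i) (of_real t) * \<phi> ^ i)"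
        "ev2 Q' t \<phi> = (\<Sum>i\<le>n. poly (poly.coeff Q' i) (of_real t) * \<phi> ^ i)"
        unfolding ev2_def n_def by (subst poly_eq_sum_le[of _ "max (degree P') (degree Q')"]; simp add: poly_sum)+
      ultimately have z: "(\<Sum>i\<le>n. (u * poly (poly.coeff Q' i) (of_real t) - poly (poly.coeff P' i) (of_real t)) * \<phi> ^ i) = 0"
        by (simp add: sum_distrib_left sum_subtractf algebra_simps)
      have "ev2 (\<Sum>i\<le>n. R i * P ^ i * Q ^ (n - i)) t u = (\<Sum>i\<le>n. ev2 Q t u ^ n *
          ((u * poly (poly.coeff Q' i) (of_real t) - poly (poly.coeff P' i) (of_real t)) * \<phi> ^ i))"
        unfolding ev2_sum
      proof (rule sum.cong)
        fix i assume "i \<in> {..n}"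
        then have "ev2 Q t u ^ n = ev2 Q t u ^ i * ev2 Q t u ^ (n - i)" by (simp flip: power_add)
        then show "ev2 (R i * P ^ i * Q ^ (n - i)) t u = ev2 Q t u ^ n *
          ((u * poly (poly.coeff Q' i) (of_real t) - poly (poly.coeff P' i) (of_real t)) * \<phi> ^ i)"
          unfolding R_def by (simp add: PQ power_mult_distrib algebra_simps)
      qed simp
      then show ?thesis using z unfolding u_def t_def by (simp flip: sum_distrib_left)
    qed (simp add: u_def t_def)
  qed
  then have s: "(\<Sum>i\<le>n. R i * P ^ i * Q ^ (n - i)) = 0" using nz(1) by simp
  have "degree Q' \<le> n" "R (degree Q') \<noteq> 0" unfolding n_def R_def using nz(2) by auto
  then have "\<exists>i\<le>n. R i \<noteq> 0" by blast
  moreover have "degree (R i) \<le> 1" for i unfolding R_def by (rule degree_le) (auto simp: coeff_pCons split: nat.splits)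
  ultimately obtain D P0 Q0 where D: "P = D * P0" "Q = D * Q0" "degree P0 \<le> 1" "degree Q0 \<le> 1"
    using binary_relation_linear[OF _ _ s \<open>P \<noteq> 0\<close> nz(1)] by blast
  have lin: "p = [:poly.coeff p 0, poly.coeff p 1:]" if "degree p \<le> 1" for p :: "complex poly poly"
    using that by (intro poly_eqI) (auto simp: coeff_pCons coeff_eq_0 split: nat.splits)
  define \<alpha> \<beta> \<gamma> \<delta> :: "real \<Rightarrow> complex" where "\<alpha> = (\<lambda>t. poly (poly.coeff P0 1) (of_real t))"
    and "\<beta> = (\<lambda>t. poly (poly.coeff P0 0) (of_real t))"
    and "\<gamma> = (\<lambda>t. poly (poly.coeff Q0 1) (of_real t))" and "\<delta> = (\<lambda>t. poly (poly.coeff Q0 0) (of_real t))"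
  have e: "ev2 P0 t u = \<alpha> t * u + \<beta> t" "ev2 Q0 t u = \<gamma> t * u + \<delta> t" for t u
    unfolding \<alpha>_def \<beta>_def \<gamma>_def \<delta>_def by (subst lin, fact, simp)+
  have c: "cpoly \<alpha>" "cpoly \<beta>" "cpoly \<gamma>" "cpoly \<delta>"
    unfolding \<alpha>_def \<beta>_def \<gamma>_def \<delta>_def by (rule cpoly_poly)+
  have ex: "\<exists>s. \<gamma> s \<noteq> 0 \<or> \<delta> s \<noteq> 0"
  proof (rule ccontr)
    assume "\<not> ?thesis"
    then have "ev2 Q0 t u = 0" for t u using e by simp
    then have "Q0 = 0" by (intro ev2_eq_0)
    then show False using D(2) nz(1) by simp
  qed
  have "uc (F v) * (\<gamma> (v $ 4) * uc v + \<delta> (v $ 4)) - of_real (F v $ 1) * (\<alpha> (v $ 4) * uc v + \<beta> (v $ 4)) = 0"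
    if v: "v \<in> sph" for v
  proof (rule cpf_cancel[OF nonzero_on_sph_mult[OF uc_nonzero[of N] uc_nonzero[of 1]] _ _ v])
    show "cpf (\<lambda>v. uc (F v) * (\<gamma> (v $ 4) * uc v + \<delta> (v $ 4)) - of_real (F v $ 1) * (\<alpha> (v $ 4) * uc v + \<beta> (v $ 4)))"
      using c r by (intro cpf_diff cpf_mult cpf_add cpf_uc_comp cpf_of_real cpf_uc cpf_cpoly self_reps_polynomial)
    fix w assume w: "w \<in> sph" "(cmod (uc w ^ N))\<^sup>2 * (cmod (uc w ^ 1))\<^sup>2 \<noteq> 0"
    have "uc w ^ N * (uc (F w) * ev2 Q0 (w $ 4) (uc w)) = ev2 P (w $ 4) (uc w) * ev2 Q0 (w $ 4) (uc w)"
      unfolding P[OF w(1), symmetric] by simp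
    also have "\<dots> = ev2 Q (w $ 4) (uc w) * ev2 P0 (w $ 4) (uc w)" unfolding D(1,2) by simp
    also have "\<dots> = uc w ^ N * (of_real (F w $ 1) * ev2 P0 (w $ 4) (uc w))"
      unfolding Q[OF w(1), symmetric] by simp
    finally show "uc (F w) * (\<gamma> (w $ 4) * uc w + \<delta> (w $ 4)) - of_real (F w $ 1) * (\<alpha> (w $ 4) * uc w + \<beta> (w $ 4)) = 0"
      using w(2) unfolding e by simp
  qed
  then have "uc (F v) * (\<gamma> (v $ 4) * uc v + \<delta> (v $ 4)) = of_real (F v $ 1) * (\<alpha> (v $ 4) * uc v + \<beta> (v $ 4))"
    if "v \<in> sph" for v using that by simp
  with ex c show ?thesis using that by metis
qed

text \<open>The real structure \<open>u \<mapsto> (1 - t\<^sup>2) / cnj u\<close> maps the solutions \<open>(\<alpha>, \<beta>, \<gamma>, \<delta>)\<close> of the linear system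
  \<open>U (\<gamma> u + \<delta>) = M (\<alpha> u + \<beta>)\<close> to solutions; adding a solution, possibly multiplied by \<open>\<i>\<close>, to its
  image gives one of quaternionic shape.\<close>

lemma moebius_ex:
  assumes A: "A \<in> carrier Bir_S"
  obtains a b where "moebius A a b"
proof -
  obtain F where F: "F \<in> A" using Bir_ex[OF A] by blast
  have r: "F \<in> self_reps" and fib: "fibred F" using Bir_rep[OF A F] Bir_fibred[OF A F] by auto
  obtain \<alpha> \<beta> \<gamma> \<delta> s where c: "cpoly \<alpha>" "cpoly \<beta>" "cpoly \<gamma>" "cpoly \<delta>" and s: "\<gamma> s \<noteq> 0 \<or> \<delta> s \<noteq> 0"
    and eq: "\<And>v. v \<in> sph \<Longrightarrow> uc (F v) * (\<gamma> (v $ 4) * uc v + \<delta> (v $ 4))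
       = of_real (F v $ 1) * (\<alpha> (v $ 4) * uc v + \<beta> (v $ 4))"
    using Bir_linear_fractional[OF A F] by metis
  \<comment> \<open>The solution multiplied by (1 - t^2) k is added to its image under the real
    structure. The sum has the coefficients a, b (1 - t^2), cnj b and cnj a of a quaternion, and
    \<open>k\<close> will be 1 or the imaginary unit.\<close>
  define a where "a = (\<lambda>k t. (1 - (of_real t)\<^sup>2) * (k * \<alpha> t + cnj (k * \<delta> t)))"
  define b where "b = (\<lambda>k t. k * \<beta> t + (1 - (of_real t)\<^sup>2) * cnj (k * \<gamma> t))"
  have cab: "cpoly (a k)" "cpoly (b k)" for k
    unfolding a_def b_def
    by (intro cpoly_add cpoly_mult cpoly_diff cpoly_power cpoly_cnj cpoly_const cpoly_of_real c)+
  have main: "moebius A (a k) (b k)" if nz: "a k s \<noteq> 0 \<or> b k s \<noteq> 0" for k s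
  proof (rule moebiusI[OF Bir_rational[OF A] F fib cab nz self_reps_nonzero[OF r]])
    fix v assume v: "v \<in> sph" "F v $ 1 \<noteq> 0"
    define t where "t = v $ 4"
    define f :: complex where "f = 1 - (of_real t)\<^sup>2"
    define U M u where "U = uc (F v)" and "M = complex_of_real (F v $ 1)" and "u = uc v"
    have f: "cnj f = f" and M: "cnj M = M" "M \<noteq> 0" unfolding f_def M_def using v(2) by auto
    have n: "u * cnj u = f" "U * cnj U = M\<^sup>2 * f"
      using uc_norm[OF v(1)] uc_self_rep[OF r fib v(1)] unfolding u_def U_def M_def f_def t_def by auto
    define \<alpha>' \<beta>' \<gamma>' \<delta>' where "\<alpha>' = k * \<alpha> t" and "\<beta>' = k * \<beta> t" and "\<gamma>' = k * \<gamma> t" and "\<delta>' = k * \<delta> t"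
    have E: "U * (\<gamma>' * u + \<delta>') = M * (\<alpha>' * u + \<beta>')"
      using arg_cong[OF eq[OF v(1)], of "\<lambda>x. k * x"]
      unfolding U_def M_def u_def t_def \<alpha>'_def \<beta>'_def \<gamma>'_def \<delta>'_def by (simp add: algebra_simps)
    have E': "cnj U * (cnj \<gamma>' * cnj u + cnj \<delta>') = M * (cnj \<alpha>' * cnj u + cnj \<beta>')"
      using arg_cong[OF E, of cnj] M(1) by simp
    have "M * (U * (cnj \<beta>' * u + f * cnj \<alpha>')) = U * u * (M * (cnj \<alpha>' * cnj u + cnj \<beta>'))"
      unfolding n(1)[symmetric] by (simp add: algebra_simps)
    also have "\<dots> = (U * cnj U) * ((u * cnj u) * cnj \<gamma>' + u * cnj \<delta>')"
      unfolding E'[symmetric] by (simp add: algebra_simps)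
    also have "\<dots> = M * (M * f * (f * cnj \<gamma>' + u * cnj \<delta>'))"
      unfolding n by (simp add: algebra_simps power2_eq_square)
    finally have E2: "U * (cnj \<beta>' * u + f * cnj \<alpha>') = M * f * (f * cnj \<gamma>' + u * cnj \<delta>')" using M(2) by simp
    have "U * (cnj (\<beta>' + f * cnj \<gamma>') * u + cnj (f * (\<alpha>' + cnj \<delta>')))
      = f * (U * (\<gamma>' * u + \<delta>')) + U * (cnj \<beta>' * u + f * cnj \<alpha>')"
      using f by (simp add: algebra_simps)
    also have "\<dots> = M * (f * (\<alpha>' + cnj \<delta>') * u + (\<beta>' + f * cnj \<gamma>') * f)"
      unfolding E E2 by (simp add: algebra_simps)
    finally show "uc (F v) * mob_den (a k) (b k) v = of_real (F v $ 1) * mob_num (a k) (b k) v"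
      unfolding mob_den_def mob_num_def t_def[symmetric] f_def[symmetric] U_def[symmetric] M_def[symmetric]
        u_def[symmetric] a_def b_def \<alpha>'_def \<beta>'_def \<gamma>'_def \<delta>'_def .
  qed
  \<comment> \<open>If the sums vanished for k = 1 and for the imaginary unit, their combinations
    would make \<gamma> and \<delta> vanish for -1 < t < 1, hence everywhere.\<close>
  have "\<exists>k s. a k s \<noteq> 0 \<or> b k s \<noteq> 0"
  proof (rule ccontr)
    assume "\<not> ?thesis"
    then have z: "a k t = 0" "b k t = 0" for k t by auto
    have "\<gamma> t = 0 \<and> \<delta> t = 0" if t: "-1 < t" "t < 1" for t
    proof -
      define f :: complex where "f = 1 - (of_real t)\<^sup>2"
      have "t\<^sup>2 < 1" using t abs_square_less_1[of t] by simp
      then have "1 - t\<^sup>2 \<noteq> 0" by simp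
      then have "complex_of_real (1 - t\<^sup>2) \<noteq> 0" unfolding of_real_eq_0_iff .
      then have f: "f \<noteq> 0" unfolding f_def by simp
      have "\<alpha> t + cnj (\<delta> t) = 0" "\<i> * (\<alpha> t - cnj (\<delta> t)) = 0"
        using z(1)[of 1 t] z(1)[of \<i> t] f unfolding a_def f_def[symmetric] by (simp_all add: algebra_simps)
      then have "\<delta> t = 0" by simp
      moreover have "\<beta> t + f * cnj (\<gamma> t) = 0" "\<i> * (\<beta> t - f * cnj (\<gamma> t)) = 0"
        using z(2)[of 1 t] z(2)[of \<i> t] unfolding b_def f_def[symmetric] by (simp_all add: algebra_simps)
      then have "\<gamma> t = 0" using f by simp
      ultimately show ?thesis by simp
    qed
    then show False using cpoly_eq_0[OF c(3)] cpoly_eq_0[OF c(4)] s by blast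
  qed
  then show ?thesis using main that by blast
qed

section \<open>Involutions\<close>

lemma moebius_unscale:
  assumes A: "moebius A (\<lambda>t. of_real (poly c t) * a t) (\<lambda>t. of_real (poly c t) * b t)"
    and ab: "cpoly a" "cpoly b"
  shows "moebius A a b"
proof -
  note A' = moebiusD[OF A]
  obtain s where s: "of_real (poly c s) * a s \<noteq> 0 \<or> of_real (poly c s) * b s \<noteq> 0" using A'(4) by blast
  then have "of_real (poly c s) \<noteq> (0 :: complex)" by auto
  then obtain t where t: "-1 < t" "t < 1" "of_real (poly c t) \<noteq> (0 :: complex)"
    using cpoly_eq_0[OF cpoly_real_poly[of c], of s] by blast
  obtain v where v: "v \<in> sph" "v $ 4 = t" using sph_circle[OF t(1,2)] by (metis complex_cnj_one mult_1)
  have P: "nonzero_on_sph (\<lambda>v. (cmod (of_real (poly c (v $ 4))))\<^sup>2)"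
    by (rule cpf_nonzero[OF cpf_cpoly[OF cpoly_real_poly] v(1)]) (simp only: v(2) t(3) not_False_eq_True)
  obtain F where F: "F \<in> A" using rational_maps_ex A'(1) by metis
  have s': "a s \<noteq> 0 \<or> b s \<noteq> 0" using s by auto
  show ?thesis
  proof (rule moebiusI[OF A'(1) F A'(5)[OF F] ab s' P])
    fix v assume v: "v \<in> sph" "(cmod (of_real (poly c (v $ 4))))\<^sup>2 \<noteq> 0"
    then have c: "complex_of_real (poly c (v $ 4)) \<noteq> 0" by simp
    have "mob_den (\<lambda>t. of_real (poly c t) * a t) (\<lambda>t. of_real (poly c t) * b t) v = of_real (poly c (v $ 4)) * mob_den a b v"
      "mob_num (\<lambda>t. of_real (poly c t) * a t) (\<lambda>t. of_real (poly c t) * b t) v = of_real (poly c (v $ 4)) * mob_num a b v"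
      unfolding mob_den_def mob_num_def by (simp_all add: algebra_simps)
    then have "of_real (poly c (v $ 4)) * (uc (F v) * mob_den a b v) = of_real (poly c (v $ 4)) * (of_real (F v $ 1) * mob_num a b v)"
      using A'(6)[OF F v(1)] by (simp add: mult.left_commute)
    then show "uc (F v) * mob_den a b v = of_real (F v $ 1) * mob_num a b v" using c by simp
  qed
qed

text \<open>Let p be the real part of a. The square of a + b j has imaginary part 2 p Im a and
  j-component 2 p b, and both vanish since the square is the identity. If p were non-zero, the
  quaternion would be a real scalar and the map the identity.\<close>

lemma involution_pure:
  assumes g: "g \<in> carrier Bir_S" and inv: "rat_comp g g = rat_id" "g \<noteq> rat_id"
  obtains a b where "cpoly b" "moebius g (\<lambda>t. \<i> * of_real (poly a t)) b"
proof -
  obtain a b where ab: "moebius g a b" using moebius_ex[OF g] by blast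
  note ab' = moebiusD[OF ab]
  obtain p q where pq: "\<And>t. a t = Complex (poly p t) (poly q t)" using cpoly_Re_Im[OF ab'(2)] by blast
  have id: "moebius rat_id (qmult1 a b a b) (qmult2 a b a b)" using moebius_comp_Bir[OF ab ab g] inv(1) by simp
  have 2: "poly p t = 0 \<or> b t = 0" for t
  proof -
    have "qmult2 a b a b t = 2 * of_real (poly p t) * b t"
      unfolding qmult2_def pq by (simp add: complex_eq_iff algebra_simps)
    then show ?thesis using moebius_id(1)[OF id, of t] by simp
  qed
  have 1: "poly p t = 0 \<or> poly q t = 0" for t
  proof -
    have "(1 - (of_real t)\<^sup>2) * (b t * cnj (b t)) = of_real ((1 - t\<^sup>2) * (cmod (b t))\<^sup>2)"
      by (simp only: of_real_mult complex_norm_square) simp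
    then have "Im (qmult1 a b a b t) = 2 * poly p t * poly q t"
      unfolding qmult1_def pq by (simp only: plus_complex.sel times_complex.sel Im_complex_of_real complex.sel) simp
    moreover have "Im (qmult1 a b a b t) = 0"
      using arg_cong[OF moebius_id(2)[OF id, of t], of Im] by simp
    ultimately show ?thesis by simp
  qed
  have "p = 0"
  proof (rule ccontr)
    assume p: "p \<noteq> 0"
    then have "finite {t. poly p t = 0}" by (rule poly_roots_finite)
    then have p0: "finite {t. poly p t = 0}" .
    have z: "f t = 0" if f: "cpoly f" "\<And>t. poly p t = 0 \<or> f t = 0" for f :: "real \<Rightarrow> complex" and t
    proof (rule ccontr)
      assume "f t \<noteq> 0"
      then have "finite ({t. poly p t = 0} \<union> {t. f t = 0})" using cpoly_finite_zeros[OF f(1)] p0 by blast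
      moreover have "{t. poly p t = 0} \<union> {t. f t = 0} = UNIV" using f(2) by blast
      ultimately show False using infinite_UNIV_char_0[where 'a = real] by simp
    qed
    have b: "b = (\<lambda>t. 0)" using z[OF ab'(3) 2] by auto
    have "of_real (poly q t) = (0 :: complex)" for t using z[OF cpoly_real_poly[of q]] 1 by simp
    then have "cnj (a t) = a t" for t unfolding pq by (simp add: complex_eq_iff)
    moreover obtain s where "a s \<noteq> 0" using ab'(4) b by auto
    ultimately have "moebius rat_id a (\<lambda>t. 0)" using moebius_rat_id ab'(2) by blast
    then show False using moebius_unique ab inv(2) b by blast
  qed
  then have "a = (\<lambda>t. \<i> * of_real (poly q t))" using pq by (auto simp: fun_eq_iff complex_eq_iff)
  then show ?thesis using that ab ab'(3) by simp
qed

text \<open>A representative of least total degree has no common real zero t, because dividing by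
  the linear factor at t would lower the degree.\<close>

lemma involution_primitive:
  assumes g: "g \<in> carrier Bir_S" and inv: "rat_comp g g = rat_id" "g \<noteq> rat_id"
  obtains a b where "cpoly b" "moebius g (\<lambda>t. \<i> * of_real (poly a t)) b" "\<And>t. poly a t \<noteq> 0 \<or> b t \<noteq> 0"
proof -
  define b where "b = (\<lambda>p q t. Complex (poly p t) (poly q t))"
  have cb: "cpoly (b p q)" for p q
  proof -
    have "b p q = (\<lambda>t. of_real (poly p t) + \<i> * of_real (poly q t))" unfolding b_def by (auto simp: fun_eq_iff complex_eq_iff)
    then show ?thesis by (simp only:) (intro cpoly_add cpoly_mult cpoly_const cpoly_real_poly)
  qed
  define Q where "Q = (\<lambda>(a, p, q). moebius g (\<lambda>t. \<i> * of_real (poly a t)) (b p q))"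
  define m :: "real poly \<times> real poly \<times> real poly \<Rightarrow> nat" where "m = (\<lambda>(a, p, q). degree a + degree p + degree q)"
  obtain a0 b0 where ab0: "cpoly b0" "moebius g (\<lambda>t. \<i> * of_real (poly a0 t)) b0" using involution_pure[OF assms] by blast
  obtain p0 q0 where "\<And>t. b0 t = Complex (poly p0 t) (poly q0 t)" using cpoly_Re_Im[OF ab0(1)] by blast
  then have "b0 = b p0 q0" unfolding b_def by auto
  then have "Q (a0, p0, q0)" using ab0 unfolding Q_def by simp
  then obtain x where x: "Q x" "\<And>y. Q y \<Longrightarrow> m x \<le> m y" using ex_has_least_nat[of Q "(a0, p0, q0)" m] by blast
  obtain a p q where apq: "x = (a, p, q)" using prod_cases3 by blast
  have mo: "moebius g (\<lambda>t. \<i> * of_real (poly a t)) (b p q)" using x(1) unfolding Q_def apq by simp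
  have "poly a t \<noteq> 0 \<or> b p q t \<noteq> 0" for t
  proof (rule ccontr)
    assume "\<not> ?thesis"
    then have "poly a t = 0" "poly p t = 0" "poly q t = 0" unfolding b_def by (auto simp: complex_eq_iff)
    then obtain a1 p1 q1 where d: "a = [:- t, 1:] * a1" "p = [:- t, 1:] * p1" "q = [:- t, 1:] * q1"
      unfolding poly_eq_0_iff_dvd dvd_def by blast
    have "(\<lambda>s. \<i> * of_real (poly a s)) = (\<lambda>s. of_real (poly [:- t, 1:] s) * (\<i> * of_real (poly a1 s)))"
      "b p q = (\<lambda>s. of_real (poly [:- t, 1:] s) * b p1 q1 s)"
      unfolding d b_def by (auto simp: fun_eq_iff complex_eq_iff algebra_simps)
    then have "moebius g (\<lambda>s. \<i> * of_real (poly a1 s)) (b p1 q1)"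
      using moebius_unscale[of g "[:- t, 1:]" "\<lambda>s. \<i> * of_real (poly a1 s)" "b p1 q1"] mo cb
        cpoly_mult[OF cpoly_const cpoly_real_poly] by (simp only:)
    then have le: "m (a, p, q) \<le> m (a1, p1, q1)" using x(2)[of "(a1, p1, q1)"] unfolding apq Q_def by simp
    have deg: "degree ([:- t, 1:] * r) = (if r = 0 then 0 else Suc (degree r))" for r :: "real poly"
      by (auto simp: degree_mult_eq simp del: mult_pCons_left)
    have "degree a = (if a1 = 0 then 0 else Suc (degree a1))" "degree p = (if p1 = 0 then 0 else Suc (degree p1))"
      "degree q = (if q1 = 0 then 0 else Suc (degree q1))"
      unfolding d by (rule deg)+
    \<comment> \<open>Division lowers the degree of each non-zero entry, while a zero entry keeps
      degree 0; minimality thus leaves only the zero triple.\<close>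
    then have "a1 = 0 \<and> p1 = 0 \<and> q1 = 0" using le unfolding m_def by (auto split: if_splits)
    then have "a = 0" "b p q = (\<lambda>t. 0)" unfolding d b_def by (auto simp: fun_eq_iff complex_eq_iff)
    then show False using moebiusD(4)[OF mo] by auto
  qed
  then show ?thesis using that cb mo by blast
qed

lemma sph_eqI:
  assumes "v \<in> sph" "w \<in> sph" "uc v = uc w" "v $ 4 = w $ 4"
  shows "v = w"
  using assms unfolding sph_def uc_def by (simp add: vec_eq_iff forall_4)

text \<open>Where the norm vanishes, the map is constant on the fibre, hence not injective.\<close>

lemma Aut_qnorm_nonzero:
  assumes g: "g \<in> carrier Aut_SR" and mo: "moebius g a b" and t: "-1 < t" "t < 1" and nz: "a t \<noteq> 0 \<or> b t \<noteq> 0"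
  shows "qnorm a b t \<noteq> 0"
proof
  assume z: "qnorm a b t = 0"
  define f :: complex where "f = 1 - (of_real t)\<^sup>2"
  have "t\<^sup>2 < 1" using t abs_square_less_1[of t] by simp
  then have b: "b t \<noteq> 0" using z nz unfolding qnorm_def by auto
  have n: "a t * cnj (a t) = f * (b t * cnj (b t))" using of_real_qnorm[of a b t] z unfolding f_def by simp
  obtain r :: real where r: "r > 0" "\<And>s. s * cnj s = 1 \<Longrightarrow> \<exists>v\<in>sph. v $ 4 = t \<and> uc v = of_real r * s"
    using sph_circle[OF t] by blast
  define d where "d = (\<lambda>s. cnj (b t) * (of_real r * s) + cnj (a t))"
  have g': "g \<in> carrier Bir_S" "regular_on_real_points g" using g Aut_carrier_iff by auto
  have inj: "s = s'" if s: "s * cnj s = 1" "s' * cnj s' = 1" "d s \<noteq> 0" "d s' \<noteq> 0" for s s'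
  proof -
    have pt: "\<exists>F v. F \<in> g \<and> v \<in> sph \<and> F v $ 1 \<noteq> 0 \<and> uc v = of_real r * s \<and> ev F v \<in> sph
        \<and> uc (ev F v) = a t / cnj (b t) \<and> ev F v $ 4 = t" if s: "s * cnj s = 1" "d s \<noteq> 0" for s
    proof -
      obtain v where v: "v \<in> sph" "v $ 4 = t" "uc v = of_real r * s" using r(2)[OF s(1)] by blast
      obtain F where F: "F \<in> g" "F v $ 1 \<noteq> 0" using g' regular_iff[OF Bir_rational[OF g'(1)]] v(1) by blast
      have e: "ev F v \<in> sph" "ev F v $ 4 = t"
        using ev_in_sph[OF Bir_rep[OF g'(1) F(1)] v(1) F(2)] fibred_ev[OF Bir_fibred[OF g'(1) F(1)] v(1) F(2)] v(2) by auto
      have F': "uc (F v) = of_real (F v $ 1) * uc (ev F v)" using ev_eq[of F v, OF F(2)] by (metis uc_scaleR)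
      have "uc (F v) * d s = of_real (F v $ 1) * (a t * (of_real r * s) + b t * f)"
        using moebiusD(6)[OF mo F(1) v(1)] unfolding mob_den_def mob_num_def v(2,3) d_def f_def .
      then have "uc (ev F v) * d s = a t * (of_real r * s) + b t * f" using F(2) unfolding F' by simp
      \<comment> \<open>When the norm is zero, cnj b times the numerator equals a times the
        denominator, so the image is a / cnj b, independent of \<open>s\<close>.\<close>
      then have "cnj (b t) * (uc (ev F v) * d s) = cnj (b t) * (a t * (of_real r * s) + b t * f)" by (simp only:)
      then have "uc (ev F v) * cnj (b t) * d s = cnj (b t) * (a t * (of_real r * s)) + f * (b t * cnj (b t))"
        by (simp only: algebra_simps)
      also have "\<dots> = a t * d s" unfolding n[symmetric] d_def by (simp add: algebra_simps)
      finally have "uc (ev F v) * cnj (b t) = a t" using s(2) by simp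
      then have "uc (ev F v) = a t / cnj (b t)" using b by (simp add: field_simps)
      then show ?thesis using F v e by blast
    qed
    obtain F v where F: "F \<in> g" "v \<in> sph" "F v $ 1 \<noteq> 0" "uc v = of_real r * s" "ev F v \<in> sph"
        "uc (ev F v) = a t / cnj (b t)" "ev F v $ 4 = t" using pt[OF s(1,3)] by blast
    obtain F' w where F': "F' \<in> g" "w \<in> sph" "F' w $ 1 \<noteq> 0" "uc w = of_real r * s'" "ev F' w \<in> sph"
        "uc (ev F' w) = a t / cnj (b t)" "ev F' w $ 4 = t" using pt[OF s(2,4)] by blast
    have "ev F v = ev F' w" using sph_eqI F F' by metis
    then have "v = w" using Aut_ev_inj[OF g F(1,3) F'(1,3) F(2) F'(2)] by blast
    then show ?thesis using F(4) F'(4) r(1) by simp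
  qed
  have dd: "d s - d s' = cnj (b t) * of_real r * (s - s')" for s s' unfolding d_def by (simp add: algebra_simps)
  have zero: "s = s'" if "d s = 0" "d s' = 0" for s s' using dd[of s s'] that b r(1) by simp
  \<comment> \<open>The denominator \<open>d\<close> is affine in \<open>s\<close> with at most one
    zero. Among three distinct points of the circle two remain, with the same image.\<close>
  have ne: "1 \<noteq> (-1 :: complex)" "1 \<noteq> \<i>" "-1 \<noteq> \<i>" by (auto simp: complex_eq_iff)
  have "d 1 = 0 \<or> d (-1) = 0" "d 1 = 0 \<or> d \<i> = 0" "d (-1) = 0 \<or> d \<i> = 0"
    using inj[of 1 "-1"] inj[of 1 \<i>] inj[of "-1" \<i>] ne by auto
  then show False using zero ne by metis
qed

lemma qnorm_poly:
  assumes "cpoly a" "cpoly b"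
  obtains N where "\<And>t. qnorm a b t = poly N t"
proof -
  obtain p q where "\<And>t. a t = Complex (poly p t) (poly q t)" using cpoly_Re_Im[OF assms(1)] by blast
  moreover obtain p' q' where "\<And>t. b t = Complex (poly p' t) (poly q' t)" using cpoly_Re_Im[OF assms(2)] by blast
  ultimately have "(cmod (a t))\<^sup>2 = (poly p t)\<^sup>2 + (poly q t)\<^sup>2" "(cmod (b t))\<^sup>2 = (poly p' t)\<^sup>2 + (poly q' t)\<^sup>2" for t
    by (simp_all add: cmod_power2)
  then have "qnorm a b t = poly (p ^ 2 + q ^ 2 - [:1, 0, -1:] * (p' ^ 2 + q' ^ 2)) t" for t
    unfolding qnorm_def by (simp add: power2_eq_square algebra_simps)
  then show ?thesis by (rule that)
qed

lemma cmod_poly: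
  assumes "cpoly b"
  obtains B where "\<And>t. (cmod (b t))\<^sup>2 = poly B t"
proof -
  obtain p q where "\<And>t. b t = Complex (poly p t) (poly q t)" using cpoly_Re_Im[OF assms(1)] by blast
  then have "(cmod (b t))\<^sup>2 = poly (p ^ 2 + q ^ 2) t" for t by (simp add: cmod_power2)
  then show ?thesis by (rule that)
qed

lemma real_poly_eqI:
  fixes p q :: "real poly"
  assumes "\<And>t. poly p t = poly q t"
  shows "p = q"
  using assms poly_eq_poly_eq_iff by blast

text \<open>Both h k and h g k g' are the identity, the latter because g' is an involution, and the
  norm of a quaternion that acts as the identity is a square. Dividing the two norms, C^2 = C1^2 N
  N', so C1 divides C and the quotient is the root sought.\<close>

lemma conjugate_qnorm:
  assumes h: "h \<in> carrier Bir_S" and g: "g \<in> carrier Bir_S" and g': "g' \<in> carrier Bir_S"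
    and conj: "g' = rat_comp (rat_comp h g) (inv\<^bsub>Bir_S\<^esub> h)" and inv: "rat_comp g' g' = rat_id"
    and mo: "moebius g a b" "moebius g' a' b'"
  obtains S where "\<And>t. (poly S t)\<^sup>2 = qnorm a b t * qnorm a' b' t"
proof -
  define k where "k = inv\<^bsub>Bir_S\<^esub> h"
  have k: "k \<in> carrier Bir_S" "rat_comp h k = rat_id" unfolding k_def using h Bir.r_inv[OF h] by auto
  obtain c d where cd: "moebius h c d" using moebius_ex[OF h] by blast
  obtain c' d' where cd': "moebius k c' d'" using moebius_ex[OF k(1)] by blast
  have real_id: "\<exists>C. \<forall>t. qnorm x y t = (poly C t)\<^sup>2" if id: "moebius rat_id x y" for x y
  proof -
    obtain p q where pq: "\<And>t. x t = Complex (poly p t) (poly q t)" using cpoly_Re_Im[OF moebiusD(2)[OF id]] by blast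
    have "poly q t = 0" for t using moebius_id(2)[OF id, of t] unfolding pq by (simp add: complex_eq_iff)
    then have "qnorm x y t = (poly p t)\<^sup>2" for t
      unfolding qnorm_def using moebius_id(1)[OF id, of t] pq[of t] by (simp add: cmod_power2)
    then show ?thesis by blast
  qed
  have "moebius rat_id (qmult1 c d c' d') (qmult2 c d c' d')" using moebius_comp_Bir[OF cd cd' k(1)] k(2) by simp
  then obtain C1 where C1: "\<And>t. qnorm c d t * qnorm c' d' t = (poly C1 t)\<^sup>2" using real_id qnorm_mult by metis
  have "rat_comp (rat_comp (rat_comp h g) k) g' = rat_id" using conj inv unfolding k_def by simp
  then obtain C where C: "\<And>t. qnorm c d t * qnorm a b t * qnorm c' d' t * qnorm a' b' t = (poly C t)\<^sup>2"
    using real_id moebius_comp_Bir[OF moebius_comp_Bir[OF moebius_comp_Bir[OF cd mo(1) g] cd' k(1)] mo(2) g'] qnorm_mult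
    by metis
  obtain N where N: "\<And>t. qnorm a b t = poly N t" using qnorm_poly moebiusD(2,3)[OF mo(1)] by blast
  obtain N' where N': "\<And>t. qnorm a' b' t = poly N' t" using qnorm_poly moebiusD(2,3)[OF mo(2)] by blast
  have "poly (C ^ 2) t = poly (C1 ^ 2 * (N * N')) t" for t
    using C[of t] C1[of t] by (simp add: N N' algebra_simps)
  then have e: "C ^ 2 = C1 ^ 2 * (N * N')" by (rule real_poly_eqI)
  \<comment> \<open>At a suitable t > 1 the norms of both factors are positive.\<close>
  have "C1 \<noteq> 0"
  proof
    assume "C1 = 0"
    obtain s s' where "c s \<noteq> 0 \<or> d s \<noteq> 0" "c' s' \<noteq> 0 \<or> d' s' \<noteq> 0" using moebiusD(4)[OF cd] moebiusD(4)[OF cd'] by blast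
    then have "finite ({t. c t = 0 \<and> d t = 0} \<union> {t. c' t = 0 \<and> d' t = 0})"
      using finite_common_zeros moebiusD(2,3)[OF cd] moebiusD(2,3)[OF cd'] by blast
    then have "\<not> {1<..} \<subseteq> {t. c t = 0 \<and> d t = 0} \<union> {t. c' t = 0 \<and> d' t = 0}"
      using infinite_Ioi[of "1 :: real"] finite_subset by blast
    then obtain t where "t > 1" "\<not> (c t = 0 \<and> d t = 0)" "\<not> (c' t = 0 \<and> d' t = 0)" by blast
    then have "qnorm c d t * qnorm c' d' t > 0" using qnorm_pos by simp
    then show False using C1[of t] \<open>C1 = 0\<close> by simp
  qed
  have "C1 ^ 2 dvd C ^ 2" unfolding e by simp
  then have "C1 dvd C" by simp
  then obtain S where "C = C1 * S" by (elim dvdE)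
  then have "S ^ 2 = N * N'" using e \<open>C1 \<noteq> 0\<close> by (simp add: power_mult_distrib)
  then have "(poly S t)\<^sup>2 = qnorm a b t * qnorm a' b' t" for t
    unfolding N N' by (metis poly_mult poly_power)
  then show ?thesis by (rule that)
qed

section \<open>Construction of the conjugating map\<close>

lemma poly_constant_sign:
  fixes p :: "real poly"
  assumes "is_interval S" "\<And>t. t \<in> S \<Longrightarrow> poly p t \<noteq> 0"
  shows "(\<forall>t\<in>S. poly p t > 0) \<or> (\<forall>t\<in>S. poly p t < 0)"
proof (rule ccontr)
  assume "\<not> ?thesis"
  then obtain x y where xy: "x \<in> S" "y \<in> S" "poly p x < 0" "poly p y > 0"
    using assms(2) by (metis linorder_less_linear)
  have "\<exists>z. min x y < z \<and> z < max x y \<and> poly p z = 0"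
  proof (cases "x < y")
    case True
    then show ?thesis using poly_IVT[of x y p] xy by (auto simp: mult_neg_pos)
  next
    case False
    then have "y < x" using xy by (cases "x = y") auto
    then show ?thesis using poly_IVT[of y x p] xy by (auto simp: mult_pos_neg min_def max_def)
  qed
  then obtain z where "min x y < z" "z < max x y" "poly p z = 0" by blast
  moreover from this have "z \<in> S" using assms(1) xy(1,2) unfolding is_interval_1
    by (metis less_eq_real_def max_def min_def)
  ultimately show False using assms(2) by blast
qed

lemma poly_nonneg_closure:
  fixes p :: "real poly"
  assumes "\<And>t. -1 < t \<Longrightarrow> t < 1 \<Longrightarrow> poly p t \<ge> 0" "t \<in> {-1..1}"
  shows "poly p t \<ge> 0"
proof -
  have "continuous_on (closure {-1<..<1}) (\<lambda>t. poly p t)" by (intro continuous_intros)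
  then show ?thesis by (rule continuous_ge_on_closure) (use assms in auto)
qed

lemma endpoint_cases:
  fixes t :: real
  assumes "t \<in> {-1..1}"
  obtains "-1 < t" "t < 1" | "t\<^sup>2 = 1"
  using assms by (cases "t = 1 \<or> t = -1") auto

text \<open>If a vanishes at e, then a^2 has a double zero there, whereas 1 - t^2 has a simple one.
  Dividing by 1 - e t and letting t tend to e leaves -2 B(e) >= 0. With B = |b|^2 this makes b
  vanish at e too.\<close>

lemma square_eq_endpoint_bound:
  fixes a B :: "real poly" and e :: real
  assumes e: "e\<^sup>2 = 1" "poly a e = 0"
    and pos: "\<And>t. -1 < t \<Longrightarrow> t < 1 \<Longrightarrow> (poly a t)\<^sup>2 - (1 - t\<^sup>2) * poly B t > 0"
  shows "poly B e \<le> 0"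
proof -
  obtain a1 where a1: "a = [:- e, 1:] * a1" using e(2) unfolding poly_eq_0_iff_dvd by (elim dvdE)
  define p where "p = [:1, - e:] * a1 ^ 2 - [:1, e:] * B"
  have ee: "e = 1 \<or> e = -1" using e(1) by (simp add: power2_eq_1_iff)
  have "poly p t \<ge> 0" if t: "-1 < t" "t < 1" for t
  proof -
    have pos': "1 - e * t > 0" using ee t by auto
    have "(poly a t)\<^sup>2 - (1 - t\<^sup>2) * poly B t = (1 - e * t) * poly p t"
      using ee unfolding p_def a1 by (auto simp: algebra_simps power2_eq_square)
    then have "(1 - e * t) * poly p t > 0" using pos[OF t] by simp
    then show ?thesis using pos' by (simp add: zero_less_mult_iff)
  qed
  then have "poly p e \<ge> 0" using poly_nonneg_closure[of p e] ee by auto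
  moreover have "poly p e = - (2 * poly B e)" using ee unfolding p_def by auto
  ultimately show ?thesis by simp
qed

lemma poly_divide_1_minus_square:
  fixes a :: "real poly"
  assumes "poly a 1 = 0" "poly a (-1) = 0"
  obtains c where "\<And>t. poly a t = (1 - t\<^sup>2) * poly c t"
proof -
  obtain a1 where a1: "a = [:- 1, 1:] * a1" using assms(1) unfolding poly_eq_0_iff_dvd by (elim dvdE)
  then have "poly a1 (-1) = 0" using assms(2) by simp
  then obtain a2 where a2: "a1 = [:1, 1:] * a2" unfolding poly_eq_0_iff_dvd by (auto elim: dvdE)
  have "poly a t = (1 - t\<^sup>2) * poly (- a2) t" for t
    unfolding a1 a2 by (simp add: algebra_simps power2_eq_square)
  then show ?thesis by (rule that)
qed

lemma cpoly_continuous: "cpoly f \<Longrightarrow> continuous_on S f"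
proof -
  assume "cpoly f"
  then obtain p where "f = (\<lambda>t. poly p (of_real t))" unfolding cpoly_def by blast
  then show ?thesis by (auto intro!: continuous_intros)
qed

lemma cpoly_if_polynomial_function:
  fixes f :: "real \<Rightarrow> complex"
  assumes "polynomial_function f"
  shows "cpoly f"
proof -
  have *: "cpoly (\<lambda>t. of_real (g t))" if g: "real_polynomial_function g" for g :: "real \<Rightarrow> real"
  proof -
    obtain a n where "g = (\<lambda>x. \<Sum>i\<le>n. a i * x ^ i)" using real_polynomial_function_imp_sum[OF g] by blast
    then have "g = (\<lambda>t. poly (\<Sum>i\<le>n. Polynomial.monom (a i) i) t)" by (simp only: poly_sum poly_monom)
    then show ?thesis using cpoly_real_poly[of "\<Sum>i\<le>n. Polynomial.monom (a i) i"] by (simp only:)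
  qed
  have "real_polynomial_function (Re \<circ> f)" "real_polynomial_function (Im \<circ> f)"
    using assms bounded_linear_Re bounded_linear_Im unfolding polynomial_function_def by blast+
  then have "cpoly (\<lambda>t. of_real (Re (f t)))" "cpoly (\<lambda>t. of_real (Im (f t)))"
    using *[of "Re \<circ> f"] *[of "Im \<circ> f"] by simp_all
  then have "cpoly (\<lambda>t. of_real (Re (f t)) + \<i> * of_real (Im (f t)))"
    by (intro cpoly_add cpoly_mult cpoly_const)
  moreover have "of_real (Re (f t)) + \<i> * of_real (Im (f t)) = f t" for t by (simp add: complex_eq_iff)
  ultimately show ?thesis by simp
qed

text \<open>A continuous unit square root of \<open>cnj \<kappa> / \<bar>\<kappa>\<bar>\<close> satisfies the inequality, and it can be approximated by
  polynomials.\<close>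

lemma positive_section:
  fixes \<kappa> :: "real \<Rightarrow> complex" and c :: "real \<Rightarrow> real"
  assumes \<kappa>: "continuous_on {-1..1} \<kappa>" "\<And>t. t \<in> {-1..1} \<Longrightarrow> \<kappa> t \<noteq> 0"
    and c: "continuous_on {-1..1} c" "\<And>t. t \<in> {-1..1} \<Longrightarrow> c t + cmod (\<kappa> t) > 0"
  obtains \<xi> where "cpoly \<xi>" "\<And>t. t \<in> {-1..1} \<Longrightarrow> (cmod (\<xi> t))\<^sup>2 * c t + Re ((\<xi> t)\<^sup>2 * \<kappa> t) > 0"
proof -
  have "contractible {-1..1 :: real}" by (intro convex_imp_contractible) simp
  then obtain g where g: "continuous_on {-1..1} g" "\<And>t. t \<in> {-1..1} \<Longrightarrow> \<kappa> t = exp (g t)"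
    using continuous_logarithm_on_contractible[OF \<kappa>(1)] \<kappa>(2) by blast
  define x where "x = (\<lambda>t. exp (- \<i> * of_real (Im (g t)) / 2))"
  have xc: "continuous_on {-1..1} x" unfolding x_def using g(1) by (intro continuous_intros) auto
  have x1: "cmod (x t) = 1" for t unfolding x_def by simp
  have xk: "(x t)\<^sup>2 * \<kappa> t = of_real (cmod (\<kappa> t))" if t: "t \<in> {-1..1}" for t
  proof -
    have "(x t)\<^sup>2 * \<kappa> t = exp (- \<i> * of_real (Im (g t)) / 2 + - \<i> * of_real (Im (g t)) / 2 + g t)"
      unfolding x_def g(2)[OF t] by (simp only: power2_eq_square exp_add)
    also have "- \<i> * of_real (Im (g t)) / 2 + - \<i> * of_real (Im (g t)) / 2 + g t = of_real (Re (g t))"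
      by (simp add: complex_eq_iff)
    also have "exp (of_real (Re (g t))) = complex_of_real (cmod (\<kappa> t))" unfolding g(2)[OF t] by (simp add: exp_of_real)
    finally show ?thesis .
  qed
  have "continuous_on {-1..1} (\<lambda>t. c t + cmod (\<kappa> t))" using \<kappa>(1) c(1) by (intro continuous_intros)
  then obtain t0 where t0: "t0 \<in> {-1..1}" "\<And>t. t \<in> {-1..1} \<Longrightarrow> c t0 + cmod (\<kappa> t0) \<le> c t + cmod (\<kappa> t)"
    using continuous_attains_inf[of "{-1..1 :: real}" "\<lambda>t. c t + cmod (\<kappa> t)"] by auto
  define \<delta> where "\<delta> = c t0 + cmod (\<kappa> t0)"
  have \<delta>: "\<delta> > 0" "\<And>t. t \<in> {-1..1} \<Longrightarrow> \<delta> \<le> c t + cmod (\<kappa> t)" unfolding \<delta>_def using t0 c(2) by auto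
  have "continuous_on {-1..1} (\<lambda>t. \<bar>c t\<bar> + cmod (\<kappa> t))" using \<kappa>(1) c(1) by (intro continuous_intros)
  then have "\<exists>s\<in>{-1..1}. \<forall>t\<in>{-1..1}. \<bar>c t\<bar> + cmod (\<kappa> t) \<le> \<bar>c s\<bar> + cmod (\<kappa> s)"
    by (intro continuous_attains_sup) auto
  then obtain t1 where t1: "\<forall>t\<in>{-1..1}. \<bar>c t\<bar> + cmod (\<kappa> t) \<le> \<bar>c t1\<bar> + cmod (\<kappa> t1)" by blast
  \<comment> \<open>The summand 1 only serves to make \<open>K\<close> positive.\<close>
  define K where "K = \<bar>c t1\<bar> + cmod (\<kappa> t1) + 1"
  have K: "K > 0" "\<And>t. t \<in> {-1..1} \<Longrightarrow> \<bar>c t\<bar> + cmod (\<kappa> t) \<le> K"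
    unfolding K_def using t1 by (fastforce intro: add_nonneg_pos)+
  \<comment> \<open>With |\<xi> - x| < \<epsilon> <= 1 one has |\<xi> + x| <= 3, so \<xi>^2 and x^2
    differ by at most 3 \<epsilon>. The resulting error is at most 3 \<epsilon> K, less than the
    minimum \<delta>.\<close>
  define \<epsilon> where "\<epsilon> = min 1 (\<delta> / (4 * K))"
  have \<epsilon>: "\<epsilon> > 0" "\<epsilon> \<le> 1" "4 * K * \<epsilon> \<le> \<delta>" unfolding \<epsilon>_def using \<delta>(1) K(1) by (auto simp: min_def field_simps)
  obtain \<xi> where \<xi>: "polynomial_function \<xi>" "\<And>t. t \<in> {-1..1} \<Longrightarrow> cmod (x t - \<xi> t) < \<epsilon>"
    using Stone_Weierstrass_polynomial_function[OF compact_Icc xc \<epsilon>(1)] by blast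
  have "(cmod (\<xi> t))\<^sup>2 * c t + Re ((\<xi> t)\<^sup>2 * \<kappa> t) > 0" if t: "t \<in> {-1..1}" for t
  proof -
    define D where "D = cmod ((\<xi> t)\<^sup>2 - (x t)\<^sup>2)"
    have "cmod (\<xi> t - x t) < \<epsilon>" using \<xi>(2)[OF t] by (simp add: norm_minus_commute)
    moreover have "cmod (\<xi> t + x t) \<le> cmod (\<xi> t - x t) + 2 * cmod (x t)"
      using norm_triangle_ineq[of "\<xi> t - x t" "2 * x t"] by (simp add: norm_mult algebra_simps)
    moreover have "D = cmod (\<xi> t - x t) * cmod (\<xi> t + x t)"
      unfolding D_def norm_mult[symmetric] by (simp add: algebra_simps power2_eq_square)
    ultimately have "cmod (\<xi> t - x t) \<le> \<epsilon>" "cmod (\<xi> t + x t) \<le> 3"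
      and D: "D = cmod (\<xi> t - x t) * cmod (\<xi> t + x t)" using \<epsilon>(2) x1[of t] by auto
    then have "D \<le> \<epsilon> * 3" unfolding D using \<epsilon>(1) by (intro mult_mono) auto
    have "\<bar>(cmod (\<xi> t))\<^sup>2 - 1\<bar> \<le> D"
      using norm_triangle_ineq3[of "(\<xi> t)\<^sup>2" "(x t)\<^sup>2"] unfolding D_def by (simp add: norm_power x1)
    then have "\<bar>((cmod (\<xi> t))\<^sup>2 - 1) * c t\<bar> \<le> D * \<bar>c t\<bar>" unfolding abs_mult by (intro mult_right_mono) auto
    moreover have "\<bar>Re (((\<xi> t)\<^sup>2 - (x t)\<^sup>2) * \<kappa> t)\<bar> \<le> D * cmod (\<kappa> t)"
      using abs_Re_le_cmod[of "((\<xi> t)\<^sup>2 - (x t)\<^sup>2) * \<kappa> t"] unfolding D_def norm_mult .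
    moreover have "Re (((\<xi> t)\<^sup>2 - (x t)\<^sup>2) * \<kappa> t) = Re ((\<xi> t)\<^sup>2 * \<kappa> t) - cmod (\<kappa> t)"
      using xk[OF t] by (simp add: left_diff_distrib)
    moreover have "D * \<bar>c t\<bar> + D * cmod (\<kappa> t) \<le> (\<epsilon> * 3) * K"
      using \<open>D \<le> \<epsilon> * 3\<close> K(2)[OF t] \<epsilon>(1) unfolding distrib_left[symmetric]
      by (intro mult_mono) (auto simp: D_def)
    moreover have "(\<epsilon> * 3) * K < \<delta>"
    proof -
      have "K * \<epsilon> > 0" using K(1) \<epsilon>(1) by simp
      moreover have "(\<epsilon> * 3) * K = 3 * (K * \<epsilon>)" "4 * K * \<epsilon> = 4 * (K * \<epsilon>)" by simp_all
      ultimately show ?thesis using \<epsilon>(3) by linarith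
    qed
    moreover have "((cmod (\<xi> t))\<^sup>2 - 1) * c t = (cmod (\<xi> t))\<^sup>2 * c t - c t" by (simp add: algebra_simps)
    ultimately show ?thesis using \<delta>(2)[OF t] by linarith
  qed
  then show ?thesis using that cpoly_if_polynomial_function[OF \<xi>(1)] by blast
qed

section \<open>Conjugation when the norms agree\<close>

lemma conjugate_in_AutI:
  assumes h: "h \<in> carrier Aut_SR" and g: "g \<in> carrier Aut_SR" and g': "g' \<in> carrier Aut_SR"
    and eq: "rat_comp g' h = rat_comp h g"
  shows "conjugate_in Aut_SR g g'"
proof -
  interpret Aut: group Aut_SR by (rule group_Aut)
  have "h \<otimes>\<^bsub>Aut_SR\<^esub> g \<otimes>\<^bsub>Aut_SR\<^esub> inv\<^bsub>Aut_SR\<^esub> h = g' \<otimes>\<^bsub>Aut_SR\<^esub> h \<otimes>\<^bsub>Aut_SR\<^esub> inv\<^bsub>Aut_SR\<^esub> h"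
    using eq by simp
  also have "\<dots> = g'" using h g' Aut.m_assoc Aut.r_inv Aut.r_one Aut.inv_closed by (metis)
  finally show ?thesis unfolding conjugate_in_def using h by metis
qed

text \<open>If the norms are positive, the sum of the two trace zero quaternions, scaled to equal norms and
  suitable signs, conjugates one into the other and has positive norm.\<close>

lemma conjugate_if_pos:
  assumes g: "g \<in> carrier Aut_SR" "moebius g (\<lambda>t. \<i> * of_real (poly a t)) b"
    and g': "g' \<in> carrier Aut_SR" "moebius g' (\<lambda>t. \<i> * of_real (poly a' t)) b'"
    and eq: "\<And>t. (poly a t)\<^sup>2 - (1 - t\<^sup>2) * (cmod (b t))\<^sup>2 = (poly a' t)\<^sup>2 - (1 - t\<^sup>2) * (cmod (b' t))\<^sup>2"
    and pos: "\<And>t. t \<in> {-1..1} \<Longrightarrow> (poly a t)\<^sup>2 - (1 - t\<^sup>2) * (cmod (b t))\<^sup>2 > 0"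
    and sgn: "\<And>t. t \<in> {-1..1} \<Longrightarrow> poly a t * poly a' t > 0"
  shows "conjugate_in Aut_SR g g'"
proof -
  define A where "A = (\<lambda>t. \<i> * complex_of_real (poly (a + a') t))"
  define B where "B = (\<lambda>t. b t + b' t)"
  have cb: "cpoly b" "cpoly b'" using moebiusD(3) g(2) g'(2) by auto
  have c: "cpoly A" "cpoly B"
    unfolding A_def B_def by (intro cpoly_mult cpoly_add cpoly_const cpoly_real_poly cb)+
  have "qnorm A B t > 0" if t: "t \<in> {-1..1}" for t
  proof -
    define f where "f = 1 - t\<^sup>2"
    have f: "f \<ge> 0" using t unfolding f_def by (simp add: abs_square_le_1 abs_le_iff)
    have p: "f * (cmod (b t))\<^sup>2 < (poly a t)\<^sup>2" "f * (cmod (b' t))\<^sup>2 < (poly a' t)\<^sup>2"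
      using pos[OF t] eq[of t] unfolding f_def by auto
    \<comment> \<open>A reverse Cauchy-Schwarz estimate: the mixed term f |b| |b'| is dominated by a
      a', which is positive by the choice of signs.\<close>
    have "(f * (cmod (b t))\<^sup>2) * (f * (cmod (b' t))\<^sup>2) \<le> (poly a t)\<^sup>2 * (poly a' t)\<^sup>2"
      using p f by (intro mult_mono) auto
    then have "(f * (cmod (b t) * cmod (b' t)))\<^sup>2 \<le> (poly a t * poly a' t)\<^sup>2"
      by (simp add: power_mult_distrib power2_eq_square algebra_simps)
    then have le: "f * (cmod (b t) * cmod (b' t)) \<le> poly a t * poly a' t"
      using sgn[OF t] by (meson less_imp_le power2_le_imp_le)
    have "f * (cmod (B t))\<^sup>2 \<le> f * (cmod (b t) + cmod (b' t))\<^sup>2"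
      unfolding B_def using f by (intro mult_left_mono power_mono norm_triangle_ineq) auto
    also have "\<dots> = f * (cmod (b t))\<^sup>2 + f * (cmod (b' t))\<^sup>2 + 2 * (f * (cmod (b t) * cmod (b' t)))"
      by (simp add: power2_eq_square algebra_simps)
    also have "\<dots> < (poly a t)\<^sup>2 + (poly a' t)\<^sup>2 + 2 * (poly a t * poly a' t)" using p le by linarith
    also have "\<dots> = (cmod (A t))\<^sup>2" unfolding A_def norm_mult norm_of_real by (simp add: power2_eq_square algebra_simps)
    finally show ?thesis unfolding qnorm_def f_def by simp
  qed
  then obtain H where H: "H \<in> carrier Aut_SR" "moebius H A B" using moebius_construct[OF c] by blast
  have Bir: "g \<in> carrier Bir_S" "H \<in> carrier Bir_S" using g(1) H(1) Aut_carrier_iff by auto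
  have e: "of_real (poly a t) * of_real (poly a t) - (1 - (of_real t)\<^sup>2) * (b t * cnj (b t))
    = of_real (poly a' t) * of_real (poly a' t) - (1 - (of_real t)\<^sup>2) * (b' t * cnj (b' t))" for t
    using arg_cong[OF eq[of t], of complex_of_real]
    by (simp only: of_real_diff of_real_mult complex_norm_square) (simp add: power2_eq_square)
  \<comment> \<open>This is y (x + y) = (x + y) x: the complex components differ by y^2 - x^2, which
    vanishes as the norms agree, and the j-components agree identically.\<close>
  have "qmult1 (\<lambda>t. \<i> * of_real (poly a' t)) b' A B t = qmult1 A B (\<lambda>t. \<i> * of_real (poly a t)) b t" for t
  proof -
    have "qmult1 (\<lambda>t. \<i> * of_real (poly a' t)) b' A B t - qmult1 A B (\<lambda>t. \<i> * of_real (poly a t)) b t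
      = (of_real (poly a t) * of_real (poly a t) - (1 - (of_real t)\<^sup>2) * (b t * cnj (b t)))
      - (of_real (poly a' t) * of_real (poly a' t) - (1 - (of_real t)\<^sup>2) * (b' t * cnj (b' t)))"
      unfolding qmult1_def A_def B_def by (simp add: algebra_simps)
    then show ?thesis using e[of t] by simp
  qed
  moreover have "qmult2 (\<lambda>t. \<i> * of_real (poly a' t)) b' A B = qmult2 A B (\<lambda>t. \<i> * of_real (poly a t)) b"
    unfolding qmult2_def A_def B_def by (simp add: fun_eq_iff algebra_simps)
  ultimately have "rat_comp g' H = rat_comp H g"
    using moebius_comp_Bir[OF g'(2) H(2) Bir(2)] moebius_comp_Bir[OF H(2) g(2) Bir(1)] moebius_unique
    by (metis ext)
  then show ?thesis using conjugate_in_AutI H(1) g(1) g'(1) by blast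
qed

text \<open>If the norms are negative, the trace zero quaternions are \<open>x = (1 - t\<^sup>2) \<alpha> \<i> + b j\<close> and
  \<open>y = (1 - t\<^sup>2) \<alpha>' \<i> + b' j\<close>, and every \<open>\<xi> x + y \<xi>\<close> conjugates \<open>x\<close> into \<open>y\<close>. For \<open>\<xi> \<in> \<complex>[t]\<close> it
  is the product of \<open>\<xi> b + b' cnj \<xi> + \<i> (\<alpha> + \<alpha>') \<xi> j\<close> with \<open>j\<close>.\<close>

lemma conjugate_if_neg:
  assumes g: "g \<in> carrier Aut_SR" "moebius g (\<lambda>t. \<i> * of_real ((1 - t\<^sup>2) * poly \<alpha> t)) b"
    and g': "g' \<in> carrier Aut_SR" "moebius g' (\<lambda>t. \<i> * of_real ((1 - t\<^sup>2) * poly \<alpha>' t)) b'"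
    and eq: "\<And>t. (cmod (b t))\<^sup>2 - (1 - t\<^sup>2) * (poly \<alpha> t)\<^sup>2 = (cmod (b' t))\<^sup>2 - (1 - t\<^sup>2) * (poly \<alpha>' t)\<^sup>2"
    and pos: "\<And>t. t \<in> {-1..1} \<Longrightarrow> (cmod (b t))\<^sup>2 - (1 - t\<^sup>2) * (poly \<alpha> t)\<^sup>2 > 0"
  shows "conjugate_in Aut_SR g g'"
proof -
  define \<mu> where "\<mu> = (\<lambda>t. (cmod (b t))\<^sup>2 - (1 - t\<^sup>2) * (poly \<alpha> t)\<^sup>2)"
  \<comment> \<open>\<open>c\<close> and \<open>\<kappa>\<close> are read off from the norm of
    \<open>A\<close> + \<open>B\<close> j below, which equals 2 (|\<xi>|^2 c + Re (\<xi>^2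
    \<kappa>)).\<close>
  define c where "c = (\<lambda>t. \<mu> t - (1 - t\<^sup>2) * (poly \<alpha> t * poly \<alpha>' t))"
  define \<kappa> where "\<kappa> = (\<lambda>t. b t * cnj (b' t))"
  have cb: "cpoly b" "cpoly b'" using moebiusD(3) g(2) g'(2) by auto
  have nb: "(cmod (b t))\<^sup>2 = \<mu> t + (1 - t\<^sup>2) * (poly \<alpha> t)\<^sup>2" "(cmod (b' t))\<^sup>2 = \<mu> t + (1 - t\<^sup>2) * (poly \<alpha>' t)\<^sup>2" for t
    using eq[of t] unfolding \<mu>_def by simp_all
  have f: "1 - t\<^sup>2 \<ge> 0" if "t \<in> {-1..1}" for t :: real using that by (simp add: abs_square_le_1 abs_le_iff)
  have \<mu>: "\<mu> t > 0" if "t \<in> {-1..1}" for t using pos[OF that] unfolding \<mu>_def .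
  have "continuous_on {-1..1} \<kappa>" unfolding \<kappa>_def using cb by (intro cpoly_continuous cpoly_mult cpoly_cnj)
  moreover have "\<kappa> t \<noteq> 0" if "t \<in> {-1..1}" for t
  proof -
    have "(cmod (b t))\<^sup>2 > 0" "(cmod (b' t))\<^sup>2 > 0"
      unfolding nb using \<mu>[OF that] f[OF that] by (auto intro!: add_pos_nonneg)
    then show ?thesis unfolding \<kappa>_def by auto
  qed
  moreover have "continuous_on {-1..1} c"
    unfolding c_def \<mu>_def using cpoly_continuous[OF cb(1)] by (intro continuous_intros)
  \<comment> \<open>Since |b|^2 and |b'|^2 exceed f \<alpha>^2 and f \<alpha>'^2 by \<mu> > 0, the
    mixed term f \<alpha> \<alpha>' is at most |b b'| = |\<kappa>|, and \<mu> is left over.\<close>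
  moreover have "c t + cmod (\<kappa> t) > 0" if t: "t \<in> {-1..1}" for t
  proof -
    define F where "F = 1 - t\<^sup>2"
    have F: "F \<ge> 0" using f[OF t] unfolding F_def .
    have "(F * (poly \<alpha> t * poly \<alpha>' t))\<^sup>2 = (F * (poly \<alpha> t)\<^sup>2) * (F * (poly \<alpha>' t)\<^sup>2)"
      by (simp add: power2_eq_square algebra_simps)
    also have "\<dots> \<le> (\<mu> t + F * (poly \<alpha> t)\<^sup>2) * (\<mu> t + F * (poly \<alpha>' t)\<^sup>2)"
      using \<mu>[OF t] F by (intro mult_mono) auto
    also have "\<dots> = (cmod (\<kappa> t))\<^sup>2" unfolding \<kappa>_def norm_mult power_mult_distrib complex_mod_cnj nb F_def ..
    finally have "F * (poly \<alpha> t * poly \<alpha>' t) \<le> cmod (\<kappa> t)" by (rule power2_le_imp_le) simp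
    then show ?thesis using \<mu>[OF t] unfolding c_def F_def by simp
  qed
  ultimately obtain \<xi> where \<xi>: "cpoly \<xi>" "\<And>t. t \<in> {-1..1} \<Longrightarrow> (cmod (\<xi> t))\<^sup>2 * c t + Re ((\<xi> t)\<^sup>2 * \<kappa> t) > 0"
    using positive_section by blast
  define A where "A = (\<lambda>t. \<xi> t * b t + b' t * cnj (\<xi> t))"
  define B where "B = (\<lambda>t. \<i> * (of_real (poly (\<alpha> + \<alpha>') t) * \<xi> t))"
  have cAB: "cpoly A" "cpoly B"
    unfolding A_def B_def by (intro cpoly_mult cpoly_add cpoly_const cpoly_real_poly cpoly_cnj cb \<xi>(1))+
  have "qnorm A B t > 0" if t: "t \<in> {-1..1}" for t
  proof -
    have "(cmod (A t))\<^sup>2 = (cmod (\<xi> t))\<^sup>2 * ((cmod (b t))\<^sup>2 + (cmod (b' t))\<^sup>2) + 2 * Re ((\<xi> t)\<^sup>2 * \<kappa> t)"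
      unfolding A_def \<kappa>_def cmod_power2 by (simp add: power2_eq_square algebra_simps)
    moreover have "(cmod (B t))\<^sup>2 = (poly \<alpha> t + poly \<alpha>' t)\<^sup>2 * (cmod (\<xi> t))\<^sup>2"
      unfolding B_def norm_mult norm_of_real by (simp add: power_mult_distrib)
    ultimately have "qnorm A B t = 2 * ((cmod (\<xi> t))\<^sup>2 * c t + Re ((\<xi> t)\<^sup>2 * \<kappa> t))"
      unfolding qnorm_def nb c_def by (simp add: power2_eq_square algebra_simps)
    then show ?thesis using \<xi>(2)[OF t] by simp
  qed
  then obtain H1 where H1: "H1 \<in> carrier Aut_SR" "moebius H1 A B" using moebius_construct[OF cAB] by blast
  obtain J where J: "J \<in> carrier Aut_SR" "moebius J (\<lambda>t. 0) (\<lambda>t. 1)" using moebius_j by blast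
  interpret Aut: group Aut_SR by (rule group_Aut)
  \<comment> \<open>The conjugating quaternion has norm -f times that of \<open>H1\<close>, so it is
    not covered by the construction for positive norms; its two factors are regular
    separately.\<close>
  define H where "H = rat_comp H1 J"
  have H: "H \<in> carrier Aut_SR" using Aut.m_closed[OF H1(1) J(1)] unfolding H_def by simp
  have Bir: "g \<in> carrier Bir_S" "H \<in> carrier Bir_S" "J \<in> carrier Bir_S" using g(1) H J(1) Aut_carrier_iff by auto
  have q: "qmult1 A B (\<lambda>t. 0) (\<lambda>t. 1) = (\<lambda>t. (1 - (of_real t)\<^sup>2) * B t)" "qmult2 A B (\<lambda>t. 0) (\<lambda>t. 1) = A"
    unfolding qmult1_def qmult2_def by (auto simp: fun_eq_iff)
  have mH: "moebius H (\<lambda>t. (1 - (of_real t)\<^sup>2) * B t) A"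
    using moebius_comp_Bir[OF H1(2) J(2) Bir(3)] unfolding H_def q .
  define x where "x = (\<lambda>t. \<i> * complex_of_real ((1 - t\<^sup>2) * poly \<alpha> t))"
  define y where "y = (\<lambda>t. \<i> * complex_of_real ((1 - t\<^sup>2) * poly \<alpha>' t))"
  have e: "b t * cnj (b t) - (1 - (of_real t)\<^sup>2) * (of_real (poly \<alpha> t) * of_real (poly \<alpha> t))
    = b' t * cnj (b' t) - (1 - (of_real t)\<^sup>2) * (of_real (poly \<alpha>' t) * of_real (poly \<alpha>' t))" for t
    using arg_cong[OF eq[of t], of complex_of_real]
    by (simp only: of_real_diff of_real_mult complex_norm_square) (simp add: power2_eq_square)
  have 1: "qmult1 y b' (\<lambda>t. (1 - (of_real t)\<^sup>2) * B t) A t = qmult1 (\<lambda>t. (1 - (of_real t)\<^sup>2) * B t) A x b t" for t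
  proof -
    define F :: complex where "F = 1 - (of_real t)\<^sup>2"
    have x: "x t = \<i> * (F * of_real (poly \<alpha> t))" "y t = \<i> * (F * of_real (poly \<alpha>' t))" unfolding x_def y_def F_def by simp_all
    have "qmult1 y b' (\<lambda>t. (1 - (of_real t)\<^sup>2) * B t) A t - qmult1 (\<lambda>t. (1 - (of_real t)\<^sup>2) * B t) A x b t
      = F * \<xi> t * ((b' t * cnj (b' t) - F * (of_real (poly \<alpha>' t) * of_real (poly \<alpha>' t)))
          - (b t * cnj (b t) - F * (of_real (poly \<alpha> t) * of_real (poly \<alpha> t))))"
      unfolding qmult1_def F_def[symmetric] x A_def B_def by (simp add: algebra_simps)
    then show ?thesis using e[of t] unfolding F_def by simp
  qed
  have 2: "qmult2 y b' (\<lambda>t. (1 - (of_real t)\<^sup>2) * B t) A t = qmult2 (\<lambda>t. (1 - (of_real t)\<^sup>2) * B t) A x b t" for t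
  proof -
    define F :: complex where "F = 1 - (of_real t)\<^sup>2"
    have x: "x t = \<i> * (F * of_real (poly \<alpha> t))" "y t = \<i> * (F * of_real (poly \<alpha>' t))" unfolding x_def y_def F_def by simp_all
    have F: "cnj F = F" unfolding F_def by simp
    show ?thesis unfolding qmult2_def F_def[symmetric] x A_def B_def by (simp add: F algebra_simps)
  qed
  have "rat_comp g' H = rat_comp H g"
  proof (rule moebius_unique)
    show "moebius (rat_comp g' H) (qmult1 y b' (\<lambda>t. (1 - (of_real t)\<^sup>2) * B t) A)
        (qmult2 y b' (\<lambda>t. (1 - (of_real t)\<^sup>2) * B t) A)"
      using moebius_comp_Bir[OF g'(2) mH Bir(2)] unfolding y_def .
    show "moebius (rat_comp H g) (qmult1 y b' (\<lambda>t. (1 - (of_real t)\<^sup>2) * B t) A)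
        (qmult2 y b' (\<lambda>t. (1 - (of_real t)\<^sup>2) * B t) A)"
      unfolding ext[of "qmult1 y b' _ A", OF 1] ext[of "qmult2 y b' _ A", OF 2]
      using moebius_comp_Bir[OF mH g(2) Bir(1)] unfolding x_def .
  qed
  then show ?thesis using conjugate_in_AutI H g(1) g'(1) by blast
qed

section \<open>Rescaling to equal norms\<close>

lemma qnorm_pure: "qnorm (\<lambda>t. \<i> * of_real (a t)) b t = (a t)\<^sup>2 - (1 - t\<^sup>2) * (cmod (b t))\<^sup>2"
  unfolding qnorm_def by (simp add: norm_mult)

lemma moebius_scale_pure:
  assumes "moebius g (\<lambda>t. \<i> * of_real (a t)) b" "poly c s \<noteq> 0"
  shows "moebius g (\<lambda>t. \<i> * of_real (poly c t * a t)) (\<lambda>t. of_real (poly c t) * b t)"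
proof -
  have "moebius g (\<lambda>t. of_real (poly c t) * (\<i> * of_real (a t))) (\<lambda>t. of_real (poly c t) * b t)"
    by (rule moebius_scale[OF assms(1) cpoly_real_poly, where s = s]) (use assms(2) in simp_all)
  then show ?thesis by (simp add: mult.left_commute)
qed

text \<open>Scaling the first quaternion by N' and the second by S, where S^2 = N N', gives both the
  norm N'^2 N. For negative norms a factor 1 - t^2 is first split off from N, N' and S, and the
  cofactors M, M' and T take their places.\<close>

lemma conjugate_in_Aut:
  assumes g: "g \<in> carrier Aut_SR" "cpoly b" "moebius g (\<lambda>t. \<i> * of_real (poly a t)) b"
      "\<And>t. poly a t \<noteq> 0 \<or> b t \<noteq> 0"
    and g': "g' \<in> carrier Aut_SR" "cpoly b'" "moebius g' (\<lambda>t. \<i> * of_real (poly a' t)) b'"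
      "\<And>t. poly a' t \<noteq> 0 \<or> b' t \<noteq> 0"
    and S: "\<And>t. (poly S t)\<^sup>2 = ((poly a t)\<^sup>2 - (1 - t\<^sup>2) * (cmod (b t))\<^sup>2) * ((poly a' t)\<^sup>2 - (1 - t\<^sup>2) * (cmod (b' t))\<^sup>2)"
  shows "conjugate_in Aut_SR g g'"
proof -
  obtain B where B: "\<And>t. (cmod (b t))\<^sup>2 = poly B t" using cmod_poly[OF g(2)] by blast
  obtain B' where B': "\<And>t. (cmod (b' t))\<^sup>2 = poly B' t" using cmod_poly[OF g'(2)] by blast
  define N where "N = a ^ 2 - [:1, 0, -1:] * B"
  define N' where "N' = a' ^ 2 - [:1, 0, -1:] * B'"
  have N: "poly N t = (poly a t)\<^sup>2 - (1 - t\<^sup>2) * (cmod (b t))\<^sup>2"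
    "poly N' t = (poly a' t)\<^sup>2 - (1 - t\<^sup>2) * (cmod (b' t))\<^sup>2" for t
    unfolding N_def N'_def B B' by (simp_all add: power2_eq_square algebra_simps)
  have SN: "(poly S t)\<^sup>2 = poly N t * poly N' t" for t using S[of t] unfolding N .
  have nz: "poly N t \<noteq> 0" "poly N' t \<noteq> 0" if t: "-1 < t" "t < 1" for t
    using Aut_qnorm_nonzero[OF g(1,3) t] Aut_qnorm_nonzero[OF g'(1,3) t] g(4)[of t] g'(4)[of t]
    unfolding qnorm_pure N by auto
  have sgn: "(\<forall>t\<in>{-1<..<1}. poly N t > 0) \<or> (\<forall>t\<in>{-1<..<1}. poly N t < 0)"
    by (rule poly_constant_sign) (use nz in \<open>auto simp: is_interval_1\<close>)
  \<comment> \<open>The product of the two norms is a square and non-zero inside the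
    interval.\<close>
  have same: "poly N t > 0 \<longleftrightarrow> poly N' t > 0" if t: "-1 < t" "t < 1" for t
    using SN[of t] nz[OF t] zero_le_power2[of "poly S t"] by (auto simp: zero_le_mult_iff)
  have Nend: "poly N t = (poly a t)\<^sup>2" "poly N' t = (poly a' t)\<^sup>2" if "t\<^sup>2 = 1" for t
    using that unfolding N by auto
  from sgn show ?thesis
  proof
    assume pos: "\<forall>t\<in>{-1<..<1}. poly N t > 0"
    have pos': "poly N' t > 0" if "-1 < t" "t < 1" for t using same that pos by simp
    have N_pos: "poly N t > 0 \<and> poly N' t > 0" if t: "t \<in> {-1..1}" for t
    proof (rule endpoint_cases[OF t])
      assume "-1 < t" "t < 1"
      then show ?thesis using pos pos' by simp
    next
      assume e: "t\<^sup>2 = 1"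
      \<comment> \<open>At an endpoint the norm is a^2. A zero of a would force b to vanish there as
        well, against primitivity.\<close>
      have "poly a t \<noteq> 0"
      proof
        assume z: "poly a t = 0"
        have "poly B t \<le> 0" by (rule square_eq_endpoint_bound[OF e z]) (use pos N(1) B in auto)
        then have "b t = 0" using B[of t] by (metis norm_eq_zero power2_less_eq_zero_iff)
        then show False using g(4)[of t] z by simp
      qed
      moreover have "poly a' t \<noteq> 0"
      proof
        assume z: "poly a' t = 0"
        have "poly B' t \<le> 0" by (rule square_eq_endpoint_bound[OF e z]) (use pos' N(2) B' in auto)
        then have "b' t = 0" using B'[of t] by (metis norm_eq_zero power2_less_eq_zero_iff)
        then show False using g'(4)[of t] z by simp
      qed
      ultimately show ?thesis using Nend[OF e] by simp
    qed
    have S_nz: "poly S t \<noteq> 0" if t: "t \<in> {-1..1}" for t using SN[of t] N_pos[OF t] by auto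
    have a_nz: "poly a t \<noteq> 0" "poly a' t \<noteq> 0" if t: "t \<in> {-1..1}" for t
    proof -
      have "(1 - t\<^sup>2) * (cmod (b t))\<^sup>2 \<ge> 0" "(1 - t\<^sup>2) * (cmod (b' t))\<^sup>2 \<ge> 0"
        using t by (simp_all add: abs_square_le_1 abs_le_iff)
      then show "poly a t \<noteq> 0" "poly a' t \<noteq> 0" using N_pos[OF t] unfolding N by auto
    qed
    \<comment> \<open>This is the product of the scaled coefficients \<open>N' * a\<close> and
      \<open>S * a'\<close>. Changing the sign of S makes it positive, which prevents the sum of the
      two quaternions from degenerating.\<close>
    have "poly (N' * a * S * a') t \<noteq> 0" if "t \<in> {-1..1}" for t
      using a_nz[OF that] S_nz[OF that] N_pos[OF that] by simp
    then have "(\<forall>t\<in>{-1..1}. poly (N' * a * S * a') t > 0) \<or> (\<forall>t\<in>{-1..1}. poly (N' * a * S * a') t < 0)"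
      by (intro poly_constant_sign) (auto simp: is_interval_1)
    then obtain \<sigma> where \<sigma>: "\<sigma>\<^sup>2 = (1 :: real)" "\<And>t. t \<in> {-1..1} \<Longrightarrow> \<sigma> * poly (N' * a * S * a') t > 0"
      by (elim disjE) (auto intro: that[of 1] that[of "-1"])
    define T where "T = Polynomial.smult \<sigma> S"
    have T2: "(poly T t)\<^sup>2 = poly N t * poly N' t" for t
      unfolding T_def using \<sigma>(1) SN[of t] by (simp add: power_mult_distrib)
    have m: "moebius g (\<lambda>t. \<i> * of_real (poly (N' * a) t)) (\<lambda>t. of_real (poly N' t) * b t)"
      using moebius_scale_pure[OF g(3), of N' 0] N_pos[of 0] by simp
    have "\<sigma> \<noteq> 0" using \<sigma>(1) by auto
    then have "poly T 0 \<noteq> 0" unfolding T_def using S_nz[of 0] by simp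
    then have m': "moebius g' (\<lambda>t. \<i> * of_real (poly (T * a') t)) (\<lambda>t. of_real (poly T t) * b' t)"
      using moebius_scale_pure[OF g'(3), of T 0] by simp
    have n1: "(poly (N' * a) t)\<^sup>2 - (1 - t\<^sup>2) * (cmod (of_real (poly N' t) * b t))\<^sup>2 = (poly N' t)\<^sup>2 * poly N t" for t
      unfolding N(1) by (simp add: norm_mult power_mult_distrib algebra_simps)
    have n2: "(poly (T * a') t)\<^sup>2 - (1 - t\<^sup>2) * (cmod (of_real (poly T t) * b' t))\<^sup>2 = (poly T t)\<^sup>2 * poly N' t" for t
      unfolding N(2) by (simp add: norm_mult power_mult_distrib algebra_simps)
    show ?thesis
    proof (rule conjugate_if_pos[OF g(1) m g'(1) m'], unfold n1 n2)
      show "(poly N' t)\<^sup>2 * poly N t = (poly T t)\<^sup>2 * poly N' t" for t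
        unfolding T2 by (simp add: power2_eq_square)
      show "(poly N' t)\<^sup>2 * poly N t > 0" if "t \<in> {-1..1}" for t using N_pos[OF that] by simp
      show "poly (N' * a) t * poly (T * a') t > 0" if "t \<in> {-1..1}" for t
        using \<sigma>(2)[OF that] unfolding T_def by (simp add: algebra_simps)
    qed
  next
    assume neg: "\<forall>t\<in>{-1<..<1}. poly N t < 0"
    have neg': "poly N' t < 0" if "-1 < t" "t < 1" for t
    proof -
      have "poly N t < 0" using neg that by simp
      then have "\<not> poly N' t > 0" using same[OF that] by simp
      then show ?thesis using nz(2)[OF that] by simp
    qed
    have le: "poly N t \<le> 0" "poly N' t \<le> 0" if "t \<in> {-1..1}" for t
      using poly_nonneg_closure[of "- N" t] poly_nonneg_closure[of "- N'" t] neg neg' that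
      by (auto simp: less_imp_le)
    \<comment> \<open>At the endpoints the norm is both a square and, by continuity, at most 0. So a
      and a' are divisible by 1 - t^2.\<close>
    have "poly a t = 0" "poly a' t = 0" if "t\<^sup>2 = 1" for t
      using le[of t] Nend[OF that] that by (auto simp: power2_eq_1_iff)
    then obtain \<alpha> \<alpha>' where \<alpha>: "\<And>t. poly a t = (1 - t\<^sup>2) * poly \<alpha> t" "\<And>t. poly a' t = (1 - t\<^sup>2) * poly \<alpha>' t"
      using poly_divide_1_minus_square[of a] poly_divide_1_minus_square[of a'] by (metis one_power2 power2_minus)
    define M where "M = B - [:1, 0, -1:] * \<alpha> ^ 2"
    define M' where "M' = B' - [:1, 0, -1:] * \<alpha>' ^ 2"
    have M: "poly M t = (cmod (b t))\<^sup>2 - (1 - t\<^sup>2) * (poly \<alpha> t)\<^sup>2"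
      "poly M' t = (cmod (b' t))\<^sup>2 - (1 - t\<^sup>2) * (poly \<alpha>' t)\<^sup>2" for t
      unfolding M_def M'_def B B' by (simp_all add: power2_eq_square algebra_simps)
    have NM: "poly N t = - ((1 - t\<^sup>2) * poly M t)" "poly N' t = - ((1 - t\<^sup>2) * poly M' t)" for t
      unfolding M N \<alpha> by (simp_all add: power2_eq_square algebra_simps)
    have M_pos: "poly M t > 0 \<and> poly M' t > 0" if t: "t \<in> {-1..1}" for t
    proof (rule endpoint_cases[OF t])
      assume t: "-1 < t" "t < 1"
      then have "1 - t\<^sup>2 > 0" using abs_square_less_1[of t] by simp
      moreover have "poly N t < 0" "poly N' t < 0" using neg neg' t by simp_all
      then have "(1 - t\<^sup>2) * poly M t > 0" "(1 - t\<^sup>2) * poly M' t > 0" unfolding NM by simp_all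
      ultimately show ?thesis by (simp add: zero_less_mult_iff)
    next
      assume e: "t\<^sup>2 = 1"
      \<comment> \<open>At the endpoints M = |b|^2, and primitivity makes b non-zero where a
        vanishes; likewise for M'.\<close>
      then have "poly a t = 0" "poly a' t = 0" using \<alpha> by auto
      then show ?thesis using M[of t] e g(4)[of t] g'(4)[of t] by simp
    qed
    have "poly S t = 0" if "t\<^sup>2 = 1" for t using SN[of t] NM(1)[of t] that by simp
    then obtain T where T: "\<And>t. poly S t = (1 - t\<^sup>2) * poly T t"
      using poly_divide_1_minus_square[of S] by (metis one_power2 power2_minus)
    \<comment> \<open>Cancelling (1 - t^2)^2 is possible only inside the interval; the polynomial
      identity then extends to all t.\<close>
    have "of_real (poly (T ^ 2 - M * M') t) = (0 :: complex)" for t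
    proof (rule cpoly_eq_0[OF cpoly_real_poly])
      fix s :: real assume "-1 < s" "s < 1"
      then have "s\<^sup>2 < 1" using abs_square_less_1[of s] by simp
      then have "1 - s\<^sup>2 \<noteq> 0" by simp
      moreover have "(1 - s\<^sup>2)\<^sup>2 * (poly T s)\<^sup>2 = (1 - s\<^sup>2)\<^sup>2 * (poly M s * poly M' s)"
        using SN[of s] unfolding T NM by (simp add: power2_eq_square algebra_simps)
      ultimately show "of_real (poly (T ^ 2 - M * M') s) = (0 :: complex)" by simp
    qed
    then have "poly (T ^ 2 - M * M') t = 0" for t by (simp only: of_real_eq_0_iff)
    then have T2: "(poly T t)\<^sup>2 = poly M t * poly M' t" for t by simp
    have T_nz: "poly T 0 \<noteq> 0" using T2[of 0] M_pos[of 0] by auto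
    have m: "moebius g (\<lambda>t. \<i> * of_real ((1 - t\<^sup>2) * poly (M' * \<alpha>) t)) (\<lambda>t. of_real (poly M' t) * b t)"
      using moebius_scale_pure[OF g(3), of M' 0] M_pos[of 0] unfolding \<alpha> by (simp add: mult.left_commute)
    have m': "moebius g' (\<lambda>t. \<i> * of_real ((1 - t\<^sup>2) * poly (T * \<alpha>') t)) (\<lambda>t. of_real (poly T t) * b' t)"
      using moebius_scale_pure[OF g'(3), of T 0] T_nz unfolding \<alpha> by (simp add: mult.left_commute)
    have n1: "(cmod (of_real (poly M' t) * b t))\<^sup>2 - (1 - t\<^sup>2) * (poly (M' * \<alpha>) t)\<^sup>2 = (poly M' t)\<^sup>2 * poly M t" for t
      unfolding M(1) by (simp add: norm_mult power_mult_distrib algebra_simps)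
    have n2: "(cmod (of_real (poly T t) * b' t))\<^sup>2 - (1 - t\<^sup>2) * (poly (T * \<alpha>') t)\<^sup>2 = (poly T t)\<^sup>2 * poly M' t" for t
      unfolding M(2) by (simp add: norm_mult power_mult_distrib algebra_simps)
    show ?thesis
    proof (rule conjugate_if_neg[OF g(1) m g'(1) m'], unfold n1 n2)
      show "(poly M' t)\<^sup>2 * poly M t = (poly T t)\<^sup>2 * poly M' t" for t
        unfolding T2 by (simp add: power2_eq_square)
      show "(poly M' t)\<^sup>2 * poly M t > 0" if "t \<in> {-1..1}" for t using M_pos[OF that] by simp
    qed
  qed
qed

theorem theorem5p30:
  fixes g g' :: rational_map
  assumes "g \<in> carrier Aut_SR" and "group.ord Aut_SR g = 2"
    and "g' \<in> carrier Aut_SR" and "group.ord Aut_SR g' = 2"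
  shows "conjugate_in Bir_S g g' \<longleftrightarrow> conjugate_in Aut_SR g g'"
proof
  assume "conjugate_in Aut_SR g g'"
  then show "conjugate_in Bir_S g g'"
    unfolding conjugate_in_def using Aut_inv Aut_carrier_iff by auto
next
  assume "conjugate_in Bir_S g g'"
  then obtain h where h: "h \<in> carrier Bir_S" "g' = rat_comp (rat_comp h g) (inv\<^bsub>Bir_S\<^esub> h)"
    unfolding conjugate_in_def by auto
  have Bir: "g \<in> carrier Bir_S" "g' \<in> carrier Bir_S" using assms(1,3) Aut_carrier_iff by auto
  note o = Aut_order_2[OF assms(1,2)] Aut_order_2[OF assms(3,4)]
  obtain a b where ab: "cpoly b" "moebius g (\<lambda>t. \<i> * of_real (poly a t)) b" "\<And>t. poly a t \<noteq> 0 \<or> b t \<noteq> 0"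
    using involution_primitive[OF Bir(1) o(1,2)] by metis
  obtain a' b' where ab': "cpoly b'" "moebius g' (\<lambda>t. \<i> * of_real (poly a' t)) b'" "\<And>t. poly a' t \<noteq> 0 \<or> b' t \<noteq> 0"
    using involution_primitive[OF Bir(2) o(3,4)] by metis
  obtain S where "\<And>t. (poly S t)\<^sup>2 = qnorm (\<lambda>t. \<i> * of_real (poly a t)) b t * qnorm (\<lambda>t. \<i> * of_real (poly a' t)) b' t"
    using conjugate_qnorm[OF h(1) Bir h(2) o(3) ab(2) ab'(2)] by metis
  then show "conjugate_in Aut_SR g g'"
    using conjugate_in_Aut[OF assms(1) ab assms(3) ab'] unfolding qnorm_pure by blast
qed

end
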